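(* The 2-functors $\mathrm Q:\mathbf{RD}_l\to\mathbf{QRD}_l$ (intensional quotient completion, $R\mapsto R^q$) and $\mathrm U_q:\mathbf{QRD}_l\to\mathbf{RD}_l$ (inclusion) form a lax 2-adjunction $\mathrm Q\dashv_l\mathrm U_q$. That is, for every relational doctrine $R$ and every relational doctrine with quotients $S$, the functor $$\mathrm U_q(-)\circ E^R:\ \mathbf{QRD}_l(R^q,S)\longrightarrow \mathbf{RD}_l(R,\mathrm U_q(S))$$ has a reflection left adjoint (i.e. a left adjoint such that the counit of the adjunction is an isomorphism).
   Context: $\mathbf{Pos}$ is the category of posets and monotone maps. A relational doctrine consists of a category $\mathcal C$ (its base); a functor $R:(\mathcal C\times\mathcal C)^{op}\to\mathbf{Pos}$ (for $f:X\to A$, $g:Y\to B$ write $R_{f,g}:R(A,B)\to R(X,Y)$); elements $d_X\in R(X,X)$ with $d_X\le R_{f,f}(d_Y)$ for all $f:X\to Y$; monotone maps $;:R(X,Y)\times R(Y,Z)\to R(X,Z)$ with $R_{f,g}(\alpha);R_{g,h}(\beta)\le R_{f,h}(\alpha;\beta)$; monotone maps $(-)^\bot:R(X,Y)\to R(Y,X)$ with $(R_{f,g}(\alpha))^\bot\le R_{g,f}(\alpha^\bot)$; such that $;$ is associative with units $d$, $(\alpha;\beta)^\bot=\beta^\bot;\alpha^\bot$, $d_X^\bot=d_X$, $\alpha^{\bot\bot}=\alpha$. The graph of $f:X\to Y$ is $\Gamma_f=R_{f,\mathrm{id}_Y}(d_Y)\in R(X,Y)$. An $R$-equivalence relation on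 $X$ is $\rho\in R(X,X)$ with $d_X\le\rho$, $\rho^\bot\le\rho$, $\rho;\rho\le\rho$. A quotient arrow of $\rho$ is $q:X\to W$ with $\rho\le\Gamma_q;\Gamma_q^\bot$ such that for every $f:X\to Z$ with $\rho\le\Gamma_f;\Gamma_f^\bot$ there is a unique $h:W\to Z$ with $f=h\circ q$. It is effective if $\rho=\Gamma_q;\Gamma_q^\bot$, and descent if $d_W\le\Gamma_q^\bot;\Gamma_q$. $R$ has quotients if every $R$-equivalence relation admits an effective descent quotient arrow. The 2-category $\mathbf{RD}_l$: objects are relational doctrines; a 1-arrow $F:R\to S$ (bases $\mathcal C,\mathcal D$) is a pair of a functor $\widehat F:\mathcal C\to\mathcal D$ and a natural transformation with components $\overline F_{X,Y}:R(X,Y)\to S(\widehat FX,\widehat FY)$ such that $d_{\widehat FX}\le\overline F_{X,X}(d_X)$, $\overline F_{X,Y}(\alpha);\overline F_{Y,Z}(\beta)\le\overline F_{X,Z}(\alpha;\beta)$, $(\overline F_{X,Y}(\alpha))^\bot\le\overline F_{Y,X}(\alpha^\bot)$; a 2-arrow $\theta:F\Rightarrow G$ is a natural transformation $\theta:\widehat F\to\widehat G$ with $\overline F_{X,Y}(\alpha)\le S_{\theta_X,\theta_Y}(\overline G_{X,Y}(\alpha))$ for all $\alpha \in R(X,Y)$. $\mathbf{QRD}_l$ is the sub-2-category (full on 2-arrows) of relational doctrines with quotients and 1-arrows $F$ preserving quotient arrows: if $q$ is a quotient arrow of an $R$-equivalence relation $\rho$ on $X$ then $\widehat Fq$ is a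 quotient arrow of $\overline F_{X,X}(\rho)$. Intensional quotient completion $R^q$ of $R$ (base $\mathcal C$): the base has objects the pairs $(X,\rho)$ with $\rho$ an $R$-equivalence relation on $X$; arrows $(X,\rho)\to(Y,\sigma)$ are the arrows $f:X\to Y$ of $\mathcal C$ with $\rho\le R_{f,f}(\sigma)$; composition and identities as in $\mathcal C$. The fibres are $R^q((X,\rho),(Y,\sigma))=\{\alpha\in R(X,Y)\mid\rho^\bot;\alpha;\sigma\le\alpha\}$, reindexing, composition and converse are those of $R$, and $d_{(X,\rho)}=\rho$. On 1-arrows, $\mathrm Q(F)=F^q$ with $\widehat{F^q}(X,\rho)=(\widehat FX,\overline F_{X,X}(\rho))$, $\widehat{F^q}f=\widehat Ff$, $\overline{F^q}_{(X,\rho),(Y,\sigma)}(\alpha)=\overline F_{X,Y}(\alpha)$; on 2-arrows $\theta^q_{(X,\rho)}=\theta_X$. The 1-arrow $E^R:R\to R^q$ has $\widehat{E^R}X=(X,d_X)$, $\widehat{E^R}f=f$, and $\overline{E^R}$ the identity. *)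

theory Defs
  imports "HOL-Library.FuncSet"
begin

section \<open>Categories\<close>

text \<open>
  Hom-sets need not be disjoint: an arrow carries no domain or codomain, and every operation
  takes the objects involved as arguments.  \<open>Comp C X Y Z g f\<close> is \<open>g \<circ> f\<close> for
  \<open>f : X \<rightarrow> Y\<close> and \<open>g : Y \<rightarrow> Z\<close>.
\<close>

record ('o, 'a) cat =
  Obj :: "'o set"
  Hom :: "'o \<Rightarrow> 'o \<Rightarrow> 'a set"
  Ident :: "'o \<Rightarrow> 'a"
  Comp :: "'o \<Rightarrow> 'o \<Rightarrow> 'o \<Rightarrow> 'a \<Rightarrow> 'a \<Rightarrow> 'a"

locale category =
  fixes C :: "('o, 'a, 'm) cat_scheme"
  assumes ident_in: "X \<in> Obj C \<Longrightarrow> Ident C X \<in> Hom C X X"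
    and comp_in: "\<lbrakk>X \<in> Obj C; Y \<in> Obj C; Z \<in> Obj C; f \<in> Hom C X Y; g \<in> Hom C Y Z\<rbrakk>
      \<Longrightarrow> Comp C X Y Z g f \<in> Hom C X Z"
    and comp_ident_right: "\<lbrakk>X \<in> Obj C; Y \<in> Obj C; f \<in> Hom C X Y\<rbrakk>
      \<Longrightarrow> Comp C X X Y f (Ident C X) = f"
    and comp_ident_left: "\<lbrakk>X \<in> Obj C; Y \<in> Obj C; f \<in> Hom C X Y\<rbrakk>
      \<Longrightarrow> Comp C X Y Y (Ident C Y) f = f"
    and comp_assoc: "\<lbrakk>X \<in> Obj C; Y \<in> Obj C; Z \<in> Obj C; V \<in> Obj C;
        f \<in> Hom C X Y; g \<in> Hom C Y Z; h \<in> Hom C Z V\<rbrakk>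
      \<Longrightarrow> Comp C X Z V h (Comp C X Y Z g f) = Comp C X Y V (Comp C Y Z V h g) f"

definition iso_in :: "('o, 'a, 'm) cat_scheme \<Rightarrow> 'o \<Rightarrow> 'o \<Rightarrow> 'a \<Rightarrow> bool" where
  "iso_in C X Y f \<longleftrightarrow> f \<in> Hom C X Y \<and>
     (\<exists>g \<in> Hom C Y X. Comp C X Y X g f = Ident C X \<and> Comp C Y X Y f g = Ident C Y)"

text \<open>
  Functors and natural transformations take the value \<open>undefined\<close> outside their domain, so
  that HOL equality of functors and of natural transformations is the intended equality.
  \<open>mk_arr\<close> cuts an action on arrows down to its domain.
\<close>

record ('o, 'a, 'p, 'b) cfun =
  FObj :: "'o \<Rightarrow> 'p"
  FArr :: "'o \<Rightarrow> 'o \<Rightarrow> 'a \<Rightarrow> 'b"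

definition mk_arr :: "('o, 'a, 'm) cat_scheme \<Rightarrow> ('o \<Rightarrow> 'o \<Rightarrow> 'a \<Rightarrow> 'b) \<Rightarrow> 'o \<Rightarrow> 'o \<Rightarrow> 'a \<Rightarrow> 'b"
where
  "mk_arr C t = (\<lambda>X Y f. if X \<in> Obj C \<and> Y \<in> Obj C \<and> f \<in> Hom C X Y then t X Y f else undefined)"

locale cat_functor = dom: category C + cod: category D
  for C :: "('o, 'a, 'm) cat_scheme" and D :: "('p, 'b, 'n) cat_scheme" +
  fixes F :: "('o, 'a, 'p, 'b, 'k) cfun_scheme"
  assumes obj_in: "FObj F \<in> Obj C \<rightarrow>\<^sub>E Obj D"
    and arr_in: "\<lbrakk>X \<in> Obj C; Y \<in> Obj C; f \<in> Hom C X Y\<rbrakk>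
      \<Longrightarrow> FArr F X Y f \<in> Hom D (FObj F X) (FObj F Y)"
    and arr_undefined: "\<not> (X \<in> Obj C \<and> Y \<in> Obj C \<and> f \<in> Hom C X Y) \<Longrightarrow> FArr F X Y f = undefined"
    and preserves_ident: "X \<in> Obj C \<Longrightarrow> FArr F X X (Ident C X) = Ident D (FObj F X)"
    and preserves_comp: "\<lbrakk>X \<in> Obj C; Y \<in> Obj C; Z \<in> Obj C; f \<in> Hom C X Y; g \<in> Hom C Y Z\<rbrakk>
      \<Longrightarrow> FArr F X Z (Comp C X Y Z g f) =
          Comp D (FObj F X) (FObj F Y) (FObj F Z) (FArr F Y Z g) (FArr F X Y f)"

definition id_functor :: "('o, 'a, 'm) cat_scheme \<Rightarrow> ('o, 'a, 'o, 'a) cfun" where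
  "id_functor C = \<lparr>FObj = (\<lambda>X\<in>Obj C. X), FArr = mk_arr C (\<lambda>X Y f. f)\<rparr>"

definition comp_functor ::
  "('o, 'a, 'm) cat_scheme \<Rightarrow> ('p, 'b, 'q, 'c, 'l) cfun_scheme \<Rightarrow> ('o, 'a, 'p, 'b, 'k) cfun_scheme
   \<Rightarrow> ('o, 'a, 'q, 'c) cfun" where
  "comp_functor C G F =
    \<lparr>FObj = (\<lambda>X\<in>Obj C. FObj G (FObj F X)),
     FArr = mk_arr C (\<lambda>X Y f. FArr G (FObj F X) (FObj F Y) (FArr F X Y f))\<rparr>"

definition nat_trans ::
  "('o, 'a, 'm) cat_scheme \<Rightarrow> ('p, 'b, 'n) cat_scheme \<Rightarrow> ('o, 'a, 'p, 'b, 'k) cfun_scheme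
   \<Rightarrow> ('o, 'a, 'p, 'b, 'l) cfun_scheme \<Rightarrow> ('o \<Rightarrow> 'b) set" where
  "nat_trans C D F G =
    {\<theta> \<in> (\<Pi>\<^sub>E X\<in>Obj C. Hom D (FObj F X) (FObj G X)).
       \<forall>X\<in>Obj C. \<forall>Y\<in>Obj C. \<forall>f\<in>Hom C X Y.
         Comp D (FObj F X) (FObj F Y) (FObj G Y) (\<theta> Y) (FArr F X Y f) =
         Comp D (FObj F X) (FObj G X) (FObj G Y) (FArr G X Y f) (\<theta> X)}"

text \<open>\<open>adjunction C D L P \<eta> \<epsilon>\<close>: the functor \<open>L : D \<rightarrow> C\<close> is left adjoint to
  \<open>P : C \<rightarrow> D\<close> with unit \<open>\<eta>\<close> and counit \<open>\<epsilon>\<close>.\<close>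

locale adjunction = left: cat_functor D C L + right: cat_functor C D P
  for C :: "('o, 'a, 'm) cat_scheme" and D :: "('p, 'b, 'n) cat_scheme"
    and L :: "('p, 'b, 'o, 'a) cfun" and P :: "('o, 'a, 'p, 'b) cfun" +
  fixes \<eta> :: "'p \<Rightarrow> 'b" and \<epsilon> :: "'o \<Rightarrow> 'a"
  assumes unit: "\<eta> \<in> nat_trans D D (id_functor D) (comp_functor D P L)"
    and counit: "\<epsilon> \<in> nat_trans C C (comp_functor C L P) (id_functor C)"
    and triangle_left: "X \<in> Obj D \<Longrightarrow>
      Comp C (FObj L X) (FObj L (FObj P (FObj L X))) (FObj L X)
        (\<epsilon> (FObj L X)) (FArr L X (FObj P (FObj L X)) (\<eta> X)) = Ident C (FObj L X)"
    and triangle_right: "A \<in> Obj C \<Longrightarrow>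
      Comp D (FObj P A) (FObj P (FObj L (FObj P A))) (FObj P A)
        (FArr P (FObj L (FObj P A)) A (\<epsilon> A)) (\<eta> (FObj P A)) = Ident D (FObj P A)"

definition has_reflection_left_adjoint ::
  "('o, 'a, 'm) cat_scheme \<Rightarrow> ('p, 'b, 'n) cat_scheme \<Rightarrow> ('o, 'a, 'p, 'b) cfun \<Rightarrow> bool" where
  "has_reflection_left_adjoint C D P \<longleftrightarrow>
    (\<exists>L \<eta> \<epsilon>. adjunction C D L P \<eta> \<epsilon> \<and>
       (\<forall>A\<in>Obj C. iso_in C (FObj L (FObj P A)) A (\<epsilon> A)))"


section \<open>Relational doctrines\<close>

text \<open>
  A doctrine extends its base category.  For \<open>f : X \<rightarrow> A\<close>, \<open>g : Y \<rightarrow> B\<close> and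
  \<open>\<alpha>\<close> in the fibre over \<open>(A, B)\<close>, \<open>Reidx R X A Y B f g \<alpha>\<close> is the reindexing
  of \<open>\<alpha>\<close> along \<open>(f, g)\<close>; \<open>Diag\<close> is the unit relation, \<open>RComp R X Y Z \<alpha> \<beta>\<close> is the
  relational composite \<open>\<alpha> ; \<beta>\<close> (in diagrammatic order) and \<open>Conv\<close> the converse.
\<close>

record ('o, 'a, 'r) doctrine = "('o, 'a) cat" +
  Fib :: "'o \<Rightarrow> 'o \<Rightarrow> 'r set"
  Le :: "'o \<Rightarrow> 'o \<Rightarrow> 'r \<Rightarrow> 'r \<Rightarrow> bool"
  Reidx :: "'o \<Rightarrow> 'o \<Rightarrow> 'o \<Rightarrow> 'o \<Rightarrow> 'a \<Rightarrow> 'a \<Rightarrow> 'r \<Rightarrow> 'r"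
  Diag :: "'o \<Rightarrow> 'r"
  RComp :: "'o \<Rightarrow> 'o \<Rightarrow> 'o \<Rightarrow> 'r \<Rightarrow> 'r \<Rightarrow> 'r"
  Conv :: "'o \<Rightarrow> 'o \<Rightarrow> 'r \<Rightarrow> 'r"

locale relational_doctrine = category R for R :: "('o, 'a, 'r) doctrine" +
  assumes le_refl: "\<lbrakk>X \<in> Obj R; Y \<in> Obj R\<rbrakk> \<Longrightarrow> reflp_on (Fib R X Y) (Le R X Y)"
    and le_trans: "\<lbrakk>X \<in> Obj R; Y \<in> Obj R\<rbrakk> \<Longrightarrow> transp_on (Fib R X Y) (Le R X Y)"
    and le_antisym: "\<lbrakk>X \<in> Obj R; Y \<in> Obj R\<rbrakk> \<Longrightarrow> antisymp_on (Fib R X Y) (Le R X Y)"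
    and reidx_in: "\<lbrakk>X \<in> Obj R; A \<in> Obj R; Y \<in> Obj R; B \<in> Obj R; f \<in> Hom R X A; g \<in> Hom R Y B;
        \<alpha> \<in> Fib R A B\<rbrakk> \<Longrightarrow> Reidx R X A Y B f g \<alpha> \<in> Fib R X Y"
    and reidx_mono: "\<lbrakk>X \<in> Obj R; A \<in> Obj R; Y \<in> Obj R; B \<in> Obj R; f \<in> Hom R X A; g \<in> Hom R Y B\<rbrakk>
      \<Longrightarrow> monotone_on (Fib R A B) (Le R A B) (Le R X Y) (Reidx R X A Y B f g)"
    and reidx_ident: "\<lbrakk>A \<in> Obj R; B \<in> Obj R; \<alpha> \<in> Fib R A B\<rbrakk>
      \<Longrightarrow> Reidx R A A B B (Ident R A) (Ident R B) \<alpha> = \<alpha>"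
    and reidx_comp: "\<lbrakk>X \<in> Obj R; A \<in> Obj R; V \<in> Obj R; Y \<in> Obj R; B \<in> Obj R; W \<in> Obj R;
        f \<in> Hom R X A; f' \<in> Hom R A V; g \<in> Hom R Y B; g' \<in> Hom R B W; \<alpha> \<in> Fib R V W\<rbrakk>
      \<Longrightarrow> Reidx R X V Y W (Comp R X A V f' f) (Comp R Y B W g' g) \<alpha> =
          Reidx R X A Y B f g (Reidx R A V B W f' g' \<alpha>)"
    and diag_in: "X \<in> Obj R \<Longrightarrow> Diag R X \<in> Fib R X X"
    and diag_reidx: "\<lbrakk>X \<in> Obj R; Y \<in> Obj R; f \<in> Hom R X Y\<rbrakk>
      \<Longrightarrow> Le R X X (Diag R X) (Reidx R X Y X Y f f (Diag R Y))"
    and rcomp_in: "\<lbrakk>X \<in> Obj R; Y \<in> Obj R; Z \<in> Obj R; \<alpha> \<in> Fib R X Y; \<beta> \<in> Fib R Y Z\<rbrakk>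
      \<Longrightarrow> RComp R X Y Z \<alpha> \<beta> \<in> Fib R X Z"
    and rcomp_mono: "\<lbrakk>X \<in> Obj R; Y \<in> Obj R; Z \<in> Obj R; \<alpha> \<in> Fib R X Y; \<alpha>' \<in> Fib R X Y;
        \<beta> \<in> Fib R Y Z; \<beta>' \<in> Fib R Y Z; Le R X Y \<alpha> \<alpha>'; Le R Y Z \<beta> \<beta>'\<rbrakk>
      \<Longrightarrow> Le R X Z (RComp R X Y Z \<alpha> \<beta>) (RComp R X Y Z \<alpha>' \<beta>')"
    and rcomp_reidx: "\<lbrakk>X \<in> Obj R; Y \<in> Obj R; Z \<in> Obj R; A \<in> Obj R; B \<in> Obj R; C \<in> Obj R;
        f \<in> Hom R X A; g \<in> Hom R Y B; h \<in> Hom R Z C; \<alpha> \<in> Fib R A B; \<beta> \<in> Fib R B C\<rbrakk>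
      \<Longrightarrow> Le R X Z (RComp R X Y Z (Reidx R X A Y B f g \<alpha>) (Reidx R Y B Z C g h \<beta>))
                  (Reidx R X A Z C f h (RComp R A B C \<alpha> \<beta>))"
    and conv_in: "\<lbrakk>X \<in> Obj R; Y \<in> Obj R; \<alpha> \<in> Fib R X Y\<rbrakk> \<Longrightarrow> Conv R X Y \<alpha> \<in> Fib R Y X"
    and conv_mono: "\<lbrakk>X \<in> Obj R; Y \<in> Obj R\<rbrakk>
      \<Longrightarrow> monotone_on (Fib R X Y) (Le R X Y) (Le R Y X) (Conv R X Y)"
    and conv_reidx: "\<lbrakk>X \<in> Obj R; Y \<in> Obj R; A \<in> Obj R; B \<in> Obj R; f \<in> Hom R X A; g \<in> Hom R Y B;
        \<alpha> \<in> Fib R A B\<rbrakk>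
      \<Longrightarrow> Le R Y X (Conv R X Y (Reidx R X A Y B f g \<alpha>)) (Reidx R Y B X A g f (Conv R A B \<alpha>))"
    and rcomp_assoc: "\<lbrakk>X \<in> Obj R; Y \<in> Obj R; Z \<in> Obj R; V \<in> Obj R;
        \<alpha> \<in> Fib R X Y; \<beta> \<in> Fib R Y Z; \<gamma> \<in> Fib R Z V\<rbrakk>
      \<Longrightarrow> RComp R X Y V \<alpha> (RComp R Y Z V \<beta> \<gamma>) = RComp R X Z V (RComp R X Y Z \<alpha> \<beta>) \<gamma>"
    and rcomp_diag_left: "\<lbrakk>X \<in> Obj R; Y \<in> Obj R; \<alpha> \<in> Fib R X Y\<rbrakk>
      \<Longrightarrow> RComp R X X Y (Diag R X) \<alpha> = \<alpha>"
    and rcomp_diag_right: "\<lbrakk>X \<in> Obj R; Y \<in> Obj R; \<alpha> \<in> Fib R X Y\<rbrakk>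
      \<Longrightarrow> RComp R X Y Y \<alpha> (Diag R Y) = \<alpha>"
    and conv_rcomp: "\<lbrakk>X \<in> Obj R; Y \<in> Obj R; Z \<in> Obj R; \<alpha> \<in> Fib R X Y; \<beta> \<in> Fib R Y Z\<rbrakk>
      \<Longrightarrow> Conv R X Z (RComp R X Y Z \<alpha> \<beta>) = RComp R Z Y X (Conv R Y Z \<beta>) (Conv R X Y \<alpha>)"
    and conv_diag: "X \<in> Obj R \<Longrightarrow> Conv R X X (Diag R X) = Diag R X"
    and conv_conv: "\<lbrakk>X \<in> Obj R; Y \<in> Obj R; \<alpha> \<in> Fib R X Y\<rbrakk>
      \<Longrightarrow> Conv R Y X (Conv R X Y \<alpha>) = \<alpha>"

definition graph :: "('o, 'a, 'r) doctrine \<Rightarrow> 'o \<Rightarrow> 'o \<Rightarrow> 'a \<Rightarrow> 'r" where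
  "graph R X Y f = Reidx R X Y Y Y f (Ident R Y) (Diag R Y)"

definition kernel :: "('o, 'a, 'r) doctrine \<Rightarrow> 'o \<Rightarrow> 'o \<Rightarrow> 'a \<Rightarrow> 'r" where
  "kernel R X Y f = RComp R X Y X (graph R X Y f) (Conv R X Y (graph R X Y f))"

definition equiv_rels :: "('o, 'a, 'r) doctrine \<Rightarrow> 'o \<Rightarrow> 'r set" where
  "equiv_rels R X = {\<rho> \<in> Fib R X X.
     Le R X X (Diag R X) \<rho> \<and> Le R X X (Conv R X X \<rho>) \<rho> \<and> Le R X X (RComp R X X X \<rho> \<rho>) \<rho>}"

definition quotient_arrow :: "('o, 'a, 'r) doctrine \<Rightarrow> 'o \<Rightarrow> 'r \<Rightarrow> 'o \<Rightarrow> 'a \<Rightarrow> bool" where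
  "quotient_arrow R X \<rho> W q \<longleftrightarrow> W \<in> Obj R \<and> q \<in> Hom R X W \<and> Le R X X \<rho> (kernel R X W q) \<and>
     (\<forall>Z\<in>Obj R. \<forall>f\<in>Hom R X Z. Le R X X \<rho> (kernel R X Z f) \<longrightarrow>
        (\<exists>!h. h \<in> Hom R W Z \<and> f = Comp R X W Z h q))"

definition effective :: "('o, 'a, 'r) doctrine \<Rightarrow> 'o \<Rightarrow> 'r \<Rightarrow> 'o \<Rightarrow> 'a \<Rightarrow> bool" where
  "effective R X \<rho> W q \<longleftrightarrow> \<rho> = kernel R X W q"

definition descent :: "('o, 'a, 'r) doctrine \<Rightarrow> 'o \<Rightarrow> 'o \<Rightarrow> 'a \<Rightarrow> bool" where
  "descent R X W q \<longleftrightarrow>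
     Le R W W (Diag R W) (RComp R W X W (Conv R X W (graph R X W q)) (graph R X W q))"

locale doctrine_with_quotients = relational_doctrine R for R :: "('o, 'a, 'r) doctrine" +
  assumes has_quotients: "\<lbrakk>X \<in> Obj R; \<rho> \<in> equiv_rels R X\<rbrakk>
    \<Longrightarrow> \<exists>W q. quotient_arrow R X \<rho> W q \<and> effective R X \<rho> W q \<and> descent R X W q"


section \<open>The 2-categories of relational doctrines\<close>

record ('o, 'a, 'p, 'b, 'r, 's) one_arr = "('o, 'a, 'p, 'b) cfun" +
  FRel :: "'o \<Rightarrow> 'o \<Rightarrow> 'r \<Rightarrow> 's"

definition mk_rel :: "('o, 'a, 'r) doctrine \<Rightarrow> ('o \<Rightarrow> 'o \<Rightarrow> 'r \<Rightarrow> 's) \<Rightarrow> 'o \<Rightarrow> 'o \<Rightarrow> 'r \<Rightarrow> 's" where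
  "mk_rel R t = (\<lambda>X Y \<alpha>. if X \<in> Obj R \<and> Y \<in> Obj R \<and> \<alpha> \<in> Fib R X Y then t X Y \<alpha> else undefined)"

locale one_arrow = dom: relational_doctrine R + cod: relational_doctrine S + cat_functor R S F
  for R :: "('o, 'a, 'r) doctrine" and S :: "('p, 'b, 's) doctrine"
    and F :: "('o, 'a, 'p, 'b, 'r, 's) one_arr" +
  assumes rel_in: "\<lbrakk>X \<in> Obj R; Y \<in> Obj R; \<alpha> \<in> Fib R X Y\<rbrakk>
      \<Longrightarrow> FRel F X Y \<alpha> \<in> Fib S (FObj F X) (FObj F Y)"
    and rel_undefined: "\<not> (X \<in> Obj R \<and> Y \<in> Obj R \<and> \<alpha> \<in> Fib R X Y) \<Longrightarrow> FRel F X Y \<alpha> = undefined"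
    and rel_mono: "\<lbrakk>X \<in> Obj R; Y \<in> Obj R\<rbrakk>
      \<Longrightarrow> monotone_on (Fib R X Y) (Le R X Y) (Le S (FObj F X) (FObj F Y)) (FRel F X Y)"
    and rel_natural: "\<lbrakk>X \<in> Obj R; A \<in> Obj R; Y \<in> Obj R; B \<in> Obj R; f \<in> Hom R X A; g \<in> Hom R Y B;
        \<alpha> \<in> Fib R A B\<rbrakk>
      \<Longrightarrow> FRel F X Y (Reidx R X A Y B f g \<alpha>) =
          Reidx S (FObj F X) (FObj F A) (FObj F Y) (FObj F B) (FArr F X A f) (FArr F Y B g)
            (FRel F A B \<alpha>)"
    and rel_diag: "X \<in> Obj R
      \<Longrightarrow> Le S (FObj F X) (FObj F X) (Diag S (FObj F X)) (FRel F X X (Diag R X))"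
    and rel_rcomp: "\<lbrakk>X \<in> Obj R; Y \<in> Obj R; Z \<in> Obj R; \<alpha> \<in> Fib R X Y; \<beta> \<in> Fib R Y Z\<rbrakk>
      \<Longrightarrow> Le S (FObj F X) (FObj F Z)
            (RComp S (FObj F X) (FObj F Y) (FObj F Z) (FRel F X Y \<alpha>) (FRel F Y Z \<beta>))
            (FRel F X Z (RComp R X Y Z \<alpha> \<beta>))"
    and rel_conv: "\<lbrakk>X \<in> Obj R; Y \<in> Obj R; \<alpha> \<in> Fib R X Y\<rbrakk>
      \<Longrightarrow> Le S (FObj F Y) (FObj F X)
            (Conv S (FObj F X) (FObj F Y) (FRel F X Y \<alpha>)) (FRel F Y X (Conv R X Y \<alpha>))"

locale quotient_one_arrow =
  dom: doctrine_with_quotients R + cod: doctrine_with_quotients S + one_arrow R S F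
  for R :: "('o, 'a, 'r) doctrine" and S :: "('p, 'b, 's) doctrine"
    and F :: "('o, 'a, 'p, 'b, 'r, 's) one_arr" +
  assumes preserves_quotients:
    "\<lbrakk>X \<in> Obj R; \<rho> \<in> equiv_rels R X; quotient_arrow R X \<rho> W q\<rbrakk>
      \<Longrightarrow> quotient_arrow S (FObj F X) (FRel F X X \<rho>) (FObj F W) (FArr F X W q)"

definition two_arrows ::
  "('o, 'a, 'r) doctrine \<Rightarrow> ('p, 'b, 's) doctrine \<Rightarrow> ('o, 'a, 'p, 'b, 'r, 's) one_arr
   \<Rightarrow> ('o, 'a, 'p, 'b, 'r, 's) one_arr \<Rightarrow> ('o \<Rightarrow> 'b) set" where
  "two_arrows R S F G =
    {\<theta> \<in> nat_trans R S F G.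
       \<forall>X\<in>Obj R. \<forall>Y\<in>Obj R. \<forall>\<alpha>\<in>Fib R X Y.
         Le S (FObj F X) (FObj F Y) (FRel F X Y \<alpha>)
           (Reidx S (FObj F X) (FObj G X) (FObj F Y) (FObj G Y) (\<theta> X) (\<theta> Y) (FRel G X Y \<alpha>))}"

definition id_one_arrow :: "('o, 'a, 'r) doctrine \<Rightarrow> ('o, 'a, 'o, 'a, 'r, 'r) one_arr" where
  "id_one_arrow R =
    \<lparr>FObj = (\<lambda>X\<in>Obj R. X), FArr = mk_arr R (\<lambda>X Y f. f), FRel = mk_rel R (\<lambda>X Y \<alpha>. \<alpha>)\<rparr>"

definition comp_one_arrow ::
  "('o, 'a, 'r) doctrine \<Rightarrow> ('p, 'b, 'q, 'c, 's, 't) one_arr \<Rightarrow> ('o, 'a, 'p, 'b, 'r, 's) one_arr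
   \<Rightarrow> ('o, 'a, 'q, 'c, 'r, 't) one_arr" where
  "comp_one_arrow R G F =
    \<lparr>FObj = (\<lambda>X\<in>Obj R. FObj G (FObj F X)),
     FArr = mk_arr R (\<lambda>X Y f. FArr G (FObj F X) (FObj F Y) (FArr F X Y f)),
     FRel = mk_rel R (\<lambda>X Y \<alpha>. FRel G (FObj F X) (FObj F Y) (FRel F X Y \<alpha>))\<rparr>"

text \<open>The hom-categories; their composition is vertical composition of 2-arrows.\<close>

definition RD_hom ::
  "('o, 'a, 'r) doctrine \<Rightarrow> ('p, 'b, 's) doctrine
   \<Rightarrow> (('o, 'a, 'p, 'b, 'r, 's) one_arr, 'o \<Rightarrow> 'b) cat" where
  "RD_hom R S =
    \<lparr>Obj = {F. one_arrow R S F},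
     Hom = two_arrows R S,
     Ident = (\<lambda>F. \<lambda>X\<in>Obj R. Ident S (FObj F X)),
     Comp = (\<lambda>F G H \<phi> \<theta>. \<lambda>X\<in>Obj R. Comp S (FObj F X) (FObj G X) (FObj H X) (\<phi> X) (\<theta> X))\<rparr>"

definition QRD_hom ::
  "('o, 'a, 'r) doctrine \<Rightarrow> ('p, 'b, 's) doctrine
   \<Rightarrow> (('o, 'a, 'p, 'b, 'r, 's) one_arr, 'o \<Rightarrow> 'b) cat" where
  "QRD_hom R S = (RD_hom R S)\<lparr>Obj := {F. quotient_one_arrow R S F}\<rparr>"

text \<open>
  The horizontal composite of \<open>\<theta> : F \<Rightarrow> F'\<close> between 1-arrows \<open>R \<rightarrow> S\<close> and
  \<open>\<phi> : G \<Rightarrow> G'\<close> between 1-arrows \<open>S \<rightarrow> T\<close>.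
\<close>

definition hcomp ::
  "('o, 'a, 'r) doctrine \<Rightarrow> ('q, 'c, 't) doctrine
   \<Rightarrow> ('p, 'b, 'q, 'c, 's, 't) one_arr \<Rightarrow> ('p, 'b, 'q, 'c, 's, 't) one_arr
   \<Rightarrow> ('o, 'a, 'p, 'b, 'r, 's) one_arr \<Rightarrow> ('o, 'a, 'p, 'b, 'r, 's) one_arr
   \<Rightarrow> ('p \<Rightarrow> 'c) \<Rightarrow> ('o \<Rightarrow> 'b) \<Rightarrow> 'o \<Rightarrow> 'c" where
  "hcomp R T G G' F F' \<phi> \<theta> =
    (\<lambda>X\<in>Obj R. Comp T (FObj G (FObj F X)) (FObj G (FObj F' X)) (FObj G' (FObj F' X))
       (\<phi> (FObj F' X)) (FArr G (FObj F X) (FObj F' X) (\<theta> X)))"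

text \<open>The functor \<open>(-) \<circ> E : RD(K, S) \<rightarrow> RD(R, S)\<close> for a 1-arrow \<open>E : R \<rightarrow> K\<close>; on
  2-arrows it is whiskering with \<open>E\<close>.\<close>

definition precomp ::
  "('o, 'a, 'r) doctrine \<Rightarrow> ('u, 'd, 'v) doctrine \<Rightarrow> ('p, 'b, 's) doctrine
   \<Rightarrow> ('o, 'a, 'u, 'd, 'r, 'v) one_arr
   \<Rightarrow> (('u, 'd, 'p, 'b, 'v, 's) one_arr, 'u \<Rightarrow> 'b,
       ('o, 'a, 'p, 'b, 'r, 's) one_arr, 'o \<Rightarrow> 'b) cfun" where
  "precomp R K S E =
    \<lparr>FObj = (\<lambda>G\<in>Obj (RD_hom K S). comp_one_arrow R G E),
     FArr = mk_arr (RD_hom K S) (\<lambda>G G' \<theta>. \<lambda>X\<in>Obj R. \<theta> (FObj E X))\<rparr>"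

text \<open>The action of the inclusion 2-functor on hom-categories.\<close>

definition Uq_hom ::
  "('o, 'a, 'r) doctrine \<Rightarrow> ('p, 'b, 's) doctrine
   \<Rightarrow> (('o, 'a, 'p, 'b, 'r, 's) one_arr, 'o \<Rightarrow> 'b,
       ('o, 'a, 'p, 'b, 'r, 's) one_arr, 'o \<Rightarrow> 'b) cfun" where
  "Uq_hom R S = id_functor (QRD_hom R S)"


section \<open>The intensional quotient completion\<close>

definition qcompl :: "('o, 'a, 'r) doctrine \<Rightarrow> ('o \<times> 'r, 'a, 'r) doctrine" where
  "qcompl R =
    \<lparr>Obj = {(X, \<rho>). X \<in> Obj R \<and> \<rho> \<in> equiv_rels R X},
     Hom = (\<lambda>(X, \<rho>) (Y, \<sigma>). {f \<in> Hom R X Y. Le R X X \<rho> (Reidx R X Y X Y f f \<sigma>)}),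
     Ident = (\<lambda>(X, \<rho>). Ident R X),
     Comp = (\<lambda>(X, \<rho>) (Y, \<sigma>) (Z, \<tau>). Comp R X Y Z),
     Fib = (\<lambda>(X, \<rho>) (Y, \<sigma>).
       {\<alpha> \<in> Fib R X Y. Le R X Y (RComp R X Y Y (RComp R X X Y (Conv R X X \<rho>) \<alpha>) \<sigma>) \<alpha>}),
     Le = (\<lambda>(X, \<rho>) (Y, \<sigma>). Le R X Y),
     Reidx = (\<lambda>(X, \<rho>) (A, \<sigma>) (Y, \<tau>) (B, \<upsilon>). Reidx R X A Y B),
     Diag = (\<lambda>(X, \<rho>). \<rho>),
     RComp = (\<lambda>(X, \<rho>) (Y, \<sigma>) (Z, \<tau>). RComp R X Y Z),
     Conv = (\<lambda>(X, \<rho>) (Y, \<sigma>). Conv R X Y)\<rparr>"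

definition Q_one ::
  "('o, 'a, 'r) doctrine \<Rightarrow> ('o, 'a, 'p, 'b, 'r, 's) one_arr
   \<Rightarrow> ('o \<times> 'r, 'a, 'p \<times> 's, 'b, 'r, 's) one_arr" where
  "Q_one R F =
    \<lparr>FObj = (\<lambda>(X, \<rho>)\<in>Obj (qcompl R). (FObj F X, FRel F X X \<rho>)),
     FArr = mk_arr (qcompl R) (\<lambda>(X, \<rho>) (Y, \<sigma>). FArr F X Y),
     FRel = mk_rel (qcompl R) (\<lambda>(X, \<rho>) (Y, \<sigma>). FRel F X Y)\<rparr>"

definition Q_two :: "('o, 'a, 'r) doctrine \<Rightarrow> ('o \<Rightarrow> 'b) \<Rightarrow> 'o \<times> 'r \<Rightarrow> 'b" where
  "Q_two R \<theta> = (\<lambda>(X, \<rho>)\<in>Obj (qcompl R). \<theta> X)"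

definition Q_hom ::
  "('o, 'a, 'r) doctrine \<Rightarrow> ('p, 'b, 's) doctrine
   \<Rightarrow> (('o, 'a, 'p, 'b, 'r, 's) one_arr, 'o \<Rightarrow> 'b,
       ('o \<times> 'r, 'a, 'p \<times> 's, 'b, 'r, 's) one_arr, 'o \<times> 'r \<Rightarrow> 'b) cfun" where
  "Q_hom R S =
    \<lparr>FObj = (\<lambda>F\<in>Obj (RD_hom R S). Q_one R F),
     FArr = mk_arr (RD_hom R S) (\<lambda>F G \<theta>. Q_two R \<theta>)\<rparr>"

definition unit_arrow :: "('o, 'a, 'r) doctrine \<Rightarrow> ('o, 'a, 'o \<times> 'r, 'a, 'r, 'r) one_arr" where
  "unit_arrow R =
    \<lparr>FObj = (\<lambda>X\<in>Obj R. (X, Diag R X)),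
     FArr = mk_arr R (\<lambda>X Y f. f),
     FRel = mk_rel R (\<lambda>X Y \<alpha>. \<alpha>)\<rparr>"

text \<open>
  Doctrines over different types cannot be collected in one HOL type, so 2-functoriality is
  stated for three doctrines of arbitrary, independent types: the action on hom-categories is
  functorial, and identity 1-arrows and horizontal composition of 1-arrows and of 2-arrows are
  preserved.
\<close>

definition Q_two_functorial ::
  "('o1, 'a1, 'r1) doctrine \<Rightarrow> ('o2, 'a2, 'r2) doctrine \<Rightarrow> ('o3, 'a3, 'r3) doctrine \<Rightarrow> bool" where
  "Q_two_functorial R1 R2 R3 \<longleftrightarrow>
     doctrine_with_quotients (qcompl R1) \<and>
     cat_functor (RD_hom R1 R2) (QRD_hom (qcompl R1) (qcompl R2)) (Q_hom R1 R2) \<and>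
     Q_one R1 (id_one_arrow R1) = id_one_arrow (qcompl R1) \<and>
     (\<forall>F\<in>Obj (RD_hom R1 R2). \<forall>G\<in>Obj (RD_hom R2 R3).
        Q_one R1 (comp_one_arrow R1 G F) = comp_one_arrow (qcompl R1) (Q_one R2 G) (Q_one R1 F)) \<and>
     (\<forall>F\<in>Obj (RD_hom R1 R2). \<forall>F'\<in>Obj (RD_hom R1 R2).
      \<forall>G\<in>Obj (RD_hom R2 R3). \<forall>G'\<in>Obj (RD_hom R2 R3).
      \<forall>\<theta>\<in>two_arrows R1 R2 F F'. \<forall>\<phi>\<in>two_arrows R2 R3 G G'.
        Q_two R1 (hcomp R1 R3 G G' F F' \<phi> \<theta>) =
        hcomp (qcompl R1) (qcompl R3) (Q_one R2 G) (Q_one R2 G') (Q_one R1 F) (Q_one R1 F')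
          (Q_two R2 \<phi>) (Q_two R1 \<theta>))"

text \<open>For the inclusion, preservation of identity 1-arrows and of composition of 1-arrows amounts
  to these being inherited from the larger 2-category.\<close>

definition Uq_two_functorial ::
  "('o1, 'a1, 'r1) doctrine \<Rightarrow> ('o2, 'a2, 'r2) doctrine \<Rightarrow> ('o3, 'a3, 'r3) doctrine \<Rightarrow> bool" where
  "Uq_two_functorial S1 S2 S3 \<longleftrightarrow>
     cat_functor (QRD_hom S1 S2) (RD_hom S1 S2) (Uq_hom S1 S2) \<and>
     id_one_arrow S1 \<in> Obj (QRD_hom S1 S1) \<and>
     (\<forall>F\<in>Obj (QRD_hom S1 S2). \<forall>G\<in>Obj (QRD_hom S2 S3).
        comp_one_arrow S1 G F \<in> Obj (QRD_hom S1 S3))"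

end

theory Submission
  imports Defs
begin

text \<open>
  The adjunction is a statement about universal arrows.  For a 1-arrow \<open>G : R\<^sup>q \<rightarrow> S\<close> that preserves
  quotients, the value \<open>G(X, \<rho>)\<close> is forced by the restriction \<open>GE\<close> of \<open>G\<close> along the unit \<open>E : R \<rightarrow> R\<^sup>q\<close>.
  Indeed the identity of \<open>X\<close> is an arrow \<open>(X, d) \<rightarrow> (X, \<rho>)\<close> of \<open>R\<^sup>q\<close>, and it is a quotient arrow of
  \<open>\<rho>\<close>; so \<open>G\<close> sends it to a quotient arrow of \<open>GE(\<rho>)\<close>.  Quotient arrows are unique up to
  isomorphism, hence all of them are effective and descent in a doctrine with quotients, and reindexing
  along descent arrows reflects the order.  The action of \<open>G\<close> on arrows and on relations is therefore
  determined by \<open>GE\<close> as well.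

  This argument, made relative to a 2-arrow \<open>\<eta> : F \<Rightarrow> HE\<close>, is \<open>universal_arrow_of_quotients\<close>: if the
  composites \<open>FX \<rightarrow> H(X, d) \<rightarrow> H(X, \<rho>)\<close> are quotient arrows of \<open>F(\<rho>)\<close>, and reindexing along
  them takes \<open>H(\<alpha>)\<close> below \<open>F(\<alpha>)\<close>, then \<open>\<eta>\<close> is a universal arrow from \<open>F\<close> to the restriction functor.
  Two instances give the theorem.

  \<^item> The left adjoint and its unit come from \<open>universal_arrow_extension\<close>: for \<open>F : R \<rightarrow> S\<close> choose
    a quotient arrow \<open>q : FX \<rightarrow> FX/F(\<rho>)\<close> in \<open>S\<close> for each equivalence relation \<open>\<rho>\<close>, and put
    \<open>H(X, \<rho>) = FX/F(\<rho>)\<close> and \<open>H(\<alpha>) = \<Gamma>\<^sub>q\<^sup>\<bottom> ; F(\<alpha>) ; \<Gamma>\<^sub>q'\<close>.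
  \<^item> The counit is invertible because the identity of \<open>GE\<close> is itself a universal arrow
    from \<open>GE\<close>, with target \<open>G\<close> (\<open>universal_arrow_ident\<close>); two universal arrows from the same object
    are isomorphic (\<open>reflection_of_universal_arrows\<close>).

  That \<open>R\<^sup>q\<close> has quotients, and that the completion of a 1-arrow preserves them, both rest on the same
  description of quotients in \<open>R\<^sup>q\<close>: the quotient of \<open>(X, \<rho>)\<close> by \<open>\<sigma>\<close> is \<open>(X, \<sigma>)\<close>.  It is enough to
  test preservation on one quotient arrow for each equivalence relation (\<open>quotient_one_arrowI\<close>).
\<close>

section \<open>Reflections from universal arrows\<close>

definition universal_arrow ::
  "('o, 'a, 'm) cat_scheme \<Rightarrow> ('p, 'b, 'n) cat_scheme \<Rightarrow> ('o, 'a, 'p, 'b, 'k) cfun_scheme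
   \<Rightarrow> 'p \<Rightarrow> 'o \<Rightarrow> 'b \<Rightarrow> bool" where
  "universal_arrow C D P Y A u \<longleftrightarrow> A \<in> Obj C \<and> u \<in> Hom D Y (FObj P A) \<and>
     (\<forall>B\<in>Obj C. \<forall>v\<in>Hom D Y (FObj P B).
        \<exists>!w. w \<in> Hom C A B \<and> Comp D Y (FObj P A) (FObj P B) (FArr P A B w) u = v)"

lemma universal_arrowD:
  assumes "universal_arrow C D P Y A u"
  shows "A \<in> Obj C" "u \<in> Hom D Y (FObj P A)"
    and "\<lbrakk>B \<in> Obj C; v \<in> Hom D Y (FObj P B)\<rbrakk>
      \<Longrightarrow> \<exists>w. w \<in> Hom C A B \<and> Comp D Y (FObj P A) (FObj P B) (FArr P A B w) u = v"
    and "\<lbrakk>B \<in> Obj C; w \<in> Hom C A B; w' \<in> Hom C A B;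
       Comp D Y (FObj P A) (FObj P B) (FArr P A B w) u = v;
       Comp D Y (FObj P A) (FObj P B) (FArr P A B w') u = v; v \<in> Hom D Y (FObj P B)\<rbrakk> \<Longrightarrow> w = w'"
  using assms unfolding universal_arrow_def by (blast, blast, blast, blast)

lemma cat_functor_comp:
  assumes "cat_functor C D F" "cat_functor D E G"
  shows "cat_functor C E (comp_functor C G F)"
proof -
  interpret F: cat_functor C D F by fact
  interpret G: cat_functor D E G by fact
  have o: "X \<in> Obj C \<Longrightarrow> FObj F X \<in> Obj D" "Y \<in> Obj D \<Longrightarrow> FObj G Y \<in> Obj E" for X Y
    using F.obj_in G.obj_in by blast+
  show ?thesis
    by unfold_locales
      (auto simp: comp_functor_def mk_arr_def o F.arr_in G.arr_in F.dom.ident_in F.dom.comp_in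
        F.preserves_ident G.preserves_ident F.preserves_comp G.preserves_comp)
qed

text \<open>
  A choice of universal arrows \<open>u\<^sub>Y : Y \<rightarrow> P(l Y)\<close> is a left adjoint of \<open>P\<close>, with \<open>u\<close> as its unit; the
  counit at \<open>A\<close> is the extension of the identity of \<open>P A\<close> along \<open>u\<close>.  If the identity of \<open>P A\<close> is
  universal as well, then the counit compares two universal arrows from \<open>P A\<close>, so it is an isomorphism.
\<close>

lemma reflection_of_universal_arrows:
  assumes P: "cat_functor C D P"
    and ex: "\<And>Y. Y \<in> Obj D \<Longrightarrow> \<exists>A u. universal_arrow C D P Y A u"
    and self: "\<And>A. A \<in> Obj C \<Longrightarrow> universal_arrow C D P (FObj P A) A (Ident D (FObj P A))"
  shows "has_reflection_left_adjoint C D P"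
proof -
  interpret P: cat_functor C D P by fact
  note Po = P.obj_in[THEN PiE_mem]
  obtain l u where lu: "\<And>Y. Y \<in> Obj D \<Longrightarrow> universal_arrow C D P Y (l Y) (u Y)"
    using ex by metis
  note l = lu[THEN universal_arrowD(1)] and u = lu[THEN universal_arrowD(2)]
  note uniq = universal_arrowD(4)[OF lu]
  define ext where "ext Y B v = (SOME w. w \<in> Hom C (l Y) B \<and>
      Comp D Y (FObj P (l Y)) (FObj P B) (FArr P (l Y) B w) (u Y) = v)" for Y B v
  have ext: "ext Y B v \<in> Hom C (l Y) B"
      "Comp D Y (FObj P (l Y)) (FObj P B) (FArr P (l Y) B (ext Y B v)) (u Y) = v"
    if "Y \<in> Obj D" "B \<in> Obj C" "v \<in> Hom D Y (FObj P B)" for Y B v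
    using universal_arrowD(3)[OF lu[OF that(1)] that(2,3)]
    unfolding ext_def by (metis (mono_tags, lifting) someI_ex)+
  have ext_comp: "Comp D Y (FObj P (l Y)) (FObj P B') (FArr P (l Y) B' (Comp C (l Y) B B' w (ext Y B v))) (u Y)
      = Comp D Y (FObj P B) (FObj P B') (FArr P B B' w) v"
    if "Y \<in> Obj D" "B \<in> Obj C" "v \<in> Hom D Y (FObj P B)" "B' \<in> Obj C" "w \<in> Hom C B B'" for Y B v B' w
    using that ext[OF that(1-3)] l[OF that(1)] u[OF that(1)]
      P.cod.comp_assoc[of Y "FObj P (l Y)" "FObj P B" "FObj P B'" "u Y"
        "FArr P (l Y) B (ext Y B v)" "FArr P B B' w"]
    by (simp add: P.preserves_comp Po P.arr_in)
  define L where "L = \<lparr>FObj = (\<lambda>Y\<in>Obj D. l Y),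
    FArr = mk_arr D (\<lambda>Y Y' f. ext Y (l Y') (Comp D Y Y' (FObj P (l Y')) (u Y') f))\<rparr>"
  have LO: "Y \<in> Obj D \<Longrightarrow> FObj L Y = l Y" for Y by (simp add: L_def)
  have v: "Comp D Y Y' (FObj P (l Y')) (u Y') f \<in> Hom D Y (FObj P (l Y'))"
    if "Y \<in> Obj D" "Y' \<in> Obj D" "f \<in> Hom D Y Y'" for Y Y' f
    using that by (simp add: P.cod.comp_in Po l u)
  have LA: "FArr L Y Y' f = ext Y (l Y') (Comp D Y Y' (FObj P (l Y')) (u Y') f)"
    if "Y \<in> Obj D" "Y' \<in> Obj D" "f \<in> Hom D Y Y'" for Y Y' f
    using that by (simp add: L_def mk_arr_def)
  have L: "cat_functor D C L"
  proof
    show "FObj L \<in> Obj D \<rightarrow>\<^sub>E Obj C" by (auto simp: L_def l)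
  next
    fix Y Y' f assume a: "Y \<in> Obj D" "Y' \<in> Obj D" "f \<in> Hom D Y Y'"
    then show "FArr L Y Y' f \<in> Hom C (FObj L Y) (FObj L Y')"
      using ext(1)[OF a(1) l[OF a(2)] v[OF a]] by (simp add: LO LA)
  next
    fix Y Y' f assume "\<not> (Y \<in> Obj D \<and> Y' \<in> Obj D \<and> f \<in> Hom D Y Y')"
    then show "FArr L Y Y' f = undefined" by (auto simp: L_def mk_arr_def)
  next
    fix Y assume a: "Y \<in> Obj D"
    note i = P.cod.ident_in[OF a]
    have "ext Y (l Y) (Comp D Y Y (FObj P (l Y)) (u Y) (Ident D Y)) = Ident C (l Y)"
      by (rule uniq[OF a l[OF a] ext(1)[OF a l[OF a] v[OF a a i]] _ ext(2)[OF a l[OF a] v[OF a a i]] _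
            v[OF a a i]])
        (use a u[OF a] l[OF a] in \<open>simp_all add: P.dom.ident_in P.preserves_ident P.cod.comp_ident_left
            P.cod.comp_ident_right Po\<close>)
    then show "FArr L Y Y (Ident D Y) = Ident C (FObj L Y)"
      using a i by (simp add: LO LA)
  next
    fix X Y Z f g assume a: "X \<in> Obj D" "Y \<in> Obj D" "Z \<in> Obj D" "f \<in> Hom D X Y" "g \<in> Hom D Y Z"
    let ?gf = "Comp D X Y Z g f"
    have gf: "?gf \<in> Hom D X Z" using a by (simp add: P.cod.comp_in)
    let ?vf = "Comp D X Y (FObj P (l Y)) (u Y) f" and ?vg = "Comp D Y Z (FObj P (l Z)) (u Z) g"
    note vf = v[OF a(1,2,4)] and vg = v[OF a(2,3,5)] and vgf = v[OF a(1,3) gf]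
    note eg = ext(1)[OF a(2) l[OF a(3)] vg] and ef = ext(1)[OF a(1) l[OF a(2)] vf]
    \<comment> \<open>Both sides extend the same arrow along the universal arrow at \<open>X\<close>.\<close>
    have "ext X (l Z) (Comp D X Z (FObj P (l Z)) (u Z) ?gf) =
        Comp C (l X) (l Y) (l Z) (ext Y (l Z) ?vg) (ext X (l Y) ?vf)"
    proof (rule uniq[OF a(1) l[OF a(3)] ext(1)[OF a(1) l[OF a(3)] vgf] _
            ext(2)[OF a(1) l[OF a(3)] vgf] _ vgf])
      show "Comp C (l X) (l Y) (l Z) (ext Y (l Z) ?vg) (ext X (l Y) ?vf) \<in> Hom C (l X) (l Z)"
        using a eg ef by (simp add: P.dom.comp_in l)
      have "Comp D X (FObj P (l Y)) (FObj P (l Z)) (FArr P (l Y) (l Z) (ext Y (l Z) ?vg)) ?vf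
          = Comp D X Y (FObj P (l Z)) ?vg f"
        using a P.cod.comp_assoc[of X Y "FObj P (l Y)" "FObj P (l Z)" f "u Y"
            "FArr P (l Y) (l Z) (ext Y (l Z) ?vg)"] ext[OF a(2) l[OF a(3)] vg]
        by (simp add: Po l u P.arr_in)
      then show "Comp D X (FObj P (l X)) (FObj P (l Z)) (FArr P (l X) (l Z)
          (Comp C (l X) (l Y) (l Z) (ext Y (l Z) ?vg) (ext X (l Y) ?vf))) (u X)
          = Comp D X Z (FObj P (l Z)) (u Z) ?gf"
        using a ext_comp[OF a(1) l[OF a(2)] vf l[OF a(3)] eg]
        by (simp add: P.cod.comp_assoc Po l u)
    qed
    then show "FArr L X Z ?gf = Comp C (FObj L X) (FObj L Y) (FObj L Z) (FArr L Y Z g) (FArr L X Y f)"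
      using a gf by (simp add: LO LA)
  qed
  interpret L: cat_functor D C L by fact
  define \<eta> where "\<eta> = (\<lambda>Y\<in>Obj D. u Y)"
  define \<epsilon> where "\<epsilon> = (\<lambda>A\<in>Obj C. ext (FObj P A) A (Ident D (FObj P A)))"
  have LAu: "Comp D Y (FObj P (l Y)) (FObj P (l Y')) (FArr P (l Y) (l Y') (FArr L Y Y' f)) (u Y)
      = Comp D Y Y' (FObj P (l Y')) (u Y') f"
    if "Y \<in> Obj D" "Y' \<in> Obj D" "f \<in> Hom D Y Y'" for Y Y' f
    using ext(2)[OF that(1) l[OF that(2)] v[OF that]] that by (simp add: LA)
  have LAin: "FArr L Y Y' f \<in> Hom C (l Y) (l Y')"
    if "Y \<in> Obj D" "Y' \<in> Obj D" "f \<in> Hom D Y Y'" for Y Y' f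
    using L.arr_in[OF that] that by (simp add: LO)
  have Pid: "A \<in> Obj C \<Longrightarrow> Ident D (FObj P A) \<in> Hom D (FObj P A) (FObj P A)" for A
    by (simp add: P.cod.ident_in Po)
  have e: "\<epsilon> A \<in> Hom C (l (FObj P A)) A"
      "Comp D (FObj P A) (FObj P (l (FObj P A))) (FObj P A) (FArr P (l (FObj P A)) A (\<epsilon> A)) (u (FObj P A))
        = Ident D (FObj P A)" if "A \<in> Obj C" for A
    using that ext[OF Po[OF that] that Pid[OF that]] by (simp_all add: \<epsilon>_def)
  have \<eta>: "\<eta> \<in> nat_trans D D (id_functor D) (comp_functor D P L)"
    by (auto simp: nat_trans_def \<eta>_def id_functor_def comp_functor_def mk_arr_def LO u LAu)
  have \<epsilon>: "\<epsilon> \<in> nat_trans C C (comp_functor C L P) (id_functor C)"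
  proof -
    have "Comp C (l (FObj P X)) (l (FObj P Y)) Y (\<epsilon> Y) (FArr L (FObj P X) (FObj P Y) (FArr P X Y f)) =
        Comp C (l (FObj P X)) X Y f (\<epsilon> X)" (is "?a = ?b")
      if a: "X \<in> Obj C" "Y \<in> Obj C" "f \<in> Hom C X Y" for X Y f
    proof (rule uniq)
      let ?X = "FObj P X" and ?Y = "FObj P Y" and ?f = "FArr P X Y f"
      have f: "?f \<in> Hom D ?X ?Y" using a by (rule P.arr_in)
      note Lf = LAin[OF Po[OF a(1)] Po[OF a(2)] f]
      show "?X \<in> Obj D" "Y \<in> Obj C" "?f \<in> Hom D ?X ?Y" using a f by (simp_all add: Po)
      show "?a \<in> Hom C (l ?X) Y" "?b \<in> Hom C (l ?X) Y"
        using a Lf e by (simp_all add: P.dom.comp_in l Po)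
      have "Comp D ?X (FObj P (l ?X)) ?Y (FArr P (l ?X) Y ?a) (u ?X)
        = Comp D ?X (FObj P (l ?Y)) ?Y (FArr P (l ?Y) Y (\<epsilon> Y))
           (Comp D ?X (FObj P (l ?X)) (FObj P (l ?Y)) (FArr P (l ?X) (l ?Y) (FArr L ?X ?Y ?f)) (u ?X))"
        using a f Lf e by (simp add: P.preserves_comp P.cod.comp_assoc P.arr_in l u Po)
      also have "\<dots> = Comp D ?X (FObj P (l ?Y)) ?Y (FArr P (l ?Y) Y (\<epsilon> Y))
           (Comp D ?X ?Y (FObj P (l ?Y)) (u ?Y) ?f)"
        using a f by (simp add: LAu Po)
      also have "\<dots> = Comp D ?X ?Y ?Y (Comp D ?Y (FObj P (l ?Y)) ?Y (FArr P (l ?Y) Y (\<epsilon> Y)) (u ?Y)) ?f"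
        using a f e(1) by (simp add: P.cod.comp_assoc P.arr_in l u Po)
      also have "\<dots> = ?f" using a f by (simp add: e P.cod.comp_ident_left Po)
      finally show "Comp D ?X (FObj P (l ?X)) ?Y (FArr P (l ?X) Y ?a) (u ?X) = ?f" .
      have "Comp D ?X (FObj P (l ?X)) ?Y (FArr P (l ?X) Y ?b) (u ?X)
        = Comp D ?X ?X ?Y ?f (Comp D ?X (FObj P (l ?X)) ?X (FArr P (l ?X) X (\<epsilon> X)) (u ?X))"
        using a f e(1) by (simp add: P.preserves_comp P.cod.comp_assoc P.arr_in l u Po)
      also have "\<dots> = ?f" using a f by (simp add: e P.cod.comp_ident_right Po)
      finally show "Comp D ?X (FObj P (l ?X)) ?Y (FArr P (l ?X) Y ?b) (u ?X) = ?f" .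
    qed
    then show ?thesis
      using e(1) by (auto simp: nat_trans_def \<epsilon>_def id_functor_def comp_functor_def mk_arr_def LO Po P.arr_in)
  qed
  have adj: "adjunction C D L P \<eta> \<epsilon>"
  proof (intro adjunction.intro adjunction_axioms.intro L P \<eta> \<epsilon>)
    fix Y assume a: "Y \<in> Obj D"
    note b = l[OF a] and c = Po[OF l[OF a]] and uY = u[OF a]
    have f: "FArr L Y (FObj P (l Y)) (u Y) \<in> Hom C (l Y) (l (FObj P (l Y)))"
      using a b c uY by (simp add: LAin)
    have "Comp C (l Y) (l (FObj P (l Y))) (l Y) (\<epsilon> (l Y)) (FArr L Y (FObj P (l Y)) (u Y)) = Ident C (l Y)"
      (is "?a = _")
    proof (rule uniq[OF a b _ _ _ _ uY])
      show "?a \<in> Hom C (l Y) (l Y)" "Ident C (l Y) \<in> Hom C (l Y) (l Y)"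
        using b c f e by (simp_all add: P.dom.comp_in P.dom.ident_in l)
      show "Comp D Y (FObj P (l Y)) (FObj P (l Y)) (FArr P (l Y) (l Y) (Ident C (l Y))) (u Y) = u Y"
        using a b c uY by (simp add: P.preserves_ident P.cod.comp_ident_left)
      have "Comp D Y (FObj P (l Y)) (FObj P (l Y)) (FArr P (l Y) (l Y) ?a) (u Y)
         = Comp D Y (FObj P (l (FObj P (l Y)))) (FObj P (l Y)) (FArr P (l (FObj P (l Y))) (l Y) (\<epsilon> (l Y)))
           (Comp D Y (FObj P (l Y)) (FObj P (l (FObj P (l Y))))
             (FArr P (l Y) (l (FObj P (l Y))) (FArr L Y (FObj P (l Y)) (u Y))) (u Y))"
        using a b c uY f e by (simp add: P.preserves_comp P.cod.comp_assoc P.arr_in l u Po)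
      also have "\<dots> = Comp D Y (FObj P (l (FObj P (l Y)))) (FObj P (l Y))
            (FArr P (l (FObj P (l Y))) (l Y) (\<epsilon> (l Y)))
           (Comp D Y (FObj P (l Y)) (FObj P (l (FObj P (l Y)))) (u (FObj P (l Y))) (u Y))"
        using a c uY by (simp add: LAu)
      also have "\<dots> = Comp D Y (FObj P (l Y)) (FObj P (l Y)) (Comp D (FObj P (l Y)) (FObj P (l (FObj P (l Y))))
          (FObj P (l Y)) (FArr P (l (FObj P (l Y))) (l Y) (\<epsilon> (l Y))) (u (FObj P (l Y)))) (u Y)"
        using a b c uY e(1) by (simp add: P.cod.comp_assoc P.arr_in l u Po)
      also have "\<dots> = u Y" using a b c uY by (simp add: e P.cod.comp_ident_left)
      finally show "Comp D Y (FObj P (l Y)) (FObj P (l Y)) (FArr P (l Y) (l Y) ?a) (u Y) = u Y" .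
    qed
    then show "Comp C (FObj L Y) (FObj L (FObj P (FObj L Y))) (FObj L Y)
        (\<epsilon> (FObj L Y)) (FArr L Y (FObj P (FObj L Y)) (\<eta> Y)) = Ident C (FObj L Y)"
      using a c by (simp add: LO \<eta>_def)
  next
    fix A assume "A \<in> Obj C"
    then show "Comp D (FObj P A) (FObj P (FObj L (FObj P A))) (FObj P A)
        (FArr P (FObj L (FObj P A)) A (\<epsilon> A)) (\<eta> (FObj P A)) = Ident D (FObj P A)"
      by (simp add: LO \<eta>_def Po e)
  qed
  moreover have "iso_in C (FObj L (FObj P A)) A (\<epsilon> A)" if A: "A \<in> Obj C" for A
  proof -
    let ?Y = "FObj P A"
    have Y: "?Y \<in> Obj D" using A by (rule Po)
    note b = l[OF Y] and uY = u[OF Y] and s = self[OF A]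
    \<comment> \<open>The inverse of the counit extends the unit along the identity of \<open>P A\<close>.\<close>
    obtain w where w: "w \<in> Hom C A (l ?Y)"
        "Comp D ?Y ?Y (FObj P (l ?Y)) (FArr P A (l ?Y) w) (Ident D ?Y) = u ?Y"
      using universal_arrowD(3)[OF s b uY] by blast
    have Pw: "FArr P A (l ?Y) w = u ?Y"
      using w A b by (simp add: P.cod.comp_ident_right P.arr_in Po)
    have "Comp C (l ?Y) A (l ?Y) w (\<epsilon> A) = Ident C (l ?Y)"
    proof (rule uniq[OF Y b _ _ _ _ uY])
      show "Comp C (l ?Y) A (l ?Y) w (\<epsilon> A) \<in> Hom C (l ?Y) (l ?Y)" "Ident C (l ?Y) \<in> Hom C (l ?Y) (l ?Y)"
        using A b w e by (simp_all add: P.dom.comp_in P.dom.ident_in)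
      show "Comp D ?Y (FObj P (l ?Y)) (FObj P (l ?Y)) (FArr P (l ?Y) (l ?Y) (Ident C (l ?Y))) (u ?Y) = u ?Y"
        using Y b uY by (simp add: P.preserves_ident P.cod.comp_ident_left Po)
      have "Comp D ?Y (FObj P (l ?Y)) (FObj P (l ?Y)) (FArr P (l ?Y) (l ?Y) (Comp C (l ?Y) A (l ?Y) w (\<epsilon> A))) (u ?Y)
        = Comp D ?Y ?Y (FObj P (l ?Y)) (FArr P A (l ?Y) w)
           (Comp D ?Y (FObj P (l ?Y)) ?Y (FArr P (l ?Y) A (\<epsilon> A)) (u ?Y))"
        using A Y b uY w(1) e(1) P.arr_in[OF A b w(1)] P.arr_in[OF b A e(1)[OF A]]
        by (simp add: P.preserves_comp P.cod.comp_assoc Po)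
      then show "Comp D ?Y (FObj P (l ?Y)) (FObj P (l ?Y)) (FArr P (l ?Y) (l ?Y) (Comp C (l ?Y) A (l ?Y) w (\<epsilon> A))) (u ?Y)
        = u ?Y"
        using A w(2) by (simp add: e)
    qed
    moreover have "Comp C A (l ?Y) A (\<epsilon> A) w = Ident C A"
    proof (rule universal_arrowD(4)[OF s A _ _ _ _ Pid[OF A]])
      show "Comp C A (l ?Y) A (\<epsilon> A) w \<in> Hom C A A" "Ident C A \<in> Hom C A A"
        using A b w e by (simp_all add: P.dom.comp_in P.dom.ident_in)
      show "Comp D ?Y ?Y ?Y (FArr P A A (Comp C A (l ?Y) A (\<epsilon> A) w)) (Ident D ?Y) = Ident D ?Y"
        using A b w(1) e P.cod.comp_ident_right[OF Y Y Pid[OF A]] by (simp add: P.preserves_comp Pw)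
      show "Comp D ?Y ?Y ?Y (FArr P A A (Ident C A)) (Ident D ?Y) = Ident D ?Y"
        using A Y P.cod.comp_ident_right[OF Y Y Pid[OF A]] by (simp add: P.preserves_ident)
    qed
    ultimately show ?thesis
      using A Y e w unfolding iso_in_def by (auto simp: LO)
  qed
  ultimately show ?thesis unfolding has_reflection_left_adjoint_def by blast
qed


section \<open>Calculus of squares in a relational doctrine\<close>

text \<open>
  An inequality \<open>\<alpha> \<le> R\<^bsub>f,g\<^esub>(\<beta>)\<close> is regarded as a square with horizontal edges \<open>\<alpha>\<close>, \<open>\<beta>\<close> and vertical
  edges \<open>f\<close>, \<open>g\<close>; functoriality of reindexing pastes squares vertically, and the lax naturality of
  \<open>;\<close> pastes them horizontally.  The judgements include membership in the
  hom-sets and fibres, which makes transitivity, monotonicity and pasting rules free of side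
  conditions.
\<close>

definition arr :: "('o, 'a, 'm) cat_scheme \<Rightarrow> 'o \<Rightarrow> 'o \<Rightarrow> 'a \<Rightarrow> bool" where
  "arr C X Y f \<longleftrightarrow> X \<in> Obj C \<and> Y \<in> Obj C \<and> f \<in> Hom C X Y"

definition rel :: "('o, 'a, 'r) doctrine \<Rightarrow> 'o \<Rightarrow> 'o \<Rightarrow> 'r \<Rightarrow> bool" where
  "rel R X Y \<alpha> \<longleftrightarrow> X \<in> Obj R \<and> Y \<in> Obj R \<and> \<alpha> \<in> Fib R X Y"

definition rle :: "('o, 'a, 'r) doctrine \<Rightarrow> 'o \<Rightarrow> 'o \<Rightarrow> 'r \<Rightarrow> 'r \<Rightarrow> bool" where
  "rle R X Y \<alpha> \<beta> \<longleftrightarrow> rel R X Y \<alpha> \<and> rel R X Y \<beta> \<and> Le R X Y \<alpha> \<beta>"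

definition direct_image :: "('o, 'a, 'r) doctrine \<Rightarrow> 'o \<Rightarrow> 'o \<Rightarrow> 'o \<Rightarrow> 'o \<Rightarrow> 'a \<Rightarrow> 'a \<Rightarrow> 'r \<Rightarrow> 'r" where
  "direct_image R X A Y B f g \<alpha> =
     RComp R A Y B (RComp R A X Y (Conv R X A (graph R X A f)) \<alpha>) (graph R Y B g)"

definition square :: "('o, 'a, 'r) doctrine \<Rightarrow> 'o \<Rightarrow> 'o \<Rightarrow> 'o \<Rightarrow> 'o \<Rightarrow> 'a \<Rightarrow> 'a \<Rightarrow> 'r \<Rightarrow> 'r \<Rightarrow> bool" where
  "square R X A Y B f g \<alpha> \<beta> \<longleftrightarrow>
     arr R X A f \<and> arr R Y B g \<and> rel R A B \<beta> \<and> rle R X Y \<alpha> (Reidx R X A Y B f g \<beta>)"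

context category
begin

lemma arr_obj: "arr C X Y f \<Longrightarrow> X \<in> Obj C" "arr C X Y f \<Longrightarrow> Y \<in> Obj C"
  and arr_hom: "arr C X Y f \<Longrightarrow> f \<in> Hom C X Y"
  by (simp_all add: arr_def)

lemma arr_ident: "X \<in> Obj C \<Longrightarrow> arr C X X (Ident C X)"
  by (simp add: arr_def ident_in)

lemma arr_comp: "\<lbrakk>arr C X Y f; arr C Y Z g\<rbrakk> \<Longrightarrow> arr C X Z (Comp C X Y Z g f)"
  by (simp add: arr_def comp_in)

lemma ident_right: "arr C X Y f \<Longrightarrow> Comp C X X Y f (Ident C X) = f"
  and ident_left: "arr C X Y f \<Longrightarrow> Comp C X Y Y (Ident C Y) f = f"
  by (simp_all add: arr_def comp_ident_right comp_ident_left)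

lemma assoc: "\<lbrakk>arr C X Y f; arr C Y Z g; arr C Z V h\<rbrakk>
  \<Longrightarrow> Comp C X Z V h (Comp C X Y Z g f) = Comp C X Y V (Comp C Y Z V h g) f"
  by (simp add: arr_def comp_assoc)

end

context relational_doctrine
begin

lemma relD: "rel R X Y \<alpha> \<Longrightarrow> X \<in> Obj R" "rel R X Y \<alpha> \<Longrightarrow> Y \<in> Obj R" "rel R X Y \<alpha> \<Longrightarrow> \<alpha> \<in> Fib R X Y"
  by (simp_all add: rel_def)

lemma rleD: "rle R X Y \<alpha> \<beta> \<Longrightarrow> rel R X Y \<alpha>" "rle R X Y \<alpha> \<beta> \<Longrightarrow> rel R X Y \<beta>" "rle R X Y \<alpha> \<beta> \<Longrightarrow> Le R X Y \<alpha> \<beta>"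
  by (simp_all add: rle_def)

lemma squareD: "square R X A Y B f g \<alpha> \<beta> \<Longrightarrow> arr R X A f" "square R X A Y B f g \<alpha> \<beta> \<Longrightarrow> arr R Y B g"
  "square R X A Y B f g \<alpha> \<beta> \<Longrightarrow> rel R X Y \<alpha>" "square R X A Y B f g \<alpha> \<beta> \<Longrightarrow> rel R A B \<beta>"
  "square R X A Y B f g \<alpha> \<beta> \<Longrightarrow> rle R X Y \<alpha> (Reidx R X A Y B f g \<beta>)"
  by (simp_all add: square_def rle_def)

lemma squareI: "\<lbrakk>arr R X A f; arr R Y B g; rel R A B \<beta>; rle R X Y \<alpha> (Reidx R X A Y B f g \<beta>)\<rbrakk>
    \<Longrightarrow> square R X A Y B f g \<alpha> \<beta>"
  by (simp add: square_def)

lemma rel_reidx: "\<lbrakk>arr R X A f; arr R Y B g; rel R A B \<alpha>\<rbrakk> \<Longrightarrow> rel R X Y (Reidx R X A Y B f g \<alpha>)"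
  and rel_diag: "X \<in> Obj R \<Longrightarrow> rel R X X (Diag R X)"
  and rel_rcomp: "\<lbrakk>rel R X Y \<alpha>; rel R Y Z \<beta>\<rbrakk> \<Longrightarrow> rel R X Z (RComp R X Y Z \<alpha> \<beta>)"
  and rel_conv: "rel R X Y \<alpha> \<Longrightarrow> rel R Y X (Conv R X Y \<alpha>)"
  by (simp_all add: rel_def arr_def reidx_in diag_in rcomp_in conv_in)

lemma rle_refl: "rel R X Y \<alpha> \<Longrightarrow> rle R X Y \<alpha> \<alpha>"
  using le_refl by (auto simp: rle_def rel_def reflp_on_def)

lemma rle_trans [trans]: "\<lbrakk>rle R X Y \<alpha> \<beta>; rle R X Y \<beta> \<gamma>\<rbrakk> \<Longrightarrow> rle R X Y \<alpha> \<gamma>"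
  using le_trans unfolding rle_def rel_def transp_on_def by blast

lemma rle_antisym: "\<lbrakk>rle R X Y \<alpha> \<beta>; rle R X Y \<beta> \<alpha>\<rbrakk> \<Longrightarrow> \<alpha> = \<beta>"
  using le_antisym unfolding rle_def rel_def antisymp_on_def by blast

lemma rle_rcomp: "\<lbrakk>rle R X Y \<alpha> \<alpha>'; rle R Y Z \<beta> \<beta>'\<rbrakk>
    \<Longrightarrow> rle R X Z (RComp R X Y Z \<alpha> \<beta>) (RComp R X Y Z \<alpha>' \<beta>')"
  unfolding rle_def rel_def by (blast intro: rcomp_in rcomp_mono)

lemma rle_conv: "rle R X Y \<alpha> \<beta> \<Longrightarrow> rle R Y X (Conv R X Y \<alpha>) (Conv R X Y \<beta>)"
  using conv_mono[of X Y] by (simp add: rle_def rel_def conv_in monotone_on_def)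

lemma rle_reidx: "\<lbrakk>arr R X A f; arr R Y B g; rle R A B \<alpha> \<beta>\<rbrakk>
    \<Longrightarrow> rle R X Y (Reidx R X A Y B f g \<alpha>) (Reidx R X A Y B f g \<beta>)"
  using reidx_mono[of X A Y B f g] by (simp add: rle_def rel_def arr_def reidx_in monotone_on_def)

lemma diag_left: "rel R X Y \<alpha> \<Longrightarrow> RComp R X X Y (Diag R X) \<alpha> = \<alpha>"
  and diag_right: "rel R X Y \<alpha> \<Longrightarrow> RComp R X Y Y \<alpha> (Diag R Y) = \<alpha>"
  and reassoc: "\<lbrakk>rel R X Y \<alpha>; rel R Y Z \<beta>; rel R Z V \<gamma>\<rbrakk>
      \<Longrightarrow> RComp R X Y V \<alpha> (RComp R Y Z V \<beta> \<gamma>) = RComp R X Z V (RComp R X Y Z \<alpha> \<beta>) \<gamma>"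
  and conv_twice: "rel R X Y \<alpha> \<Longrightarrow> Conv R Y X (Conv R X Y \<alpha>) = \<alpha>"
  and conv_comp: "\<lbrakk>rel R X Y \<alpha>; rel R Y Z \<beta>\<rbrakk>
      \<Longrightarrow> Conv R X Z (RComp R X Y Z \<alpha> \<beta>) = RComp R Z Y X (Conv R Y Z \<beta>) (Conv R X Y \<alpha>)"
  and reidx_id: "rel R X Y \<alpha> \<Longrightarrow> Reidx R X X Y Y (Ident R X) (Ident R Y) \<alpha> = \<alpha>"
  and reidx_reidx: "\<lbrakk>arr R X A f; arr R A V f'; arr R Y B g; arr R B W g'; rel R V W \<alpha>\<rbrakk>
      \<Longrightarrow> Reidx R X A Y B f g (Reidx R A V B W f' g' \<alpha>) =
          Reidx R X V Y W (Comp R X A V f' f) (Comp R Y B W g' g) \<alpha>"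
  by (simp_all add: rel_def arr_def rcomp_diag_left rcomp_diag_right rcomp_assoc conv_conv conv_rcomp
      reidx_ident reidx_comp)

lemma square_id_iff: "square R X X Y Y (Ident R X) (Ident R Y) \<alpha> \<beta> \<longleftrightarrow> rle R X Y \<alpha> \<beta>"
  unfolding square_def by (auto simp: reidx_id rle_def dest: relD intro: arr_ident)

lemma square_vertical:
  assumes "square R X A Y B f g \<alpha> \<beta>" "square R A V B W f' g' \<beta> \<gamma>"
  shows "square R X V Y W (Comp R X A V f' f) (Comp R Y B W g' g) \<alpha> \<gamma>"
proof -
  note a = squareD[OF assms(1)] and b = squareD[OF assms(2)]
  have "rle R X Y \<alpha> (Reidx R X V Y W (Comp R X A V f' f) (Comp R Y B W g' g) \<gamma>)"
    using rle_trans[OF a(5) rle_reidx[OF a(1,2) b(5)]] by (simp add: reidx_reidx[OF a(1) b(1) a(2) b(2,4)])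
  then show ?thesis using a b by (auto intro!: squareI arr_comp)
qed

lemma square_horizontal:
  assumes "square R X A Y B f g \<alpha> \<beta>" "square R Y B Z D g h \<alpha>' \<beta>'"
  shows "square R X A Z D f h (RComp R X Y Z \<alpha> \<alpha>') (RComp R A B D \<beta> \<beta>')"
proof -
  note a = squareD[OF assms(1)] and b = squareD[OF assms(2)]
  have "rle R X Z (RComp R X Y Z (Reidx R X A Y B f g \<beta>) (Reidx R Y B Z D g h \<beta>'))
     (Reidx R X A Z D f h (RComp R A B D \<beta> \<beta>'))"
    using a b by (simp add: rle_def rel_rcomp rel_reidx) (simp add: rel_def arr_def rcomp_reidx)
  with rle_rcomp[OF a(5) b(5)] show ?thesis
    using a b by (blast intro: squareI rel_rcomp rle_trans)
qed

lemma square_conv: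
  assumes "square R X A Y B f g \<alpha> \<beta>"
  shows "square R Y B X A g f (Conv R X Y \<alpha>) (Conv R A B \<beta>)"
proof -
  note a = squareD[OF assms(1)]
  have "rle R Y X (Conv R X Y (Reidx R X A Y B f g \<beta>)) (Reidx R Y B X A g f (Conv R A B \<beta>))"
    using a by (simp add: rle_def rel_conv rel_reidx) (simp add: rel_def arr_def conv_reidx)
  with rle_conv[OF a(5)] show ?thesis
    using a by (blast intro: squareI rel_conv rle_trans)
qed

lemma square_diag: "arr R X Y f \<Longrightarrow> square R X Y X Y f f (Diag R X) (Diag R Y)"
  using diag_reidx by (auto simp: square_def rle_def arr_def rel_def diag_in reidx_in)

lemma square_reidx: "\<lbrakk>arr R X A f; arr R Y B g; rel R A B \<alpha>\<rbrakk>
    \<Longrightarrow> square R X A Y B f g (Reidx R X A Y B f g \<alpha>) \<alpha>"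
  by (simp add: square_def rle_refl rel_reidx)

lemma square_mono:
  assumes "rle R X Y \<alpha>' \<alpha>" "square R X A Y B f g \<alpha> \<beta>" "rle R A B \<beta> \<beta>'"
  shows "square R X A Y B f g \<alpha>' \<beta>'"
proof -
  note a = squareD[OF assms(2)]
  show ?thesis using rle_trans[OF assms(1) rle_trans[OF a(5) rle_reidx[OF a(1,2) assms(3)]]] assms(3) a
    by (auto intro: squareI dest: rleD)
qed

lemma square_mono_left: "\<lbrakk>rle R X Y \<alpha>' \<alpha>; square R X A Y B f g \<alpha> \<beta>\<rbrakk> \<Longrightarrow> square R X A Y B f g \<alpha>' \<beta>"
  by (rule square_mono) (auto intro: rle_refl dest: squareD)

lemma square_mono_right: "\<lbrakk>square R X A Y B f g \<alpha> \<beta>; rle R A B \<beta> \<beta>'\<rbrakk> \<Longrightarrow> square R X A Y B f g \<alpha> \<beta>'"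
  by (rule square_mono[rotated]) (auto intro: rle_refl dest: squareD)

text \<open>
  Reindexing is functorial, so a square whose vertical edges are composites factors through the
  reindexing of its lower edge.
\<close>

lemma square_factor:
  assumes "square R X V Y W (Comp R X A V f' f) (Comp R Y B W g' g) \<alpha> \<beta>"
    and "arr R X A f" "arr R A V f'" "arr R Y B g" "arr R B W g'"
  shows "square R X A Y B f g \<alpha> (Reidx R A V B W f' g' \<beta>)"
  using assms squareD[OF assms(1)] by (auto intro!: squareI rel_reidx simp: reidx_reidx)

text \<open>
  Only one inequality is an axiom; the other follows from it because the converse is an involution.
\<close>

lemma conv_reidx_eq:
  assumes "arr R X A f" "arr R Y B g" "rel R A B \<alpha>"
  shows "Conv R X Y (Reidx R X A Y B f g \<alpha>) = Reidx R Y B X A g f (Conv R A B \<alpha>)"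
proof (rule rle_antisym)
  show "rle R Y X (Conv R X Y (Reidx R X A Y B f g \<alpha>)) (Reidx R Y B X A g f (Conv R A B \<alpha>))"
    by (rule squareD(5)[OF square_conv[OF square_reidx[OF assms]]])
  have "square R X A Y B f g (Conv R Y X (Reidx R Y B X A g f (Conv R A B \<alpha>))) \<alpha>"
    using square_conv[OF square_reidx[OF assms(2,1) rel_conv[OF assms(3)]]] assms by (simp add: conv_twice)
  from rle_conv[OF squareD(5)[OF this]]
  show "rle R Y X (Reidx R Y B X A g f (Conv R A B \<alpha>)) (Conv R X Y (Reidx R X A Y B f g \<alpha>))"
    using assms by (simp add: conv_twice rel_reidx rel_conv)
qed


subsection \<open>Graphs\<close>

lemma rel_graph: "arr R X Y f \<Longrightarrow> rel R X Y (graph R X Y f)"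
  unfolding graph_def by (intro rel_reidx) (auto intro: arr_ident rel_diag dest: arr_obj)

lemma square_graph: "arr R X Y f \<Longrightarrow> square R X Y Y Y f (Ident R Y) (graph R X Y f) (Diag R Y)"
  unfolding graph_def by (intro square_reidx) (auto intro: arr_ident rel_diag dest: arr_obj)

text \<open>
  The inequality \<open>d\<^sub>X \<le> R\<^bsub>f,f\<^esub>(d\<^sub>Y) = R\<^bsub>id,f\<^esub>(\<Gamma>\<^sub>f)\<close> is what makes graphs total: pasting it with its converse
  yields \<open>d\<^sub>X \<le> \<Gamma>\<^sub>f ; \<Gamma>\<^sub>f\<^sup>\<bottom>\<close>.
\<close>

lemma square_graph_diag:
  assumes "arr R X Y f" shows "square R X X X Y (Ident R X) f (Diag R X) (graph R X Y f)"
  unfolding graph_def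
proof (rule square_factor)
  show "square R X Y X Y (Comp R X X Y f (Ident R X)) (Comp R X Y Y (Ident R Y) f) (Diag R X) (Diag R Y)"
    using assms by (simp add: ident_left ident_right square_diag)
qed (use assms in \<open>auto intro: arr_ident dest: arr_obj\<close>)

lemma square_conv_graph: "arr R X Y f \<Longrightarrow> square R Y Y X Y (Ident R Y) f (Conv R X Y (graph R X Y f)) (Diag R Y)"
  using square_conv[OF square_graph, of X Y f] by (simp add: conv_diag arr_obj)

lemma square_conv_graph_diag: "arr R X Y f \<Longrightarrow> square R X Y X X f (Ident R X) (Diag R X) (Conv R X Y (graph R X Y f))"
  using square_conv[OF square_graph_diag, of X Y f] by (simp add: conv_diag arr_obj)

text \<open>
  The four squares on \<open>\<Gamma>\<^sub>f\<close> and its converse that relate them to the identity relations make \<open>\<Gamma>\<^sub>f\<close> a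
  left adjoint relation.  Pasting them on either side of \<open>\<alpha>\<close> yields both inequalities.
\<close>

lemma reidx_eq_graphs:
  assumes f: "arr R X A f" and g: "arr R Y B g" and \<alpha>: "rel R A B \<alpha>"
  shows "Reidx R X A Y B f g \<alpha> =
    RComp R X A Y (graph R X A f) (RComp R A B Y \<alpha> (Conv R Y B (graph R Y B g)))"
proof (rule rle_antisym)
  note o = arr_obj[OF f] arr_obj[OF g]
  note r = rel_graph[OF f] rel_conv[OF rel_graph[OF g]]
  have d: "rel R X Y (Reidx R X A Y B f g \<alpha>)" using assms by (rule rel_reidx)
  have i: "square R A A B B (Ident R A) (Ident R B) \<alpha> \<alpha>" using \<alpha> by (simp add: square_id_iff rle_refl)
  show "rle R X Y (RComp R X A Y (graph R X A f) (RComp R A B Y \<alpha> (Conv R Y B (graph R Y B g))))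
      (Reidx R X A Y B f g \<alpha>)"
    using square_horizontal[OF square_graph[OF f] square_horizontal[OF i square_conv_graph[OF g]]] o \<alpha>
    by (simp add: diag_left diag_right squareD)
  show "rle R X Y (Reidx R X A Y B f g \<alpha>)
     (RComp R X A Y (graph R X A f) (RComp R A B Y \<alpha> (Conv R Y B (graph R Y B g))))"
    using square_horizontal[OF square_graph_diag[OF f]
        square_horizontal[OF square_reidx[OF f g \<alpha>] square_conv_graph_diag[OF g]]] o \<alpha> d
    by (simp add: diag_left diag_right square_id_iff)
qed

lemma kernel_eq_reidx:
  assumes "arr R X Y f" shows "kernel R X Y f = Reidx R X Y X Y f f (Diag R Y)"
  unfolding kernel_def
  by (simp add: reidx_eq_graphs[OF assms assms] rel_diag diag_left rel_conv rel_graph assms arr_obj[OF assms])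

lemma le_kernel_iff:
  assumes "arr R X Y f"
  shows "rle R X X \<rho> (kernel R X Y f) \<longleftrightarrow> square R X Y X Y f f \<rho> (Diag R Y)"
  using assms by (auto simp: kernel_eq_reidx square_def rel_diag arr_obj)


subsection \<open>Direct images\<close>

lemma rel_direct_image: "\<lbrakk>arr R X A f; arr R Y B g; rel R X Y \<alpha>\<rbrakk> \<Longrightarrow> rel R A B (direct_image R X A Y B f g \<alpha>)"
  unfolding direct_image_def by (auto intro: rel_rcomp rel_conv rel_graph)

text \<open>
  The direct image is left adjoint to reindexing, again by pasting the squares of the graphs.
\<close>

lemma direct_image_le_iff:
  assumes f: "arr R X A f" and g: "arr R Y B g" and \<alpha>: "rel R X Y \<alpha>" and \<beta>: "rel R A B \<beta>"
  shows "rle R A B (direct_image R X A Y B f g \<alpha>) \<beta> \<longleftrightarrow> square R X A Y B f g \<alpha> \<beta>"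
proof
  note o = arr_obj[OF f] arr_obj[OF g]
  have i: "square R X X Y Y (Ident R X) (Ident R Y) \<alpha> \<alpha>" using \<alpha> by (simp add: square_id_iff rle_refl)
  have "square R X A Y B f g (RComp R X Y Y (RComp R X X Y (Diag R X) \<alpha>) (Diag R Y)) (direct_image R X A Y B f g \<alpha>)"
    using square_horizontal[OF square_horizontal[OF square_conv_graph_diag[OF f] i] square_graph_diag[OF g]]
    unfolding direct_image_def by simp
  then have "square R X A Y B f g \<alpha> (direct_image R X A Y B f g \<alpha>)"
    using o \<alpha> by (simp add: diag_left diag_right)
  then show "rle R A B (direct_image R X A Y B f g \<alpha>) \<beta> \<Longrightarrow> square R X A Y B f g \<alpha> \<beta>"
    by (rule square_mono_right)
  assume s: "square R X A Y B f g \<alpha> \<beta>"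
  show "rle R A B (direct_image R X A Y B f g \<alpha>) \<beta>"
    using square_horizontal[OF square_horizontal[OF square_conv_graph[OF f] s] square_graph[OF g]] \<beta>
    unfolding direct_image_def by (simp add: diag_left diag_right square_id_iff)
qed

lemma square_direct_image: "\<lbrakk>arr R X A f; arr R Y B g; rel R X Y \<alpha>\<rbrakk>
    \<Longrightarrow> square R X A Y B f g \<alpha> (direct_image R X A Y B f g \<alpha>)"
  by (simp add: direct_image_le_iff[symmetric] rel_direct_image rle_refl)


subsection \<open>Descent arrows\<close>

lemma descent_iff: 
  assumes q: "arr R X W q"
  shows "descent R X W q \<longleftrightarrow> rle R W W (Diag R W) (direct_image R X W X W q q (Diag R X))"
  using q unfolding descent_def direct_image_def
  by (simp add: rle_def rel_diag diag_right rel_conv rel_graph rel_rcomp arr_obj)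

text \<open>
  The identity relations at both ends of \<open>\<alpha>\<close> are bounded by \<open>\<Gamma>\<^sub>q\<^sup>\<bottom> ; \<Gamma>\<^sub>q\<close> and \<open>\<Gamma>\<^sub>q'\<^sup>\<bottom> ; \<Gamma>\<^sub>q'\<close>; hence \<open>\<alpha>\<close>
  lies below the direct image of its own reindexing.  Reindexing along descent arrows is thus an
  order embedding.
\<close>

lemma descent_reflects:
  assumes q: "arr R X W q" and q': "arr R Y V q'" and d: "descent R X W q" and d': "descent R Y V q'"
    and s: "square R X W Y V q q' (Reidx R X W Y V q q' \<alpha>) \<beta>" and \<alpha>: "rel R W V \<alpha>"
  shows "rle R W V \<alpha> \<beta>"
proof -
  note o = arr_obj[OF q] arr_obj[OF q']
  let ?q = "graph R X W q" and ?q' = "graph R Y V q'"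
  note r = rel_graph[OF q] rel_conv[OF rel_graph[OF q]] rel_graph[OF q'] rel_conv[OF rel_graph[OF q']]
  note rr = squareD(3)[OF s]
  have "rle R W V (RComp R W V V (RComp R W W V (Diag R W) \<alpha>) (Diag R V))
     (RComp R W V V (RComp R W W V (RComp R W X W (Conv R X W ?q) ?q) \<alpha>) (RComp R V Y V (Conv R Y V ?q') ?q'))"
    using d d' unfolding descent_def
    by (intro rle_rcomp rle_refl \<alpha>) (simp_all add: rle_def rel_diag o r rel_rcomp)
  also have "RComp R W V V (RComp R W W V (RComp R W X W (Conv R X W ?q) ?q) \<alpha>) (RComp R V Y V (Conv R Y V ?q') ?q')
      = direct_image R X W Y V q q' (Reidx R X W Y V q q' \<alpha>)"
    unfolding direct_image_def by (simp add: reidx_eq_graphs[OF q q' \<alpha>] reassoc r \<alpha> rel_rcomp)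
  also have "rle R W V \<dots> \<beta>" using direct_image_le_iff[OF q q' rr] s by (simp add: squareD)
  finally show ?thesis using o \<alpha> by (simp add: diag_left diag_right)
qed

lemma descent_reidx_inject:
  assumes q: "arr R X W q" and q': "arr R Y V q'" and d: "descent R X W q" and d': "descent R Y V q'"
    and e: "Reidx R X W Y V q q' \<alpha> = Reidx R X W Y V q q' \<beta>" and \<alpha>: "rel R W V \<alpha>" and \<beta>: "rel R W V \<beta>"
  shows "\<alpha> = \<beta>"
proof (rule rle_antisym)
  show "rle R W V \<alpha> \<beta>"
    by (rule descent_reflects[OF q q' d d' _ \<alpha>]) (simp add: e square_reidx q q' \<beta>)
  show "rle R W V \<beta> \<alpha>"
    by (rule descent_reflects[OF q q' d d' _ \<beta>]) (simp add: e[symmetric] square_reidx q q' \<alpha>)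
qed


subsection \<open>Equivalence relations and quotient arrows\<close>

lemma equiv_rels_iff:
  "X \<in> Obj R \<Longrightarrow> \<rho> \<in> equiv_rels R X \<longleftrightarrow> rle R X X (Diag R X) \<rho> \<and> rle R X X (Conv R X X \<rho>) \<rho> \<and>
     rle R X X (RComp R X X X \<rho> \<rho>) \<rho>"
  by (auto simp: equiv_rels_def rle_def rel_def diag_in conv_in rcomp_in)

lemma equiv_relsD:
  assumes "X \<in> Obj R" "\<rho> \<in> equiv_rels R X"
  shows "rel R X X \<rho>" "rle R X X (Diag R X) \<rho>" "rle R X X (RComp R X X X \<rho> \<rho>) \<rho>" "Conv R X X \<rho> = \<rho>"
    "RComp R X X X \<rho> \<rho> = \<rho>"
proof -
  from assms have e: "rle R X X (Diag R X) \<rho>" "rle R X X (Conv R X X \<rho>) \<rho>" "rle R X X (RComp R X X X \<rho> \<rho>) \<rho>"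
    by (simp_all add: equiv_rels_iff)
  then show r: "rel R X X \<rho>" and "rle R X X (Diag R X) \<rho>" and "rle R X X (RComp R X X X \<rho> \<rho>) \<rho>"
    by (auto dest: rleD)
  show "Conv R X X \<rho> = \<rho>" using rle_conv[OF e(2)] e(2) r by (auto intro: rle_antisym simp: conv_twice)
  show "RComp R X X X \<rho> \<rho> = \<rho>"
    using rle_rcomp[OF e(1) rle_refl[OF r]] e(3) r by (auto intro: rle_antisym simp: diag_left)
qed

lemma diag_equiv: "X \<in> Obj R \<Longrightarrow> Diag R X \<in> equiv_rels R X"
  by (simp add: equiv_rels_iff conv_diag diag_left rel_diag rle_refl)

lemma diag_le_equiv: "\<lbrakk>X \<in> Obj R; \<rho> \<in> equiv_rels R X\<rbrakk> \<Longrightarrow> rle R X X (Diag R X) \<rho>"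
  by (rule equiv_relsD)

text \<open>
  The condition \<open>\<rho> \<le> \<Gamma>\<^sub>f ; \<Gamma>\<^sub>f\<^sup>\<bottom>\<close> says that \<open>f\<close> is the vertical edge, on both sides, of a square from
  \<open>\<rho>\<close> to an identity relation.
\<close>

lemma quotient_arrow_iff:
  assumes X: "X \<in> Obj R" and \<rho>: "rel R X X \<rho>"
  shows "quotient_arrow R X \<rho> W q \<longleftrightarrow> square R X W X W q q \<rho> (Diag R W) \<and>
     (\<forall>Z f. square R X Z X Z f f \<rho> (Diag R Z) \<longrightarrow> (\<exists>!h. arr R W Z h \<and> f = Comp R X W Z h q))"
proof -
  have 1: "Z \<in> Obj R \<and> f \<in> Hom R X Z \<and> Le R X X \<rho> (kernel R X Z f) \<longleftrightarrow> square R X Z X Z f f \<rho> (Diag R Z)" for Z f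
  proof (cases "arr R X Z f")
    case True
    then show ?thesis
      using \<rho> by (simp add: le_kernel_iff[symmetric] rle_def kernel_eq_reidx rel_diag rel_reidx arr_def)
  next
    case False
    then show ?thesis using X by (auto simp: arr_def square_def)
  qed
  have 2: "(\<forall>Z\<in>Obj R. \<forall>f\<in>Hom R X Z. Le R X X \<rho> (kernel R X Z f) \<longrightarrow>
        (\<exists>!h. h \<in> Hom R W Z \<and> f = Comp R X W Z h q)) \<longleftrightarrow>
      (\<forall>Z f. square R X Z X Z f f \<rho> (Diag R Z) \<longrightarrow> (\<exists>!h. arr R W Z h \<and> f = Comp R X W Z h q))"
    (is "?L \<longleftrightarrow> ?R") if W: "W \<in> Obj R"
  proof
    assume L: ?L
    show ?R
    proof (intro allI impI)
      fix Z f assume "square R X Z X Z f f \<rho> (Diag R Z)"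
      then have c: "Z \<in> Obj R" "f \<in> Hom R X Z" "Le R X X \<rho> (kernel R X Z f)" using 1 by blast+
      with L have "\<exists>!h. h \<in> Hom R W Z \<and> f = Comp R X W Z h q" by blast
      then show "\<exists>!h. arr R W Z h \<and> f = Comp R X W Z h q" using W c(1) by (simp add: arr_def)
    qed
  next
    assume r: ?R
    show ?L
    proof (intro ballI impI)
      fix Z f assume c: "Z \<in> Obj R" "f \<in> Hom R X Z" "Le R X X \<rho> (kernel R X Z f)"
      with 1 r have "\<exists>!h. arr R W Z h \<and> f = Comp R X W Z h q" by blast
      then show "\<exists>!h. h \<in> Hom R W Z \<and> f = Comp R X W Z h q" using W c(1) by (simp add: arr_def)
    qed
  qed
  show ?thesis
  proof (cases "square R X W X W q q \<rho> (Diag R W)")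
    case True
    with 1 have "W \<in> Obj R" "q \<in> Hom R X W" "Le R X X \<rho> (kernel R X W q)" by blast+
    then show ?thesis unfolding quotient_arrow_def 2[OF \<open>W \<in> Obj R\<close>] using True by simp
  next
    case False
    with 1[of W q] show ?thesis unfolding quotient_arrow_def by blast
  qed
qed

lemma quotient_arrowD:
  assumes "quotient_arrow R X \<rho> W q" "rel R X X \<rho>"
  shows quotient_arrow_arr: "arr R X W q" and quotient_arrow_square: "square R X W X W q q \<rho> (Diag R W)"
    and quotient_arrow_factor: "square R X Z X Z f f \<rho> (Diag R Z) \<Longrightarrow> \<exists>h. arr R W Z h \<and> Comp R X W Z h q = f"
    and quotient_arrow_epi: "\<lbrakk>arr R W Z h; arr R W Z h'; Comp R X W Z h q = Comp R X W Z h' q\<rbrakk> \<Longrightarrow> h = h'"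
proof -
  note 1 = iffD1[OF quotient_arrow_iff[OF relD(1)[OF assms(2)] assms(2)] assms(1)]
  then show s: "square R X W X W q q \<rho> (Diag R W)" by blast
  then show a: "arr R X W q" by (rule squareD)
  have 2: "\<exists>!h. arr R W Z h \<and> f = Comp R X W Z h q" if "square R X Z X Z f f \<rho> (Diag R Z)" for Z f
    using 1 that by blast
  show "square R X Z X Z f f \<rho> (Diag R Z) \<Longrightarrow> \<exists>h. arr R W Z h \<and> Comp R X W Z h q = f"
    using 2[of Z f] by metis
  assume h: "arr R W Z h" "arr R W Z h'" "Comp R X W Z h q = Comp R X W Z h' q"
  have "square R X Z X Z (Comp R X W Z h q) (Comp R X W Z h q) \<rho> (Diag R Z)"
    using square_vertical[OF s square_diag[OF h(1)]] .
  from 2[OF this] show "h = h'" using h by metis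
qed

lemma quotient_arrowI:
  assumes "square R X W X W q q \<rho> (Diag R W)"
    and "\<And>Z f. square R X Z X Z f f \<rho> (Diag R Z) \<Longrightarrow> \<exists>h. arr R W Z h \<and> Comp R X W Z h q = f"
    and "\<And>Z h h'. \<lbrakk>arr R W Z h; arr R W Z h'; Comp R X W Z h q = Comp R X W Z h' q\<rbrakk> \<Longrightarrow> h = h'"
  shows "quotient_arrow R X \<rho> W q"
proof (subst quotient_arrow_iff)
  show "X \<in> Obj R" "rel R X X \<rho>" using squareD(3)[OF assms(1)] by (simp_all add: rel_def)
  have "\<exists>!h. arr R W Z h \<and> f = Comp R X W Z h q" if "square R X Z X Z f f \<rho> (Diag R Z)" for Z f
    using assms(2)[OF that] assms(3) by metis
  with assms(1) show "square R X W X W q q \<rho> (Diag R W) \<and>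
     (\<forall>Z f. square R X Z X Z f f \<rho> (Diag R Z) \<longrightarrow> (\<exists>!h. arr R W Z h \<and> f = Comp R X W Z h q))"
    by blast
qed

lemma iso_in_arr: "\<lbrakk>X \<in> Obj R; Y \<in> Obj R\<rbrakk> \<Longrightarrow> iso_in R X Y i \<longleftrightarrow> arr R X Y i \<and>
   (\<exists>j. arr R Y X j \<and> Comp R X Y X j i = Ident R X \<and> Comp R Y X Y i j = Ident R Y)"
  by (auto simp: iso_in_def arr_def)

lemma quotient_arrow_unique:
  assumes q: "quotient_arrow R X \<rho> W q" and q': "quotient_arrow R X \<rho> V q'" and \<rho>: "rel R X X \<rho>"
  shows "\<exists>i. iso_in R W V i \<and> q' = Comp R X W V i q"
proof -
  note a = quotient_arrowD[OF q \<rho>] and b = quotient_arrowD[OF q' \<rho>]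
  note o = arr_obj[OF a(1)] arr_obj[OF b(1)]
  obtain i where i: "arr R W V i" "Comp R X W V i q = q'" using a(3)[OF b(2)] by blast
  obtain j where j: "arr R V W j" "Comp R X V W j q' = q" using b(3)[OF a(2)] by blast
  have "Comp R W V W j i = Ident R W"
    using i j o a(1) by - (rule a(4)[where Z=W], simp_all add: assoc[symmetric] ident_left arr_comp arr_ident)
  moreover have "Comp R V W V i j = Ident R V"
    using i j o b(1) by - (rule b(4)[where Z=V], simp_all add: assoc[symmetric] ident_left arr_comp arr_ident)
  ultimately have "iso_in R W V i" using i j o unfolding iso_in_arr[OF o(2,4)] by blast
  with i(2) show ?thesis by blast
qed

lemma quotient_arrow_comp_iso:
  assumes q: "quotient_arrow R X \<rho> W q" and i: "iso_in R W V i" and \<rho>: "rel R X X \<rho>" and V: "V \<in> Obj R"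
  shows "quotient_arrow R X \<rho> V (Comp R X W V i q)"
proof -
  note a = quotient_arrowD[OF q \<rho>]
  obtain j where i: "arr R W V i" and j: "arr R V W j" "Comp R W V W j i = Ident R W" "Comp R V W V i j = Ident R V"
    using i unfolding iso_in_arr[OF arr_obj(2)[OF a(1)] V] by blast
  show ?thesis
  proof (rule quotient_arrowI)
    show "square R X V X V (Comp R X W V i q) (Comp R X W V i q) \<rho> (Diag R V)"
      using square_vertical[OF a(2) square_diag[OF i]] .
  next
    fix Z f assume "square R X Z X Z f f \<rho> (Diag R Z)"
    then obtain h where h: "arr R W Z h" "Comp R X W Z h q = f" using a(3) by blast
    have "Comp R X V Z (Comp R V W Z h j) (Comp R X W V i q) = Comp R X W Z (Comp R W W Z h (Comp R W V W j i)) q"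
      using h(1) i j(1) a(1) by (simp add: assoc arr_comp)
    then have "Comp R X V Z (Comp R V W Z h j) (Comp R X W V i q) = f"
      using h by (simp add: j ident_right)
    then show "\<exists>h. arr R V Z h \<and> Comp R X V Z h (Comp R X W V i q) = f"
      using arr_comp[OF j(1) h(1)] by blast
  next
    fix Z h h' assume h: "arr R V Z h" "arr R V Z h'"
      "Comp R X V Z h (Comp R X W V i q) = Comp R X V Z h' (Comp R X W V i q)"
    then have "Comp R W V Z h i = Comp R W V Z h' i"
      using i a(1) by - (rule a(4)[where Z=Z], simp_all add: arr_comp assoc)
    then have "Comp R V W Z (Comp R W V Z h i) j = Comp R V W Z (Comp R W V Z h' i) j" by simp
    then show "h = h'" using h i j by (simp add: assoc[symmetric] ident_right)
  qed
qed

end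

context doctrine_with_quotients
begin

text \<open>
  Some quotient arrow of \<open>\<rho>\<close> is effective and descent by assumption.  Any other one differs from it by
  an isomorphism, and both properties are invariant under composition with an isomorphism.
\<close>

lemma quotient_arrow_effective_descent:
  assumes X: "X \<in> Obj R" and \<rho>: "\<rho> \<in> equiv_rels R X" and q': "quotient_arrow R X \<rho> V q'"
  shows quotient_arrow_effective: "Reidx R X V X V q' q' (Diag R V) = \<rho>"
    and quotient_arrow_descent: "descent R X V q'"
proof -
  note r = equiv_relsD(1)[OF X \<rho>]
  obtain W q where q: "quotient_arrow R X \<rho> W q" and e: "effective R X \<rho> W q" and d: "descent R X W q"
    using has_quotients[OF X \<rho>] by blast
  note a = quotient_arrowD[OF q r] and b = quotient_arrowD[OF q' r]
  note o = arr_obj[OF a(1)] arr_obj[OF b(1)]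
  obtain i where i': "iso_in R W V i" "q' = Comp R X W V i q" using quotient_arrow_unique[OF q q' r] by blast
  then obtain j where i: "arr R W V i" and j: "arr R V W j" "Comp R W V W j i = Ident R W"
      "Comp R V W V i j = Ident R V" using o by (auto simp: iso_in_arr)
  have jq: "Comp R X V W j q' = q" using i j a(1) by (simp add: i'(2) assoc ident_left)
  show "Reidx R X V X V q' q' (Diag R V) = \<rho>"
  proof (rule rle_antisym)
    have "rle R X X (Reidx R X V X V q' q' (Diag R V)) (Reidx R X V X V q' q' (Reidx R V W V W j j (Diag R W)))"
      by (intro rle_reidx b(1) squareD(5)[OF square_diag[OF j(1)]])
    also have "Reidx R X V X V q' q' (Reidx R V W V W j j (Diag R W)) = \<rho>"
      using e a(1) b(1) j(1) o by (simp add: reidx_reidx jq rel_diag effective_def kernel_eq_reidx)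
    finally show "rle R X X (Reidx R X V X V q' q' (Diag R V)) \<rho>" .
    show "rle R X X \<rho> (Reidx R X V X V q' q' (Diag R V))" using b(2) by (rule squareD)
  qed
  show "descent R X V q'"
  proof -
    \<comment> \<open>The square from the identity relation of \<open>X\<close> to its direct image under \<open>q' = i q\<close> factors
    through the direct image under \<open>q\<close>; the inverse \<open>j\<close> transports the resulting bound back.\<close>
    let ?p = "direct_image R X V X V q' q' (Diag R X)"
    have "square R X V X V q' q' (Diag R X) ?p" using b(1) X by (simp add: square_direct_image rel_diag)
    then have "square R X W X W q q (Diag R X) (Reidx R W V W V i i ?p)"
      unfolding i'(2) by (rule square_factor) (use i a in auto)
    then have "rle R W W (direct_image R X W X W q q (Diag R X)) (Reidx R W V W V i i ?p)"
      using a(1) X by (subst direct_image_le_iff) (simp_all add: rel_diag squareD(4))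
    with d a(1) have "rle R W W (Diag R W) (Reidx R W V W V i i ?p)"
      unfolding descent_iff[OF a(1)] by (blast intro: rle_trans)
    then have "square R W V W V i i (Diag R W) ?p"
      using i b(1) X by (intro squareI) (auto simp: rel_direct_image rel_diag)
    from square_vertical[OF square_diag[OF j(1)] this]
    show ?thesis using b(1) j by (simp add: square_id_iff descent_iff)
  qed
qed

end


section \<open>One-arrows and two-arrows\<close>

context one_arrow
begin

lemma obj: "X \<in> Obj R \<Longrightarrow> FObj F X \<in> Obj S"
  using obj_in by blast

lemma arr: "arr R X Y f \<Longrightarrow> arr S (FObj F X) (FObj F Y) (FArr F X Y f)"
  by (simp add: arr_def obj arr_in)

lemma ident: "X \<in> Obj R \<Longrightarrow> FArr F X X (Ident R X) = Ident S (FObj F X)"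
  by (rule preserves_ident)

lemma comp: "\<lbrakk>arr R X Y f; arr R Y Z g\<rbrakk> \<Longrightarrow> FArr F X Z (Comp R X Y Z g f) =
    Comp S (FObj F X) (FObj F Y) (FObj F Z) (FArr F Y Z g) (FArr F X Y f)"
  by (simp add: arr_def preserves_comp)

lemma rel: "rel R X Y \<alpha> \<Longrightarrow> rel S (FObj F X) (FObj F Y) (FRel F X Y \<alpha>)"
  by (simp add: rel_def obj rel_in)

lemma rle: "rle R X Y \<alpha> \<beta> \<Longrightarrow> rle S (FObj F X) (FObj F Y) (FRel F X Y \<alpha>) (FRel F X Y \<beta>)"
  using rel_mono[of X Y] rel by (auto simp: rle_def rel_def monotone_on_def)

lemma reidx: "\<lbrakk>arr R X A f; arr R Y B g; rel R A B \<alpha>\<rbrakk> \<Longrightarrow>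
    FRel F X Y (Reidx R X A Y B f g \<alpha>) =
      Reidx S (FObj F X) (FObj F A) (FObj F Y) (FObj F B) (FArr F X A f) (FArr F Y B g) (FRel F A B \<alpha>)"
  by (simp add: arr_def rel_def rel_natural)

lemma square:
  assumes "square R X A Y B f g \<alpha> \<beta>"
  shows "square S (FObj F X) (FObj F A) (FObj F Y) (FObj F B) (FArr F X A f) (FArr F Y B g)
      (FRel F X Y \<alpha>) (FRel F A B \<beta>)"
  using rle[OF dom.squareD(5)[OF assms]] dom.squareD[OF assms]
  by (intro cod.squareI arr rel) (simp_all add: reidx)

lemma diag_le: "X \<in> Obj R \<Longrightarrow> rle S (FObj F X) (FObj F X) (Diag S (FObj F X)) (FRel F X X (Diag R X))"
  using rel_diag by (simp add: rle_def obj cod.rel_diag rel dom.rel_diag)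

lemma rcomp_le: "\<lbrakk>rel R X Y \<alpha>; rel R Y Z \<beta>\<rbrakk> \<Longrightarrow> rle S (FObj F X) (FObj F Z)
    (RComp S (FObj F X) (FObj F Y) (FObj F Z) (FRel F X Y \<alpha>) (FRel F Y Z \<beta>))
    (FRel F X Z (RComp R X Y Z \<alpha> \<beta>))"
  using rel_rcomp[of X Y Z \<alpha> \<beta>] by (simp add: rle_def rel cod.rel_rcomp dom.rel_rcomp) (simp add: rel_def)

lemma conv_le: "rel R X Y \<alpha> \<Longrightarrow> rle S (FObj F Y) (FObj F X)
    (Conv S (FObj F X) (FObj F Y) (FRel F X Y \<alpha>)) (FRel F Y X (Conv R X Y \<alpha>))"
  using rel_conv[of X Y \<alpha>] by (simp add: rle_def rel cod.rel_conv dom.rel_conv) (simp add: rel_def)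

lemma conv: assumes "rel R X Y \<alpha>"
  shows "Conv S (FObj F X) (FObj F Y) (FRel F X Y \<alpha>) = FRel F Y X (Conv R X Y \<alpha>)"
proof (rule cod.rle_antisym[OF conv_le[OF assms]])
  show "rle S (FObj F Y) (FObj F X) (FRel F Y X (Conv R X Y \<alpha>)) (Conv S (FObj F X) (FObj F Y) (FRel F X Y \<alpha>))"
    using cod.rle_conv[OF conv_le[OF dom.rel_conv[OF assms]]] assms
    by (simp add: dom.conv_twice cod.conv_twice rel dom.rel_conv)
qed

lemma equiv:
  assumes X: "X \<in> Obj R" and \<rho>: "\<rho> \<in> equiv_rels R X"
  shows "FRel F X X \<rho> \<in> equiv_rels S (FObj F X)"
proof -
  note r = dom.equiv_relsD[OF X \<rho>]
  show ?thesis
    unfolding cod.equiv_rels_iff[OF obj[OF X]]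
    using cod.rle_trans[OF diag_le[OF X] rle[OF r(2)]] cod.rle_trans[OF rcomp_le[OF r(1,1)] rle[OF r(3)]]
      cod.rle_refl[OF rel[OF r(1)]]
    by (simp add: conv r)
qed

lemma iso:
  assumes "X \<in> Obj R" "Y \<in> Obj R" "iso_in R X Y i"
  shows "iso_in S (FObj F X) (FObj F Y) (FArr F X Y i)"
proof -
  obtain j where "arr R X Y i" "arr R Y X j" "Comp R X Y X j i = Ident R X" "Comp R Y X Y i j = Ident R Y"
    using assms(3) unfolding dom.iso_in_arr[OF assms(1,2)] by blast
  then have "arr S (FObj F X) (FObj F Y) (FArr F X Y i)" "arr S (FObj F Y) (FObj F X) (FArr F Y X j)"
    "Comp S (FObj F X) (FObj F Y) (FObj F X) (FArr F Y X j) (FArr F X Y i) = Ident S (FObj F X)"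
    "Comp S (FObj F Y) (FObj F X) (FObj F Y) (FArr F X Y i) (FArr F Y X j) = Ident S (FObj F Y)"
    using assms by (simp_all add: arr comp[symmetric] ident)
  then show ?thesis unfolding cod.iso_in_arr[OF obj[OF assms(1)] obj[OF assms(2)]] by blast
qed

end

text \<open>
  The defining conditions in terms of the typed judgements.  Membership of the images in the
  fibres is contained in the condition on \<open>rle\<close>, by reflexivity.
\<close>

lemma one_arrowI:
  assumes R: "relational_doctrine R" and S: "relational_doctrine S"
    and obj: "\<And>X. X \<in> Obj R \<Longrightarrow> FObj F X \<in> Obj S" and ext: "FObj F \<in> extensional (Obj R)"
    and arr: "\<And>X Y f. arr R X Y f \<Longrightarrow> arr S (FObj F X) (FObj F Y) (FArr F X Y f)"
    and arr_undefined: "\<And>X Y f. \<not> arr R X Y f \<Longrightarrow> FArr F X Y f = undefined"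
    and ident: "\<And>X. X \<in> Obj R \<Longrightarrow> FArr F X X (Ident R X) = Ident S (FObj F X)"
    and comp: "\<And>X Y Z f g. \<lbrakk>arr R X Y f; arr R Y Z g\<rbrakk> \<Longrightarrow> FArr F X Z (Comp R X Y Z g f) =
        Comp S (FObj F X) (FObj F Y) (FObj F Z) (FArr F Y Z g) (FArr F X Y f)"
    and rel_undefined: "\<And>X Y \<alpha>. \<not> rel R X Y \<alpha> \<Longrightarrow> FRel F X Y \<alpha> = undefined"
    and rle: "\<And>X Y \<alpha> \<beta>. rle R X Y \<alpha> \<beta> \<Longrightarrow> rle S (FObj F X) (FObj F Y) (FRel F X Y \<alpha>) (FRel F X Y \<beta>)"
    and reidx: "\<And>X A Y B f g \<alpha>. \<lbrakk>arr R X A f; arr R Y B g; rel R A B \<alpha>\<rbrakk> \<Longrightarrow>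
        FRel F X Y (Reidx R X A Y B f g \<alpha>) =
          Reidx S (FObj F X) (FObj F A) (FObj F Y) (FObj F B) (FArr F X A f) (FArr F Y B g) (FRel F A B \<alpha>)"
    and diag: "\<And>X. X \<in> Obj R \<Longrightarrow> rle S (FObj F X) (FObj F X) (Diag S (FObj F X)) (FRel F X X (Diag R X))"
    and rcomp: "\<And>X Y Z \<alpha> \<beta>. \<lbrakk>rel R X Y \<alpha>; rel R Y Z \<beta>\<rbrakk> \<Longrightarrow> rle S (FObj F X) (FObj F Z)
        (RComp S (FObj F X) (FObj F Y) (FObj F Z) (FRel F X Y \<alpha>) (FRel F Y Z \<beta>))
        (FRel F X Z (RComp R X Y Z \<alpha> \<beta>))"
    and conv: "\<And>X Y \<alpha>. rel R X Y \<alpha> \<Longrightarrow> rle S (FObj F Y) (FObj F X)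
        (Conv S (FObj F X) (FObj F Y) (FRel F X Y \<alpha>)) (FRel F Y X (Conv R X Y \<alpha>))"
  shows "one_arrow R S F"
proof -
  interpret R: relational_doctrine R by fact
  interpret S: relational_doctrine S by fact
  have "cat_functor R S F"
    by unfold_locales
      (use obj ext arr arr_undefined ident comp in \<open>auto simp: arr_def PiE_def\<close>)
  moreover have "one_arrow_axioms R S F"
  proof
    fix X Y \<alpha> assume a: "X \<in> Obj R" "Y \<in> Obj R" "\<alpha> \<in> Fib R X Y"
    then have r: "rel R X Y \<alpha>" by (simp add: rel_def)
    show "FRel F X Y \<alpha> \<in> Fib S (FObj F X) (FObj F Y)"
      using S.rleD(1)[OF rle[OF R.rle_refl[OF r]]] by (simp add: rel_def)
    show "Le S (FObj F Y) (FObj F X)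
            (Conv S (FObj F X) (FObj F Y) (FRel F X Y \<alpha>)) (FRel F Y X (Conv R X Y \<alpha>))"
      using conv[OF r] by (rule S.rleD)
  next
    fix X Y assume a: "X \<in> Obj R" "Y \<in> Obj R"
    show "monotone_on (Fib R X Y) (Le R X Y) (Le S (FObj F X) (FObj F Y)) (FRel F X Y)"
      using rle[of X Y] a by (auto simp: rle_def rel_def monotone_on_def)
  next
    fix X assume "X \<in> Obj R"
    then show "Le S (FObj F X) (FObj F X) (Diag S (FObj F X)) (FRel F X X (Diag R X))"
      using diag by (simp add: rle_def)
  next
    fix X Y Z \<alpha> \<beta> assume "X \<in> Obj R" "Y \<in> Obj R" "Z \<in> Obj R" "\<alpha> \<in> Fib R X Y" "\<beta> \<in> Fib R Y Z"
    then show "Le S (FObj F X) (FObj F Z)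
            (RComp S (FObj F X) (FObj F Y) (FObj F Z) (FRel F X Y \<alpha>) (FRel F Y Z \<beta>))
            (FRel F X Z (RComp R X Y Z \<alpha> \<beta>))"
      using rcomp[of X Y \<alpha> Z \<beta>] by (simp add: rle_def rel_def)
  qed (use rel_undefined reidx in \<open>simp_all add: arr_def rel_def\<close>)
  ultimately show ?thesis using R S by (simp add: one_arrow_def)
qed

text \<open>
  Two quotient arrows of \<open>\<rho>\<close> differ by an isomorphism, which every functor preserves.  So it is
  enough to find one quotient arrow of each equivalence relation that is sent to a quotient arrow.
\<close>

lemma quotient_one_arrowI:
  assumes R: "doctrine_with_quotients R" and S: "doctrine_with_quotients S" and F: "one_arrow R S F"
    and ex: "\<And>X \<rho>. \<lbrakk>X \<in> Obj R; \<rho> \<in> equiv_rels R X\<rbrakk> \<Longrightarrow>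
      \<exists>W q. quotient_arrow R X \<rho> W q \<and> quotient_arrow S (FObj F X) (FRel F X X \<rho>) (FObj F W) (FArr F X W q)"
  shows "quotient_one_arrow R S F"
proof (intro quotient_one_arrow.intro quotient_one_arrow_axioms.intro R S F)
  interpret R: doctrine_with_quotients R by fact
  interpret S: doctrine_with_quotients S by fact
  interpret F: one_arrow R S F by fact
  fix X \<rho> V q' assume X: "X \<in> Obj R" and \<rho>: "\<rho> \<in> equiv_rels R X" and q': "quotient_arrow R X \<rho> V q'"
  note r = R.equiv_relsD(1)[OF X \<rho>]
  obtain W q where q: "quotient_arrow R X \<rho> W q"
    and Fq: "quotient_arrow S (FObj F X) (FRel F X X \<rho>) (FObj F W) (FArr F X W q)"
    using ex[OF X \<rho>] by blast
  obtain i where i: "iso_in R W V i" "q' = Comp R X W V i q" using R.quotient_arrow_unique[OF q q' r] by blast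
  have a: "arr R X W q" "arr R X V q'" using q q' r by (auto intro: R.quotient_arrow_arr)
  note o = R.arr_obj[OF a(1)] R.arr_obj[OF a(2)]
  have "arr R W V i" using i(1) o by (simp add: R.iso_in_arr)
  then show "quotient_arrow S (FObj F X) (FRel F X X \<rho>) (FObj F V) (FArr F X V q')"
    using S.quotient_arrow_comp_iso[OF Fq F.iso[OF o(2,4) i(1)] F.rel[OF r] F.obj[OF o(4)]] a(1)
    by (simp add: i(2) F.comp)
qed

lemma comp_one_arrow_simps:
  "X \<in> Obj R \<Longrightarrow> FObj (comp_one_arrow R G F) X = FObj G (FObj F X)"
  "arr R X Y f \<Longrightarrow> FArr (comp_one_arrow R G F) X Y f = FArr G (FObj F X) (FObj F Y) (FArr F X Y f)"
  "rel R X Y \<alpha> \<Longrightarrow> FRel (comp_one_arrow R G F) X Y \<alpha> = FRel G (FObj F X) (FObj F Y) (FRel F X Y \<alpha>)"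
  by (simp_all add: comp_one_arrow_def mk_arr_def mk_rel_def arr_def rel_def)

lemma id_one_arrow_simps:
  "X \<in> Obj R \<Longrightarrow> FObj (id_one_arrow R) X = X"
  "arr R X Y f \<Longrightarrow> FArr (id_one_arrow R) X Y f = f"
  "rel R X Y \<alpha> \<Longrightarrow> FRel (id_one_arrow R) X Y \<alpha> = \<alpha>"
  by (simp_all add: id_one_arrow_def mk_arr_def mk_rel_def arr_def rel_def)

lemma one_arrow_id:
  assumes "relational_doctrine R" shows "one_arrow R R (id_one_arrow R)"
proof -
  interpret relational_doctrine R by fact
  let ?I = "id_one_arrow R"
  show ?thesis
  proof (rule one_arrowI[OF assms assms])
    fix X Y \<alpha> \<beta> assume a: "rle R X Y \<alpha> \<beta>"
    then show "rle R (FObj ?I X) (FObj ?I Y)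
        (FRel ?I X Y \<alpha>) (FRel ?I X Y \<beta>)"
      using rleD(1,2)[OF a] by (simp add: id_one_arrow_simps relD)
  next
    show "FObj ?I \<in> extensional (Obj R)" by (simp add: id_one_arrow_def)
  next
    fix X Y f assume "\<not> arr R X Y f"
    then show "FArr ?I X Y f = undefined" by (auto simp: id_one_arrow_def mk_arr_def arr_def)
  next
    fix X Y \<alpha> assume "\<not> rel R X Y \<alpha>"
    then show "FRel ?I X Y \<alpha> = undefined" by (auto simp: id_one_arrow_def mk_rel_def rel_def)
  qed (simp_all add: id_one_arrow_simps arr_obj arr_comp arr_ident relD rel_reidx rel_diag
      rel_rcomp rel_conv rle_refl)
qed

lemma one_arrow_comp:
  assumes F: "one_arrow R S F" and G: "one_arrow S T G"
  shows "one_arrow R T (comp_one_arrow R G F)"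
proof -
  interpret F: one_arrow R S F by fact
  interpret G: one_arrow S T G by fact
  note s = comp_one_arrow_simps
  let ?GF = "comp_one_arrow R G F"
  show ?thesis
  proof (rule one_arrowI[OF F.dom.relational_doctrine_axioms G.cod.relational_doctrine_axioms])
    fix X assume X: "X \<in> Obj R"
    show "rle T (FObj ?GF X) (FObj ?GF X)
        (Diag T (FObj ?GF X)) (FRel ?GF X X (Diag R X))"
      using X G.cod.rle_trans[OF G.diag_le[OF F.obj[OF X]] G.rle[OF F.diag_le[OF X]]]
      by (simp add: s F.dom.rel_diag)
  next
    fix X Y Z \<alpha> \<beta> assume a: "rel R X Y \<alpha>" "rel R Y Z \<beta>"
    show "rle T (FObj ?GF X) (FObj ?GF Z)
        (RComp T (FObj ?GF X) (FObj ?GF Y) (FObj ?GF Z)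
          (FRel ?GF X Y \<alpha>) (FRel ?GF Y Z \<beta>))
        (FRel ?GF X Z (RComp R X Y Z \<alpha> \<beta>))"
      using a G.cod.rle_trans[OF G.rcomp_le[OF F.rel[OF a(1)] F.rel[OF a(2)]] G.rle[OF F.rcomp_le[OF a]]]
      by (simp add: s F.dom.rel_rcomp F.dom.relD[OF a(1)] F.dom.relD[OF a(2)])
  next
    fix X Y \<alpha> assume a: "rel R X Y \<alpha>"
    show "rle T (FObj ?GF Y) (FObj ?GF X)
        (Conv T (FObj ?GF X) (FObj ?GF Y)
          (FRel ?GF X Y \<alpha>)) (FRel ?GF Y X (Conv R X Y \<alpha>))"
      using a G.cod.rle_trans[OF G.conv_le[OF F.rel[OF a]] G.rle[OF F.conv_le[OF a]]]
      by (simp add: s F.dom.rel_conv F.dom.relD[OF a])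
  next
    fix X Y \<alpha> \<beta> assume a: "rle R X Y \<alpha> \<beta>"
    show "rle T (FObj ?GF X) (FObj ?GF Y)
       (FRel ?GF X Y \<alpha>) (FRel ?GF X Y \<beta>)"
      using G.rle[OF F.rle[OF a]] F.dom.rleD[OF a] by (simp add: s F.dom.relD)
  next
    show "FObj ?GF \<in> extensional (Obj R)" by (simp add: comp_one_arrow_def)
  next
    fix X Y f assume "\<not> arr R X Y f"
    then show "FArr ?GF X Y f = undefined" by (auto simp: comp_one_arrow_def mk_arr_def arr_def)
  next
    fix X Y \<alpha> assume "\<not> rel R X Y \<alpha>"
    then show "FRel ?GF X Y \<alpha> = undefined" by (auto simp: comp_one_arrow_def mk_rel_def rel_def)
  qed (simp_all add: s F.obj G.obj F.arr G.arr F.dom.arr_obj F.dom.arr_ident F.dom.arr_comp F.dom.rel_reidx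
      F.ident G.ident F.comp G.comp F.reidx G.reidx F.rel)
qed

lemma quotient_one_arrow_id:
  assumes "doctrine_with_quotients R" shows "quotient_one_arrow R R (id_one_arrow R)"
proof -
  interpret doctrine_with_quotients R by fact
  show ?thesis
  proof (rule quotient_one_arrowI[OF assms assms one_arrow_id[OF relational_doctrine_axioms]])
    fix X \<rho> assume X: "X \<in> Obj R" and \<rho>: "\<rho> \<in> equiv_rels R X"
    obtain W q where q: "quotient_arrow R X \<rho> W q" using has_quotients[OF X \<rho>] by blast
    note r = equiv_relsD(1)[OF X \<rho>] and a = quotient_arrow_arr[OF q equiv_relsD(1)[OF X \<rho>]]
    show "\<exists>W q. quotient_arrow R X \<rho> W q \<and> quotient_arrow R (FObj (id_one_arrow R) X)
        (FRel (id_one_arrow R) X X \<rho>) (FObj (id_one_arrow R) W) (FArr (id_one_arrow R) X W q)"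
      using q r a X arr_obj(2)[OF a]
      by (intro exI[of _ W] exI[of _ q]) (simp add: id_one_arrow_simps)
  qed
qed

lemma quotient_one_arrow_comp:
  assumes F: "quotient_one_arrow R S F" and G: "quotient_one_arrow S T G"
  shows "quotient_one_arrow R T (comp_one_arrow R G F)"
proof -
  interpret F: quotient_one_arrow R S F by fact
  interpret G: quotient_one_arrow S T G by fact
  show ?thesis
  proof (rule quotient_one_arrowI[OF F.dom.doctrine_with_quotients_axioms G.cod.doctrine_with_quotients_axioms
        one_arrow_comp[OF F.one_arrow_axioms G.one_arrow_axioms]])
    fix X \<rho> assume X: "X \<in> Obj R" and \<rho>: "\<rho> \<in> equiv_rels R X"
    obtain W q where q: "quotient_arrow R X \<rho> W q" using F.dom.has_quotients[OF X \<rho>] by blast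
    note r = F.dom.equiv_relsD(1)[OF X \<rho>]
    note a = F.dom.quotient_arrow_arr[OF q r]
    note G.preserves_quotients[OF F.obj[OF X] F.equiv[OF X \<rho>] F.preserves_quotients[OF X \<rho> q]]
    then show "\<exists>W q. quotient_arrow R X \<rho> W q \<and> quotient_arrow T (FObj (comp_one_arrow R G F) X)
        (FRel (comp_one_arrow R G F) X X \<rho>) (FObj (comp_one_arrow R G F) W) (FArr (comp_one_arrow R G F) X W q)"
      using q r a X F.dom.arr_obj(2)[OF a]
      by (intro exI[of _ W] exI[of _ q]) (simp add: comp_one_arrow_simps)
  qed
qed


subsection \<open>Two-arrows\<close>

lemma two_arrowsD:
  assumes "\<theta> \<in> two_arrows R S F G" "one_arrow R S F" "one_arrow R S G"
  shows two_arrow_ext: "\<theta> \<in> extensional (Obj R)"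
    and two_arrow_arr: "X \<in> Obj R \<Longrightarrow> arr S (FObj F X) (FObj G X) (\<theta> X)"
    and two_arrow_natural: "arr R X Y f \<Longrightarrow>
      Comp S (FObj F X) (FObj F Y) (FObj G Y) (\<theta> Y) (FArr F X Y f) =
      Comp S (FObj F X) (FObj G X) (FObj G Y) (FArr G X Y f) (\<theta> X)"
    and two_arrow_square: "rel R X Y \<alpha> \<Longrightarrow>
      square S (FObj F X) (FObj G X) (FObj F Y) (FObj G Y) (\<theta> X) (\<theta> Y) (FRel F X Y \<alpha>) (FRel G X Y \<alpha>)"
proof -
  interpret F: one_arrow R S F by fact
  interpret G: one_arrow R S G by fact
  note t = assms(1)[unfolded two_arrows_def nat_trans_def]
  then show "\<theta> \<in> extensional (Obj R)" by (simp add: PiE_def)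
  show a: "arr S (FObj F X) (FObj G X) (\<theta> X)" if "X \<in> Obj R" for X
    using t that by (auto simp: arr_def F.obj G.obj)
  show "Comp S (FObj F X) (FObj F Y) (FObj G Y) (\<theta> Y) (FArr F X Y f) =
      Comp S (FObj F X) (FObj G X) (FObj G Y) (FArr G X Y f) (\<theta> X)" if "arr R X Y f"
    using t that unfolding arr_def by blast
  show "square S (FObj F X) (FObj G X) (FObj F Y) (FObj G Y) (\<theta> X) (\<theta> Y) (FRel F X Y \<alpha>) (FRel G X Y \<alpha>)"
    if "rel R X Y \<alpha>"
    using t that F.rel[OF that] G.rel[OF that] a[OF F.dom.relD(1)[OF that]] a[OF F.dom.relD(2)[OF that]]
    by (auto simp: square_def rle_def F.cod.rel_reidx) (auto simp: rel_def)
qed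

lemma two_arrowsI:
  assumes F: "one_arrow R S F" and G: "one_arrow R S G" and "\<theta> \<in> extensional (Obj R)"
    and arr: "\<And>X. X \<in> Obj R \<Longrightarrow> arr S (FObj F X) (FObj G X) (\<theta> X)"
    and nat: "\<And>X Y f. arr R X Y f \<Longrightarrow>
      Comp S (FObj F X) (FObj F Y) (FObj G Y) (\<theta> Y) (FArr F X Y f) =
      Comp S (FObj F X) (FObj G X) (FObj G Y) (FArr G X Y f) (\<theta> X)"
    and square: "\<And>X Y \<alpha>. rel R X Y \<alpha> \<Longrightarrow>
      square S (FObj F X) (FObj G X) (FObj F Y) (FObj G Y) (\<theta> X) (\<theta> Y) (FRel F X Y \<alpha>) (FRel G X Y \<alpha>)"
  shows "\<theta> \<in> two_arrows R S F G"
  using assms(3-6) unfolding two_arrows_def nat_trans_def square_def rle_def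
  by (auto simp: PiE_def arr_def rel_def)

lemma two_arrow_ident:
  assumes F: "one_arrow R S F"
  shows "(\<lambda>X\<in>Obj R. Ident S (FObj F X)) \<in> two_arrows R S F F"
proof -
  interpret F: one_arrow R S F by fact
  show ?thesis
    by (rule two_arrowsI[OF F F])
      (simp_all add: F.obj F.cod.arr_ident F.dom.arr_obj F.arr F.cod.ident_left F.cod.ident_right F.dom.relD
        F.cod.square_id_iff F.cod.rle_refl F.rel)
qed

lemma two_arrow_comp:
  assumes F: "one_arrow R S F" and G: "one_arrow R S G" and H: "one_arrow R S H"
    and \<theta>: "\<theta> \<in> two_arrows R S F G" and \<phi>: "\<phi> \<in> two_arrows R S G H"
  shows "(\<lambda>X\<in>Obj R. Comp S (FObj F X) (FObj G X) (FObj H X) (\<phi> X) (\<theta> X)) \<in> two_arrows R S F H"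
proof -
  interpret F: one_arrow R S F by fact
  interpret G: one_arrow R S G by fact
  interpret H: one_arrow R S H by fact
  note t = two_arrowsD[OF \<theta> F G] and p = two_arrowsD[OF \<phi> G H]
  show ?thesis
  proof (rule two_arrowsI[OF F H])
    fix X Y f assume f: "arr R X Y f"
    note o = F.dom.arr_obj[OF f]
    have "Comp S (FObj F X) (FObj F Y) (FObj H Y) (Comp S (FObj F Y) (FObj G Y) (FObj H Y) (\<phi> Y) (\<theta> Y)) (FArr F X Y f)
      = Comp S (FObj F X) (FObj G Y) (FObj H Y) (\<phi> Y) (Comp S (FObj F X) (FObj G X) (FObj G Y) (FArr G X Y f) (\<theta> X))"
      using t(3)[OF f] F.cod.assoc[OF F.arr[OF f] t(2)[OF o(2)] p(2)[OF o(2)]] by simp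
    also have "\<dots> = Comp S (FObj F X) (FObj G X) (FObj H Y)
        (Comp S (FObj G X) (FObj H X) (FObj H Y) (FArr H X Y f) (\<phi> X)) (\<theta> X)"
      using p(3)[OF f] F.cod.assoc[OF t(2)[OF o(1)] G.arr[OF f] p(2)[OF o(2)]] by simp
    also have "\<dots> = Comp S (FObj F X) (FObj H X) (FObj H Y) (FArr H X Y f)
        (Comp S (FObj F X) (FObj G X) (FObj H X) (\<phi> X) (\<theta> X))"
      using F.cod.assoc[OF t(2)[OF o(1)] p(2)[OF o(1)] H.arr[OF f]] by simp
    finally show "Comp S (FObj F X) (FObj F Y) (FObj H Y)
        ((\<lambda>X\<in>Obj R. Comp S (FObj F X) (FObj G X) (FObj H X) (\<phi> X) (\<theta> X)) Y) (FArr F X Y f) =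
      Comp S (FObj F X) (FObj H X) (FObj H Y) (FArr H X Y f)
        ((\<lambda>X\<in>Obj R. Comp S (FObj F X) (FObj G X) (FObj H X) (\<phi> X) (\<theta> X)) X)"
      using o by simp
  next
    fix X Y \<alpha> assume a: "rel R X Y \<alpha>"
    show "square S (FObj F X) (FObj H X) (FObj F Y) (FObj H Y)
       ((\<lambda>X\<in>Obj R. Comp S (FObj F X) (FObj G X) (FObj H X) (\<phi> X) (\<theta> X)) X)
       ((\<lambda>X\<in>Obj R. Comp S (FObj F X) (FObj G X) (FObj H X) (\<phi> X) (\<theta> X)) Y) (FRel F X Y \<alpha>) (FRel H X Y \<alpha>)"
      using F.cod.square_vertical[OF t(4)[OF a] p(4)[OF a]] F.dom.relD[OF a] by simp
  qed (use t p in \<open>auto intro: F.cod.arr_comp\<close>)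
qed

lemma RD_hom_simps:
  "Obj (RD_hom R S) = {F. one_arrow R S F}" "Hom (RD_hom R S) = two_arrows R S"
  "Ident (RD_hom R S) F = (\<lambda>X\<in>Obj R. Ident S (FObj F X))"
  "Comp (RD_hom R S) F G H \<phi> \<theta> = (\<lambda>X\<in>Obj R. Comp S (FObj F X) (FObj G X) (FObj H X) (\<phi> X) (\<theta> X))"
  and QRD_hom_simps:
  "Obj (QRD_hom R S) = {F. quotient_one_arrow R S F}" "Hom (QRD_hom R S) = two_arrows R S"
  "Ident (QRD_hom R S) F = (\<lambda>X\<in>Obj R. Ident S (FObj F X))"
  "Comp (QRD_hom R S) F G H \<phi> \<theta> = (\<lambda>X\<in>Obj R. Comp S (FObj F X) (FObj G X) (FObj H X) (\<phi> X) (\<theta> X))"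
  by (simp_all add: RD_hom_def QRD_hom_def)

lemma RD_hom_category: "category (RD_hom R S)"
proof
  fix F G \<theta> assume "F \<in> Obj (RD_hom R S)" "G \<in> Obj (RD_hom R S)" and t: "\<theta> \<in> Hom (RD_hom R S) F G"
  then have F: "one_arrow R S F" and G: "one_arrow R S G" and t: "\<theta> \<in> two_arrows R S F G"
    by (simp_all add: RD_hom_simps)
  interpret F: one_arrow R S F by fact
  note t = two_arrowsD[OF t F G]
  show "Comp (RD_hom R S) F F G \<theta> (Ident (RD_hom R S) F) = \<theta>"
    "Comp (RD_hom R S) F G G (Ident (RD_hom R S) G) \<theta> = \<theta>"
    using t by (auto intro!: extensionalityI[of _ "Obj R"]
        simp: RD_hom_simps F.cod.ident_left F.cod.ident_right)
next
  fix F G H K \<theta> \<phi> \<psi> assume "F \<in> Obj (RD_hom R S)" "G \<in> Obj (RD_hom R S)" "H \<in> Obj (RD_hom R S)"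
    "K \<in> Obj (RD_hom R S)" "\<theta> \<in> Hom (RD_hom R S) F G" "\<phi> \<in> Hom (RD_hom R S) G H" "\<psi> \<in> Hom (RD_hom R S) H K"
  then have o: "one_arrow R S F" "one_arrow R S G" "one_arrow R S H" "one_arrow R S K" and
      m: "\<theta> \<in> two_arrows R S F G" "\<phi> \<in> two_arrows R S G H" "\<psi> \<in> two_arrows R S H K"
    by (simp_all add: RD_hom_simps)
  interpret F: one_arrow R S F by fact
  note t = two_arrowsD[OF m(1) o(1,2)] and p = two_arrowsD[OF m(2) o(2,3)] and s = two_arrowsD[OF m(3) o(3,4)]
  show "Comp (RD_hom R S) F H K \<psi> (Comp (RD_hom R S) F G H \<phi> \<theta>) =
      Comp (RD_hom R S) F G K (Comp (RD_hom R S) G H K \<psi> \<phi>) \<theta>"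
    using t p s by (auto simp: RD_hom_simps F.cod.assoc intro!: restrict_ext)
qed (simp_all add: RD_hom_simps two_arrow_ident two_arrow_comp)

lemma QRD_hom_category: "category (QRD_hom R S)"
proof -
  interpret category "RD_hom R S" by (rule RD_hom_category)
  have s: "F \<in> Obj (QRD_hom R S) \<Longrightarrow> F \<in> Obj (RD_hom R S)" for F
    by (simp add: RD_hom_simps QRD_hom_simps quotient_one_arrow.axioms)
  have e: "Hom (QRD_hom R S) = Hom (RD_hom R S)" "Ident (QRD_hom R S) = Ident (RD_hom R S)"
    "Comp (QRD_hom R S) = Comp (RD_hom R S)" by (simp_all add: QRD_hom_def)
  show ?thesis
    by unfold_locales (simp_all add: e s ident_in comp_in comp_ident_left comp_ident_right comp_assoc)
qed

lemma Uq_hom_functor: "cat_functor (QRD_hom R S) (RD_hom R S) (Uq_hom R S)"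
proof -
  interpret Q: category "QRD_hom R S" by (rule QRD_hom_category)
  interpret category "RD_hom R S" by (rule RD_hom_category)
  show ?thesis
    by unfold_locales
      (auto simp: Uq_hom_def id_functor_def mk_arr_def Q.ident_in Q.comp_in,
       auto simp: RD_hom_simps QRD_hom_simps quotient_one_arrow.axioms)
qed

lemma precomp_functor:
  assumes E: "one_arrow R K E"
  shows "cat_functor (RD_hom K S) (RD_hom R S) (precomp R K S E)"
proof -
  interpret E: one_arrow R K E by fact
  interpret K: category "RD_hom K S" by (rule RD_hom_category)
  interpret category "RD_hom R S" by (rule RD_hom_category)
  have w: "(\<lambda>X\<in>Obj R. \<theta> (FObj E X)) \<in> two_arrows R S (comp_one_arrow R G E) (comp_one_arrow R G' E)"
    if G: "one_arrow K S G" and G': "one_arrow K S G'" and \<theta>: "\<theta> \<in> two_arrows K S G G'" for G G' \<theta>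
  proof -
    interpret G: one_arrow K S G by fact
    interpret G': one_arrow K S G' by fact
    note t = two_arrowsD[OF \<theta> G G']
    show ?thesis
      by (rule two_arrowsI[OF one_arrow_comp[OF E G] one_arrow_comp[OF E G']])
        (simp_all add: comp_one_arrow_simps E.obj t E.dom.arr_obj E.arr E.dom.relD E.rel)
  qed
  show ?thesis
  proof
    show "FObj (precomp R K S E) \<in> Obj (RD_hom K S) \<rightarrow>\<^sub>E Obj (RD_hom R S)"
      using E by (auto simp: precomp_def RD_hom_simps one_arrow_comp)
  next
    fix F assume F: "F \<in> Obj (RD_hom K S)"
    then show "FArr (precomp R K S E) F F (Ident (RD_hom K S) F) = Ident (RD_hom R S) (FObj (precomp R K S E) F)"
      using K.ident_in[OF F] 
      by (auto simp: precomp_def mk_arr_def RD_hom_simps E.obj comp_one_arrow_simps intro!: restrict_ext)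
  next
    fix F G H \<theta> \<phi> assume a: "F \<in> Obj (RD_hom K S)" "G \<in> Obj (RD_hom K S)" "H \<in> Obj (RD_hom K S)"
      "\<theta> \<in> Hom (RD_hom K S) F G" "\<phi> \<in> Hom (RD_hom K S) G H"
    show "FArr (precomp R K S E) F H (Comp (RD_hom K S) F G H \<phi> \<theta>) =
       Comp (RD_hom R S) (FObj (precomp R K S E) F) (FObj (precomp R K S E) G) (FObj (precomp R K S E) H)
         (FArr (precomp R K S E) G H \<phi>) (FArr (precomp R K S E) F G \<theta>)"
      using a K.comp_in[OF a] 
      by (auto simp: precomp_def mk_arr_def RD_hom_simps E.obj comp_one_arrow_simps intro!: restrict_ext)
  next
    fix F G \<theta> assume a: "F \<in> Obj (RD_hom K S)" "G \<in> Obj (RD_hom K S)" "\<theta> \<in> Hom (RD_hom K S) F G"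
    then show "FArr (precomp R K S E) F G \<theta> \<in> Hom (RD_hom R S) (FObj (precomp R K S E) F) (FObj (precomp R K S E) G)"
      using w by (simp add: precomp_def mk_arr_def RD_hom_simps)
  qed (auto simp: precomp_def mk_arr_def)
qed


section \<open>The intensional quotient completion\<close>

lemma qcompl_simps:
  "(X, \<rho>) \<in> Obj (qcompl R) \<longleftrightarrow> X \<in> Obj R \<and> \<rho> \<in> equiv_rels R X"
  "Ident (qcompl R) (X, \<rho>) = Ident R X"
  "Comp (qcompl R) (X, \<rho>) (Y, \<sigma>) (Z, \<tau>) = Comp R X Y Z"
  "Le (qcompl R) (X, \<rho>) (Y, \<sigma>) = Le R X Y"
  "Reidx (qcompl R) (X, \<rho>) (Y, \<sigma>) (Z, \<tau>) (V, \<upsilon>) = Reidx R X Y Z V"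
  "Diag (qcompl R) (X, \<rho>) = \<rho>"
  "RComp (qcompl R) (X, \<rho>) (Y, \<sigma>) (Z, \<tau>) = RComp R X Y Z"
  "Conv (qcompl R) (X, \<rho>) (Y, \<sigma>) = Conv R X Y"
  by (simp_all add: qcompl_def)

context relational_doctrine
begin

text \<open>
  Composing with an equivalence relation never makes a relation smaller, since equivalence
  relations are reflexive.
\<close>

lemma absorb_left:
  assumes "X \<in> Obj R" "\<rho> \<in> equiv_rels R X" "rle R X Y (RComp R X X Y \<rho> \<alpha>) \<alpha>"
  shows "RComp R X X Y \<rho> \<alpha> = \<alpha>"
  using rle_rcomp[OF diag_le_equiv[OF assms(1,2)] rle_refl, of Y \<alpha>] assms(3) rleD(2)[OF assms(3)]
  by (auto intro: rle_antisym simp: diag_left)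

lemma absorb_right:
  assumes "Y \<in> Obj R" "\<sigma> \<in> equiv_rels R Y" "rle R X Y (RComp R X Y Y \<alpha> \<sigma>) \<alpha>"
  shows "RComp R X Y Y \<alpha> \<sigma> = \<alpha>"
  using rle_rcomp[OF rle_refl diag_le_equiv[OF assms(1,2)], of X \<alpha>] assms(3) rleD(2)[OF assms(3)]
  by (auto intro: rle_antisym simp: diag_right)

lemma qcompl_hom:
  assumes "X \<in> Obj R" "\<rho> \<in> equiv_rels R X" "Y \<in> Obj R" "\<sigma> \<in> equiv_rels R Y"
  shows "f \<in> Hom (qcompl R) (X, \<rho>) (Y, \<sigma>) \<longleftrightarrow> square R X Y X Y f f \<rho> \<sigma>"
  using assms equiv_relsD(1)[OF assms(1,2)] equiv_relsD(1)[OF assms(3,4)]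
  by (auto simp: qcompl_def square_def arr_def rle_def rel_reidx)

text \<open>
  The two-sided saturation condition in the definition of the fibres splits into one condition for
  each side, which makes stability under composition and converse immediate.
\<close>

lemma qcompl_fib:
  assumes X: "X \<in> Obj R" "\<rho> \<in> equiv_rels R X" and Y: "Y \<in> Obj R" "\<sigma> \<in> equiv_rels R Y"
  shows "\<alpha> \<in> Fib (qcompl R) (X, \<rho>) (Y, \<sigma>) \<longleftrightarrow>
    rel R X Y \<alpha> \<and> RComp R X X Y \<rho> \<alpha> = \<alpha> \<and> RComp R X Y Y \<alpha> \<sigma> = \<alpha>"
proof
  note e = equiv_relsD[OF X] and e' = equiv_relsD[OF Y]
  assume "\<alpha> \<in> Fib (qcompl R) (X, \<rho>) (Y, \<sigma>)"
  then have a: "rel R X Y \<alpha>" and "Le R X Y (RComp R X Y Y (RComp R X X Y \<rho> \<alpha>) \<sigma>) \<alpha>"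
    using X Y by (simp_all add: qcompl_def rel_def e)
  then have s: "rle R X Y (RComp R X Y Y (RComp R X X Y \<rho> \<alpha>) \<sigma>) \<alpha>"
    by (simp add: rle_def rel_rcomp e e')
  have "rle R X Y (RComp R X Y Y (RComp R X X Y \<rho> \<alpha>) (Diag R Y)) (RComp R X Y Y (RComp R X X Y \<rho> \<alpha>) \<sigma>)"
    by (intro rle_rcomp rle_refl rel_rcomp e(1) e'(2) a)
  then have 1: "rle R X Y (RComp R X X Y \<rho> \<alpha>) \<alpha>"
    using s a e(1) by (simp add: diag_right rel_rcomp) (rule rle_trans)
  have "rle R X Y (RComp R X Y Y (RComp R X X Y (Diag R X) \<alpha>) \<sigma>) (RComp R X Y Y (RComp R X X Y \<rho> \<alpha>) \<sigma>)"
    by (intro rle_rcomp rle_refl rel_rcomp e(2) e'(1) a)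
  then have 2: "rle R X Y (RComp R X Y Y \<alpha> \<sigma>) \<alpha>"
    using s a by (simp add: diag_left) (rule rle_trans)
  from a 1 2 show "rel R X Y \<alpha> \<and> RComp R X X Y \<rho> \<alpha> = \<alpha> \<and> RComp R X Y Y \<alpha> \<sigma> = \<alpha>"
    by (intro conjI absorb_left absorb_right X Y)
next
  assume "rel R X Y \<alpha> \<and> RComp R X X Y \<rho> \<alpha> = \<alpha> \<and> RComp R X Y Y \<alpha> \<sigma> = \<alpha>"
  then show "\<alpha> \<in> Fib (qcompl R) (X, \<rho>) (Y, \<sigma>)"
    using rle_refl[of X Y \<alpha>] by (simp add: qcompl_def equiv_relsD[OF X] rle_def) (simp add: rel_def)
qed

lemma qcompl_relational_doctrine: "relational_doctrine (qcompl R)"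
proof -
  let ?Q = "qcompl R"
  note qs = qcompl_simps qcompl_hom qcompl_fib
  show ?thesis
  proof (unfold_locales; unfold split_paired_all)
    fix X \<rho> A \<sigma> Y \<tau> B \<upsilon> f g \<alpha>
    assume "(X, \<rho>) \<in> Obj ?Q" "(A, \<sigma>) \<in> Obj ?Q" "(Y, \<tau>) \<in> Obj ?Q" "(B, \<upsilon>) \<in> Obj ?Q"
      "f \<in> Hom ?Q (X, \<rho>) (A, \<sigma>)" "g \<in> Hom ?Q (Y, \<tau>) (B, \<upsilon>)"
      "\<alpha> \<in> Fib ?Q (A, \<sigma>) (B, \<upsilon>)"
    then have o: "X \<in> Obj R" "\<rho> \<in> equiv_rels R X" "Y \<in> Obj R" "\<tau> \<in> equiv_rels R Y"
      and f: "square R X A X A f f \<rho> \<sigma>" and g: "square R Y B Y B g g \<tau> \<upsilon>"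
      and a: "rel R A B \<alpha>" "RComp R A A B \<sigma> \<alpha> = \<alpha>" "RComp R A B B \<alpha> \<upsilon> = \<alpha>"
      by (simp_all add: qs)
    note s = square_reidx[OF squareD(1)[OF f] squareD(1)[OF g] a(1)]
    show "Reidx ?Q (X, \<rho>) (A, \<sigma>) (Y, \<tau>) (B, \<upsilon>) f g \<alpha> \<in> Fib ?Q (X, \<rho>) (Y, \<tau>)"
      using absorb_left[OF o(1,2), of Y "Reidx R X A Y B f g \<alpha>"] absorb_right[OF o(3,4), of X "Reidx R X A Y B f g \<alpha>"]
        squareD(5)[OF square_horizontal[OF f s]] squareD(5)[OF square_horizontal[OF s g]] squareD(3)[OF s] a o
      by (simp add: qs)
  next
    fix X \<rho> Y \<sigma> Z \<tau> \<alpha> \<beta>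
    assume "(X, \<rho>) \<in> Obj ?Q" "(Y, \<sigma>) \<in> Obj ?Q" "(Z, \<tau>) \<in> Obj ?Q"
      "\<alpha> \<in> Fib ?Q (X, \<rho>) (Y, \<sigma>)" "\<beta> \<in> Fib ?Q (Y, \<sigma>) (Z, \<tau>)"
    then show "RComp ?Q (X, \<rho>) (Y, \<sigma>) (Z, \<tau>) \<alpha> \<beta> \<in> Fib ?Q (X, \<rho>) (Z, \<tau>)"
      using reassoc[of X X \<rho> Y \<alpha> Z \<beta>] reassoc[of X Y \<alpha> Z \<beta> Z \<tau>]
      by (simp add: qs rel_rcomp equiv_relsD)
  next
    fix X \<rho> Y \<sigma> \<alpha>
    assume "(X, \<rho>) \<in> Obj ?Q" "(Y, \<sigma>) \<in> Obj ?Q" "\<alpha> \<in> Fib ?Q (X, \<rho>) (Y, \<sigma>)"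
    then show "Conv ?Q (X, \<rho>) (Y, \<sigma>) \<alpha> \<in> Fib ?Q (Y, \<sigma>) (X, \<rho>)"
      using conv_comp[of X X \<rho> Y \<alpha>] conv_comp[of X Y \<alpha> Y \<sigma>]
      by (simp add: qs rel_conv equiv_relsD)
  next
    fix X \<rho> assume "(X, \<rho>) \<in> Obj ?Q"
    then show "Ident ?Q (X, \<rho>) \<in> Hom ?Q (X, \<rho>) (X, \<rho>)"
      by (simp add: qs square_id_iff rle_refl equiv_relsD)
  next
    fix X \<rho> Y \<sigma> Z \<tau> f g
    assume "(X, \<rho>) \<in> Obj ?Q" "(Y, \<sigma>) \<in> Obj ?Q" "(Z, \<tau>) \<in> Obj ?Q"
      "f \<in> Hom ?Q (X, \<rho>) (Y, \<sigma>)" "g \<in> Hom ?Q (Y, \<sigma>) (Z, \<tau>)"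
    then show "Comp ?Q (X, \<rho>) (Y, \<sigma>) (Z, \<tau>) g f \<in> Hom ?Q (X, \<rho>) (Z, \<tau>)"
      by (auto simp: qs intro: square_vertical)
  next
    fix X \<rho> Y \<sigma> Z \<tau> A \<rho>' B \<sigma>' C \<tau>' f g h \<alpha> \<beta>
    assume "(X, \<rho>) \<in> Obj ?Q" "(Y, \<sigma>) \<in> Obj ?Q" "(Z, \<tau>) \<in> Obj ?Q"
      "(A, \<rho>') \<in> Obj ?Q" "(B, \<sigma>') \<in> Obj ?Q" "(C, \<tau>') \<in> Obj ?Q"
      "f \<in> Hom ?Q (X, \<rho>) (A, \<rho>')" "g \<in> Hom ?Q (Y, \<sigma>) (B, \<sigma>')" "h \<in> Hom ?Q (Z, \<tau>) (C, \<tau>')"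
      "\<alpha> \<in> Fib ?Q (A, \<rho>') (B, \<sigma>')" "\<beta> \<in> Fib ?Q (B, \<sigma>') (C, \<tau>')"
    then show "Le ?Q (X, \<rho>) (Z, \<tau>)
        (RComp ?Q (X, \<rho>) (Y, \<sigma>) (Z, \<tau>)
          (Reidx ?Q (X, \<rho>) (A, \<rho>') (Y, \<sigma>) (B, \<sigma>') f g \<alpha>)
          (Reidx ?Q (Y, \<sigma>) (B, \<sigma>') (Z, \<tau>) (C, \<tau>') g h \<beta>))
        (Reidx ?Q (X, \<rho>) (A, \<rho>') (Z, \<tau>) (C, \<tau>') f h
          (RComp ?Q (A, \<rho>') (B, \<sigma>') (C, \<tau>') \<alpha> \<beta>))"
      using rcomp_reidx[of X Y Z A B C f g h \<alpha> \<beta>]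
      by (auto simp: qs rel_def arr_def dest!: squareD(1))
  next
    fix X \<rho> Y \<sigma> f
    assume "(X, \<rho>) \<in> Obj ?Q" "(Y, \<sigma>) \<in> Obj ?Q" "f \<in> Hom ?Q (X, \<rho>) (Y, \<sigma>)"
    then show "Le ?Q (X, \<rho>) (X, \<rho>) (Diag ?Q (X, \<rho>))
        (Reidx ?Q (X, \<rho>) (Y, \<sigma>) (X, \<rho>) (Y, \<sigma>) f f (Diag ?Q (Y, \<sigma>)))"
      using squareD(5)[of X Y X Y f f \<rho> \<sigma>] by (simp add: qs rle_def)
  next
    fix X \<rho> Y \<sigma>
    assume a: "(X, \<rho>) \<in> Obj ?Q" "(Y, \<sigma>) \<in> Obj ?Q"
    then show "reflp_on (Fib ?Q (X, \<rho>) (Y, \<sigma>)) (Le ?Q (X, \<rho>) (Y, \<sigma>))"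
      using rle_refl by (auto simp: qs reflp_on_def rle_def)
    show "transp_on (Fib ?Q (X, \<rho>) (Y, \<sigma>)) (Le ?Q (X, \<rho>) (Y, \<sigma>))"
      using a rle_trans by (auto simp: qs transp_on_def rle_def)
    show "antisymp_on (Fib ?Q (X, \<rho>) (Y, \<sigma>)) (Le ?Q (X, \<rho>) (Y, \<sigma>))"
      using a rle_antisym by (auto simp: qs antisymp_on_def rle_def)
    show "monotone_on (Fib ?Q (X, \<rho>) (Y, \<sigma>)) (Le ?Q (X, \<rho>) (Y, \<sigma>))
        (Le ?Q (Y, \<sigma>) (X, \<rho>)) (Conv ?Q (X, \<rho>) (Y, \<sigma>))"
      using a rle_conv by (auto simp: qs monotone_on_def rle_def)
  next
    fix X \<rho> A \<sigma> Y \<tau> B \<upsilon> f g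
    assume "(X, \<rho>) \<in> Obj ?Q" "(A, \<sigma>) \<in> Obj ?Q" "(Y, \<tau>) \<in> Obj ?Q" "(B, \<upsilon>) \<in> Obj ?Q"
      "f \<in> Hom ?Q (X, \<rho>) (A, \<sigma>)" "g \<in> Hom ?Q (Y, \<tau>) (B, \<upsilon>)"
    then show "monotone_on (Fib ?Q (A, \<sigma>) (B, \<upsilon>)) (Le ?Q (A, \<sigma>) (B, \<upsilon>))
        (Le ?Q (X, \<rho>) (Y, \<tau>)) (Reidx ?Q (X, \<rho>) (A, \<sigma>) (Y, \<tau>) (B, \<upsilon>) f g)"
      using rle_reidx[of X A f Y B g] by (auto simp: qs monotone_on_def rle_def dest!: squareD(1))
  next
    fix X \<rho> Y \<sigma> Z \<tau> \<alpha> \<alpha>' \<beta> \<beta>'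
    assume "(X, \<rho>) \<in> Obj ?Q" "(Y, \<sigma>) \<in> Obj ?Q" "(Z, \<tau>) \<in> Obj ?Q"
      "\<alpha> \<in> Fib ?Q (X, \<rho>) (Y, \<sigma>)" "\<alpha>' \<in> Fib ?Q (X, \<rho>) (Y, \<sigma>)"
      "\<beta> \<in> Fib ?Q (Y, \<sigma>) (Z, \<tau>)" "\<beta>' \<in> Fib ?Q (Y, \<sigma>) (Z, \<tau>)"
      "Le ?Q (X, \<rho>) (Y, \<sigma>) \<alpha> \<alpha>'" "Le ?Q (Y, \<sigma>) (Z, \<tau>) \<beta> \<beta>'"
    then show "Le ?Q (X, \<rho>) (Z, \<tau>) (RComp ?Q (X, \<rho>) (Y, \<sigma>) (Z, \<tau>) \<alpha> \<beta>)
        (RComp ?Q (X, \<rho>) (Y, \<sigma>) (Z, \<tau>) \<alpha>' \<beta>')"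
      using rle_rcomp[of X Y \<alpha> \<alpha>' Z \<beta> \<beta>'] by (simp add: qs rle_def)
  next
    fix X \<rho> Y \<sigma> A \<rho>' B \<sigma>' f g \<alpha>
    assume "(X, \<rho>) \<in> Obj ?Q" "(Y, \<sigma>) \<in> Obj ?Q" "(A, \<rho>') \<in> Obj ?Q" "(B, \<sigma>') \<in> Obj ?Q"
      "f \<in> Hom ?Q (X, \<rho>) (A, \<rho>')" "g \<in> Hom ?Q (Y, \<sigma>) (B, \<sigma>')"
      "\<alpha> \<in> Fib ?Q (A, \<rho>') (B, \<sigma>')"
    then show "Le ?Q (Y, \<sigma>) (X, \<rho>)
        (Conv ?Q (X, \<rho>) (Y, \<sigma>) (Reidx ?Q (X, \<rho>) (A, \<rho>') (Y, \<sigma>) (B, \<sigma>') f g \<alpha>))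
        (Reidx ?Q (Y, \<sigma>) (B, \<sigma>') (X, \<rho>) (A, \<rho>') g f (Conv ?Q (A, \<rho>') (B, \<sigma>') \<alpha>))"
      using conv_reidx[of X Y A B f g \<alpha>] by (auto simp: qs rel_def arr_def dest!: squareD(1))
  next
    fix X \<rho> assume "(X, \<rho>) \<in> Obj ?Q"
    then show "Diag ?Q (X, \<rho>) \<in> Fib ?Q (X, \<rho>) (X, \<rho>)"
      "Conv ?Q (X, \<rho>) (X, \<rho>) (Diag ?Q (X, \<rho>)) = Diag ?Q (X, \<rho>)"
      by (simp_all add: qs equiv_relsD)
  next
    fix X \<rho> Y \<sigma> f
    assume "(X, \<rho>) \<in> Obj ?Q" "(Y, \<sigma>) \<in> Obj ?Q" "f \<in> Hom ?Q (X, \<rho>) (Y, \<sigma>)"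
    then show "Comp ?Q (X, \<rho>) (X, \<rho>) (Y, \<sigma>) f (Ident ?Q (X, \<rho>)) = f"
      "Comp ?Q (X, \<rho>) (Y, \<sigma>) (Y, \<sigma>) (Ident ?Q (Y, \<sigma>)) f = f"
      by (auto simp: qs ident_left ident_right dest: squareD)
  next
    fix X \<rho> Y \<sigma> Z \<tau> V \<upsilon> f g h
    assume "(X, \<rho>) \<in> Obj ?Q" "(Y, \<sigma>) \<in> Obj ?Q" "(Z, \<tau>) \<in> Obj ?Q" "(V, \<upsilon>) \<in> Obj ?Q"
      "f \<in> Hom ?Q (X, \<rho>) (Y, \<sigma>)" "g \<in> Hom ?Q (Y, \<sigma>) (Z, \<tau>)" "h \<in> Hom ?Q (Z, \<tau>) (V, \<upsilon>)"
    then show "Comp ?Q (X, \<rho>) (Z, \<tau>) (V, \<upsilon>) h (Comp ?Q (X, \<rho>) (Y, \<sigma>) (Z, \<tau>) g f) =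
        Comp ?Q (X, \<rho>) (Y, \<sigma>) (V, \<upsilon>) (Comp ?Q (Y, \<sigma>) (Z, \<tau>) (V, \<upsilon>) h g) f"
      by (auto simp: qs intro: assoc dest: squareD)
  next
    fix X \<rho> A \<rho>' V \<rho>'' Y \<sigma> B \<sigma>' W \<sigma>'' f f' g g' \<alpha>
    assume "(X, \<rho>) \<in> Obj ?Q" "(A, \<rho>') \<in> Obj ?Q" "(V, \<rho>'') \<in> Obj ?Q"
      "(Y, \<sigma>) \<in> Obj ?Q" "(B, \<sigma>') \<in> Obj ?Q" "(W, \<sigma>'') \<in> Obj ?Q"
      "f \<in> Hom ?Q (X, \<rho>) (A, \<rho>')" "f' \<in> Hom ?Q (A, \<rho>') (V, \<rho>'')"
      "g \<in> Hom ?Q (Y, \<sigma>) (B, \<sigma>')" "g' \<in> Hom ?Q (B, \<sigma>') (W, \<sigma>'')"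
      "\<alpha> \<in> Fib ?Q (V, \<rho>'') (W, \<sigma>'')"
    then show "Reidx ?Q (X, \<rho>) (V, \<rho>'') (Y, \<sigma>) (W, \<sigma>'')
         (Comp ?Q (X, \<rho>) (A, \<rho>') (V, \<rho>'') f' f) (Comp ?Q (Y, \<sigma>) (B, \<sigma>') (W, \<sigma>'') g' g) \<alpha> =
       Reidx ?Q (X, \<rho>) (A, \<rho>') (Y, \<sigma>) (B, \<sigma>') f g
         (Reidx ?Q (A, \<rho>') (V, \<rho>'') (B, \<sigma>') (W, \<sigma>'') f' g' \<alpha>)"
      by (auto simp: qs intro!: reidx_reidx[symmetric] dest!: squareD(1))
  next
    fix X \<rho> Y \<sigma> Z \<tau> V \<upsilon> \<alpha> \<beta> \<gamma>
    assume "(X, \<rho>) \<in> Obj ?Q" "(Y, \<sigma>) \<in> Obj ?Q" "(Z, \<tau>) \<in> Obj ?Q" "(V, \<upsilon>) \<in> Obj ?Q"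
      "\<alpha> \<in> Fib ?Q (X, \<rho>) (Y, \<sigma>)" "\<beta> \<in> Fib ?Q (Y, \<sigma>) (Z, \<tau>)" "\<gamma> \<in> Fib ?Q (Z, \<tau>) (V, \<upsilon>)"
    then show "RComp ?Q (X, \<rho>) (Y, \<sigma>) (V, \<upsilon>) \<alpha> (RComp ?Q (Y, \<sigma>) (Z, \<tau>) (V, \<upsilon>) \<beta> \<gamma>) =
        RComp ?Q (X, \<rho>) (Z, \<tau>) (V, \<upsilon>) (RComp ?Q (X, \<rho>) (Y, \<sigma>) (Z, \<tau>) \<alpha> \<beta>) \<gamma>"
      by (simp add: qs reassoc)
  qed (simp_all add: qs reidx_id conv_twice conv_comp)
qed

lemma qcompl_arr:
  "arr (qcompl R) (X, \<rho>) (Y, \<sigma>) f \<longleftrightarrow>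
     \<rho> \<in> equiv_rels R X \<and> \<sigma> \<in> equiv_rels R Y \<and> square R X Y X Y f f \<rho> \<sigma>"
  using squareD(1)[of X Y X Y f f \<rho> \<sigma>] unfolding arr_def
  by (auto simp: qcompl_simps qcompl_hom)

lemma qcompl_rel:
  "rel (qcompl R) (X, \<rho>) (Y, \<sigma>) \<alpha> \<longleftrightarrow>
     \<rho> \<in> equiv_rels R X \<and> \<sigma> \<in> equiv_rels R Y \<and> rel R X Y \<alpha> \<and> RComp R X X Y \<rho> \<alpha> = \<alpha> \<and> RComp R X Y Y \<alpha> \<sigma> = \<alpha>"
  unfolding rel_def[of "qcompl R"] using relD(1,2)[of X Y \<alpha>] by (auto simp: qcompl_simps qcompl_fib)

lemma qcompl_rle:
  "rle (qcompl R) (X, \<rho>) (Y, \<sigma>) \<alpha> \<beta> \<longleftrightarrow>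
     rel (qcompl R) (X, \<rho>) (Y, \<sigma>) \<alpha> \<and> rel (qcompl R) (X, \<rho>) (Y, \<sigma>) \<beta> \<and> rle R X Y \<alpha> \<beta>"
  by (auto simp: rle_def qcompl_simps qcompl_rel)

lemma qcompl_square:
  "square (qcompl R) (X, \<rho>) (A, \<sigma>) (Y, \<tau>) (B, \<upsilon>) f g \<alpha> \<beta> \<longleftrightarrow>
     arr (qcompl R) (X, \<rho>) (A, \<sigma>) f \<and> arr (qcompl R) (Y, \<tau>) (B, \<upsilon>) g \<and>
     rel (qcompl R) (X, \<rho>) (Y, \<tau>) \<alpha> \<and> rel (qcompl R) (A, \<sigma>) (B, \<upsilon>) \<beta> \<and> square R X A Y B f g \<alpha> \<beta>"
proof -
  interpret Q: relational_doctrine "qcompl R" by (rule qcompl_relational_doctrine)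
  show ?thesis
    unfolding square_def[of "qcompl R"] qcompl_simps qcompl_rle
    using Q.rel_reidx[of "(X, \<rho>)" "(A, \<sigma>)" f "(Y, \<tau>)" "(B, \<upsilon>)" g \<beta>, unfolded qcompl_simps]
    by (auto simp: square_def qcompl_arr qcompl_rel)
qed

text \<open>
  The identity relation of \<open>(X, \<rho>)\<close> is \<open>\<rho>\<close>, so reflexivity in the completion means lying above \<open>\<rho>\<close>.
  Such an equivalence relation is saturated because it is transitive.
\<close>

lemma qcompl_equiv_rels:
  assumes "X \<in> Obj R" "\<rho> \<in> equiv_rels R X"
  shows "\<sigma> \<in> equiv_rels (qcompl R) (X, \<rho>) \<longleftrightarrow> \<sigma> \<in> equiv_rels R X \<and> rle R X X \<rho> \<sigma>"
proof
  interpret Q: relational_doctrine "qcompl R" by (rule qcompl_relational_doctrine)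
  have X: "(X, \<rho>) \<in> Obj (qcompl R)" using assms by (simp add: qcompl_simps)
  note r = equiv_relsD[OF assms]
  {
    assume "\<sigma> \<in> equiv_rels (qcompl R) (X, \<rho>)"
    then have "rle R X X \<rho> \<sigma>" "rle R X X (Conv R X X \<sigma>) \<sigma>" "rle R X X (RComp R X X X \<sigma> \<sigma>) \<sigma>"
      unfolding Q.equiv_rels_iff[OF X] qcompl_simps qcompl_rle by simp_all
    with rle_trans[OF r(2)] show "\<sigma> \<in> equiv_rels R X \<and> rle R X X \<rho> \<sigma>"
      using assms by (simp add: equiv_rels_iff)
  next
    assume s: "\<sigma> \<in> equiv_rels R X \<and> rle R X X \<rho> \<sigma>"
    then have t: "\<sigma> \<in> equiv_rels R X" "rle R X X \<rho> \<sigma>" by simp_all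
    note e = equiv_relsD[OF assms(1) t(1)]
    have "rle R X X (RComp R X X X \<rho> \<sigma>) \<sigma>" "rle R X X (RComp R X X X \<sigma> \<rho>) \<sigma>"
      using rle_trans[OF rle_rcomp[OF t(2) rle_refl] e(3)] rle_trans[OF rle_rcomp[OF rle_refl t(2)] e(3)] e(1)
      by blast+
    then have "RComp R X X X \<rho> \<sigma> = \<sigma>" "RComp R X X X \<sigma> \<rho> = \<sigma>"
      by (blast intro: absorb_left absorb_right assms)+
    then show "\<sigma> \<in> equiv_rels (qcompl R) (X, \<rho>)"
      unfolding Q.equiv_rels_iff[OF X] qcompl_simps qcompl_rle qcompl_rel
      using assms t e r by (simp add: rle_refl)
  }
qed

text \<open>
  An arrow out of \<open>(X, \<rho>)\<close> is also an arrow out of \<open>(X, \<sigma>)\<close> exactly when \<open>\<sigma>\<close> lies below its kernel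
  in the completion.  So the factorisation of such an arrow through the identity of \<open>X\<close> is the arrow
  itself.
\<close>

lemma qcompl_quotient_arrow:
  assumes X: "X \<in> Obj R" and \<rho>: "\<rho> \<in> equiv_rels R X" and \<sigma>: "\<sigma> \<in> equiv_rels (qcompl R) (X, \<rho>)"
  shows "quotient_arrow (qcompl R) (X, \<rho>) \<sigma> (X, \<sigma>) (Ident R X)"
proof -
  interpret Q: relational_doctrine "qcompl R" by (rule qcompl_relational_doctrine)
  have s: "\<sigma> \<in> equiv_rels R X" "rle R X X \<rho> \<sigma>" using \<sigma> by (simp_all add: qcompl_equiv_rels[OF X \<rho>])
  have QX: "(X, \<rho>) \<in> Obj (qcompl R)" using assms by (simp add: qcompl_simps)
  note e = equiv_relsD[OF X s(1)] 
  show ?thesis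
  proof (rule Q.quotient_arrowI)
    show "square (qcompl R) (X, \<rho>) (X, \<sigma>) (X, \<rho>) (X, \<sigma>) (Ident R X) (Ident R X) \<sigma> (Diag (qcompl R) (X, \<sigma>))"
      using Q.equiv_relsD(1)[OF QX \<sigma>]
      by (simp add: qcompl_square qcompl_simps qcompl_arr \<rho> s square_id_iff rle_refl e) (simp add: qcompl_rel s e)
  next
    fix Z' f assume a: "square (qcompl R) (X, \<rho>) Z' (X, \<rho>) Z' f f \<sigma> (Diag (qcompl R) Z')"
    obtain Z \<tau> where Z': "Z' = (Z, \<tau>)" by (cases Z')
    have "arr (qcompl R) (X, \<sigma>) Z' f" and z: "square R X Z X Z f f \<sigma> \<tau>"
      using a s unfolding Z' by (simp_all add: qcompl_square qcompl_arr qcompl_simps)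
    moreover note squareD(1)[OF z]
    ultimately show "\<exists>h. arr (qcompl R) (X, \<sigma>) Z' h \<and> Comp (qcompl R) (X, \<rho>) (X, \<sigma>) Z' h (Ident R X) = f"
      by (auto simp: Z' qcompl_simps ident_right)
  next
    fix Z' h h' assume a: "arr (qcompl R) (X, \<sigma>) Z' h" "arr (qcompl R) (X, \<sigma>) Z' h'"
      "Comp (qcompl R) (X, \<rho>) (X, \<sigma>) Z' h (Ident R X) = Comp (qcompl R) (X, \<rho>) (X, \<sigma>) Z' h' (Ident R X)"
    obtain Z \<tau> where Z': "Z' = (Z, \<tau>)" by (cases Z')
    have "arr R X Z h" "arr R X Z h'" using a unfolding Z' by (auto simp: qcompl_arr dest: squareD(1))
    then show "h = h'" using a(3) by (simp add: Z' qcompl_simps ident_right)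
  qed
qed

lemma qcompl_with_quotients: "doctrine_with_quotients (qcompl R)"
proof (intro doctrine_with_quotients.intro doctrine_with_quotients_axioms.intro qcompl_relational_doctrine)
  interpret Q: relational_doctrine "qcompl R" by (rule qcompl_relational_doctrine)
  fix X' \<sigma> assume a: "X' \<in> Obj (qcompl R)" "\<sigma> \<in> equiv_rels (qcompl R) X'"
  obtain X \<rho> where X': "X' = (X, \<rho>)" by (cases X')
  have X: "X \<in> Obj R" "\<rho> \<in> equiv_rels R X" using a by (simp_all add: X' qcompl_simps)
  note q = qcompl_quotient_arrow[OF X a(2)[unfolded X']]
  have s: "\<sigma> \<in> equiv_rels R X" using a X by (simp add: X' qcompl_equiv_rels)
  note e = equiv_relsD[OF X(1) s]
  have k: "Reidx R X X X X (Ident R X) (Ident R X) \<sigma> = \<sigma>" by (rule reidx_id[OF e(1)])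
  have "effective (qcompl R) (X, \<rho>) \<sigma> (X, \<sigma>) (Ident R X)" "descent (qcompl R) (X, \<rho>) (X, \<sigma>) (Ident R X)"
    using rle_refl[OF e(1)]
    by (simp_all add: effective_def descent_def kernel_def graph_def qcompl_simps k e rle_def)
  then show "\<exists>W q. quotient_arrow (qcompl R) X' \<sigma> W q \<and> effective (qcompl R) X' \<sigma> W q \<and>
      descent (qcompl R) X' W q"
    using q unfolding X' by blast
qed

end

lemma unit_arrow_simps:
  "X \<in> Obj R \<Longrightarrow> FObj (unit_arrow R) X = (X, Diag R X)"
  "arr R X Y f \<Longrightarrow> FArr (unit_arrow R) X Y f = f"
  "rel R X Y \<alpha> \<Longrightarrow> FRel (unit_arrow R) X Y \<alpha> = \<alpha>"
  by (simp_all add: unit_arrow_def mk_arr_def mk_rel_def arr_def rel_def)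

lemma (in relational_doctrine) one_arrow_unit: "one_arrow R (qcompl R) (unit_arrow R)"
proof (rule one_arrowI[OF relational_doctrine_axioms qcompl_relational_doctrine])
  show "FObj (unit_arrow R) \<in> extensional (Obj R)" by (simp add: unit_arrow_def)
next
  fix X Y f assume "\<not> arr R X Y f"
  then show "FArr (unit_arrow R) X Y f = undefined" by (auto simp: unit_arrow_def mk_arr_def arr_def)
next
  fix X Y \<alpha> assume "\<not> rel R X Y \<alpha>"
  then show "FRel (unit_arrow R) X Y \<alpha> = undefined" by (auto simp: unit_arrow_def mk_rel_def rel_def)
next
  fix X Y \<alpha> \<beta> assume a: "rle R X Y \<alpha> \<beta>"
  then show "rle (qcompl R) (FObj (unit_arrow R) X) (FObj (unit_arrow R) Y)
     (FRel (unit_arrow R) X Y \<alpha>) (FRel (unit_arrow R) X Y \<beta>)"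
    using rleD[OF a] by (simp add: unit_arrow_simps relD qcompl_rle qcompl_rel diag_equiv diag_left diag_right)
qed (simp_all add: unit_arrow_simps qcompl_simps qcompl_arr qcompl_rle qcompl_rel diag_equiv diag_left diag_right
    arr_obj relD rel_reidx rel_rcomp rel_conv rel_diag rle_refl arr_ident arr_comp square_diag)


subsection \<open>The completion as a two-functor\<close>

lemma Q_one_simps:
  "(X, \<rho>) \<in> Obj (qcompl R) \<Longrightarrow> FObj (Q_one R F) (X, \<rho>) = (FObj F X, FRel F X X \<rho>)"
  "arr (qcompl R) (X, \<rho>) (Y, \<sigma>) f \<Longrightarrow> FArr (Q_one R F) (X, \<rho>) (Y, \<sigma>) f = FArr F X Y f"
  "rel (qcompl R) (X, \<rho>) (Y, \<sigma>) \<alpha> \<Longrightarrow> FRel (Q_one R F) (X, \<rho>) (Y, \<sigma>) \<alpha> = FRel F X Y \<alpha>"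
  by (simp_all add: Q_one_def mk_arr_def mk_rel_def arr_def rel_def)

context one_arrow
begin

text \<open>
  Lax 1-arrows preserve saturated relations: \<open>F(\<rho>) ; F(\<alpha>) \<le> F(\<rho> ; \<alpha>) = F(\<alpha>)\<close>, and \<open>F(\<rho>)\<close> is
  reflexive.
\<close>

lemma rel_absorb_left:
  assumes "X \<in> Obj R" "\<rho> \<in> equiv_rels R X" "rel R X Y \<alpha>" "RComp R X X Y \<rho> \<alpha> = \<alpha>"
  shows "RComp S (FObj F X) (FObj F X) (FObj F Y) (FRel F X X \<rho>) (FRel F X Y \<alpha>) = FRel F X Y \<alpha>"
  by (rule cod.absorb_left[OF obj[OF assms(1)] equiv[OF assms(1,2)]])
    (use rcomp_le[OF dom.equiv_relsD(1)[OF assms(1,2)] assms(3)] assms(4) in simp)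

lemma rel_absorb_right:
  assumes "Y \<in> Obj R" "\<sigma> \<in> equiv_rels R Y" "rel R X Y \<alpha>" "RComp R X Y Y \<alpha> \<sigma> = \<alpha>"
  shows "RComp S (FObj F X) (FObj F Y) (FObj F Y) (FRel F X Y \<alpha>) (FRel F Y Y \<sigma>) = FRel F X Y \<alpha>"
  by (rule cod.absorb_right[OF obj[OF assms(1)] equiv[OF assms(1,2)]])
    (use rcomp_le[OF assms(3) dom.equiv_relsD(1)[OF assms(1,2)]] assms(4) in simp)

lemma Q_arr: "arr (qcompl R) (X, \<rho>) (Y, \<sigma>) f \<Longrightarrow>
    arr (qcompl S) (FObj F X, FRel F X X \<rho>) (FObj F Y, FRel F Y Y \<sigma>) (FArr F X Y f)"
  using square[of X Y X Y f f \<rho> \<sigma>]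
  by (auto simp: dom.qcompl_arr cod.qcompl_arr intro: equiv dest: dom.squareD(3,4) dom.relD(1))

lemma Q_rel: "rel (qcompl R) (X, \<rho>) (Y, \<sigma>) \<alpha> \<Longrightarrow>
    rel (qcompl S) (FObj F X, FRel F X X \<rho>) (FObj F Y, FRel F Y Y \<sigma>) (FRel F X Y \<alpha>)"
  using dom.relD(1,2)[of X Y \<alpha>]
  by (auto simp: dom.qcompl_rel cod.qcompl_rel rel equiv rel_absorb_left rel_absorb_right)

lemma Q_obj: "(X, \<rho>) \<in> Obj (qcompl R) \<Longrightarrow> (FObj F X, FRel F X X \<rho>) \<in> Obj (qcompl S)"
  by (simp add: qcompl_simps obj equiv)

lemma one_arrow_Q: "one_arrow (qcompl R) (qcompl S) (Q_one R F)"
proof -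
  let ?R = "qcompl R"
  let ?S = "qcompl S"
  let ?F = "Q_one R F"
  interpret QR: relational_doctrine "?R" by (rule dom.qcompl_relational_doctrine)
  interpret QS: relational_doctrine "?S" by (rule cod.qcompl_relational_doctrine)
  show ?thesis
  proof (rule one_arrowI[OF dom.qcompl_relational_doctrine cod.qcompl_relational_doctrine]; (unfold split_paired_all)?)
    show "FObj ?F \<in> extensional (Obj ?R)" by (simp add: Q_one_def)
  next
    fix X \<rho> Y \<sigma> f assume "\<not> arr ?R (X, \<rho>) (Y, \<sigma>) f"
    then show "FArr ?F (X, \<rho>) (Y, \<sigma>) f = undefined" by (auto simp: Q_one_def mk_arr_def arr_def)
  next
    fix X \<rho> Y \<sigma> \<alpha> assume "\<not> rel ?R (X, \<rho>) (Y, \<sigma>) \<alpha>"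
    then show "FRel ?F (X, \<rho>) (Y, \<sigma>) \<alpha> = undefined" by (auto simp: Q_one_def mk_rel_def rel_def)
  next
    fix X \<rho> assume a: "(X, \<rho>) \<in> Obj ?R"
    then show "FObj ?F (X, \<rho>) \<in> Obj ?S" by (simp add: Q_one_simps Q_obj)
    show "FArr ?F (X, \<rho>) (X, \<rho>) (Ident ?R (X, \<rho>)) = Ident ?S (FObj ?F (X, \<rho>))"
      using a QR.arr_ident[OF a] by (simp add: Q_one_simps) (simp add: qcompl_simps ident)
    show "rle ?S (FObj ?F (X, \<rho>)) (FObj ?F (X, \<rho>))
        (Diag ?S (FObj ?F (X, \<rho>))) (FRel ?F (X, \<rho>) (X, \<rho>) (Diag ?R (X, \<rho>)))"
      using a QR.rel_diag[OF a] QS.rle_refl[OF Q_rel[OF QR.rel_diag[OF a]]]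
      by (simp add: Q_one_simps) (simp add: qcompl_simps)
  next
    fix X \<rho> Y \<sigma> f assume "arr ?R (X, \<rho>) (Y, \<sigma>) f"
    then show "arr ?S (FObj ?F (X, \<rho>)) (FObj ?F (Y, \<sigma>)) (FArr ?F (X, \<rho>) (Y, \<sigma>) f)"
      by (simp add: Q_one_simps QR.arr_obj Q_arr)
  next
    fix X \<rho> Y \<sigma> Z \<tau> f g assume a: "arr ?R (X, \<rho>) (Y, \<sigma>) f" "arr ?R (Y, \<sigma>) (Z, \<tau>) g"
    then have b: "arr R X Y f" "arr R Y Z g" by (auto simp: dom.qcompl_arr dest: dom.squareD(1))
    show "FArr ?F (X, \<rho>) (Z, \<tau>) (Comp ?R (X, \<rho>) (Y, \<sigma>) (Z, \<tau>) g f) =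
        Comp ?S (FObj ?F (X, \<rho>)) (FObj ?F (Y, \<sigma>)) (FObj ?F (Z, \<tau>))
         (FArr ?F (Y, \<sigma>) (Z, \<tau>) g) (FArr ?F (X, \<rho>) (Y, \<sigma>) f)"
      using a QR.arr_comp[OF a] by (simp add: Q_one_simps QR.arr_obj) (simp add: qcompl_simps comp b)
  next
    fix X \<rho> Y \<sigma> \<alpha> \<beta> assume a: "rle ?R (X, \<rho>) (Y, \<sigma>) \<alpha> \<beta>"
    then show "rle ?S (FObj ?F (X, \<rho>)) (FObj ?F (Y, \<sigma>))
        (FRel ?F (X, \<rho>) (Y, \<sigma>) \<alpha>) (FRel ?F (X, \<rho>) (Y, \<sigma>) \<beta>)"
      using QR.rleD[OF a]
      by (simp add: Q_one_simps QR.relD) (simp add: Q_rel rle cod.qcompl_rle dom.qcompl_rle)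
  next
    fix X \<rho> A \<sigma> Y \<tau> B \<upsilon> f g \<alpha>
    assume a: "arr ?R (X, \<rho>) (A, \<sigma>) f" "arr ?R (Y, \<tau>) (B, \<upsilon>) g" "rel ?R (A, \<sigma>) (B, \<upsilon>) \<alpha>"
    then have b: "arr R X A f" "arr R Y B g" "rel R A B \<alpha>"
      by (auto simp: dom.qcompl_arr dom.qcompl_rel dest: dom.squareD(1))
    show "FRel ?F (X, \<rho>) (Y, \<tau>) (Reidx ?R (X, \<rho>) (A, \<sigma>) (Y, \<tau>) (B, \<upsilon>) f g \<alpha>) =
      Reidx ?S (FObj ?F (X, \<rho>)) (FObj ?F (A, \<sigma>)) (FObj ?F (Y, \<tau>))
        (FObj ?F (B, \<upsilon>)) (FArr ?F (X, \<rho>) (A, \<sigma>) f) (FArr ?F (Y, \<tau>) (B, \<upsilon>) g)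
        (FRel ?F (A, \<sigma>) (B, \<upsilon>) \<alpha>)"
      using a QR.rel_reidx[OF a] by (simp add: Q_one_simps QR.arr_obj) (simp add: qcompl_simps reidx b)
  next
    fix X \<rho> Y \<sigma> Z \<tau> \<alpha> \<beta> assume a: "rel ?R (X, \<rho>) (Y, \<sigma>) \<alpha>" "rel ?R (Y, \<sigma>) (Z, \<tau>) \<beta>"
    then have b: "rel R X Y \<alpha>" "rel R Y Z \<beta>" by (simp_all add: dom.qcompl_rel)
    note c = QS.rel_rcomp[OF Q_rel[OF a(1)] Q_rel[OF a(2)]] Q_rel[OF QR.rel_rcomp[OF a]]
    show "rle ?S (FObj ?F (X, \<rho>)) (FObj ?F (Z, \<tau>))
        (RComp ?S (FObj ?F (X, \<rho>)) (FObj ?F (Y, \<sigma>)) (FObj ?F (Z, \<tau>))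
          (FRel ?F (X, \<rho>) (Y, \<sigma>) \<alpha>) (FRel ?F (Y, \<sigma>) (Z, \<tau>) \<beta>))
        (FRel ?F (X, \<rho>) (Z, \<tau>) (RComp ?R (X, \<rho>) (Y, \<sigma>) (Z, \<tau>) \<alpha> \<beta>))"
      using a QR.rel_rcomp[OF a] rcomp_le[OF b] c
      by (simp add: Q_one_simps QR.relD[OF a(1)] QR.relD[OF a(2)]) (simp add: qcompl_simps cod.qcompl_rle)
  next
    fix X \<rho> Y \<sigma> \<alpha> assume a: "rel ?R (X, \<rho>) (Y, \<sigma>) \<alpha>"
    then have b: "rel R X Y \<alpha>" by (simp_all add: dom.qcompl_rel)
    note c = QS.rel_conv[OF Q_rel[OF a]] Q_rel[OF QR.rel_conv[OF a]]
    show "rle ?S (FObj ?F (Y, \<sigma>)) (FObj ?F (X, \<rho>))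
        (Conv ?S (FObj ?F (X, \<rho>)) (FObj ?F (Y, \<sigma>)) (FRel ?F (X, \<rho>) (Y, \<sigma>) \<alpha>))
        (FRel ?F (Y, \<sigma>) (X, \<rho>) (Conv ?R (X, \<rho>) (Y, \<sigma>) \<alpha>))"
      using a QR.rel_conv[OF a] conv_le[OF b] c
      by (simp add: Q_one_simps QR.relD[OF a]) (simp add: qcompl_simps cod.qcompl_rle)
  qed
qed

lemma quotient_one_arrow_Q: "quotient_one_arrow (qcompl R) (qcompl S) (Q_one R F)"
proof (rule quotient_one_arrowI[OF dom.qcompl_with_quotients cod.qcompl_with_quotients one_arrow_Q])
  interpret QR: relational_doctrine "qcompl R" by (rule dom.qcompl_relational_doctrine)
  interpret Q: one_arrow "qcompl R" "qcompl S" "Q_one R F" by (rule one_arrow_Q)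
  fix X' \<sigma> assume a: "X' \<in> Obj (qcompl R)" "\<sigma> \<in> equiv_rels (qcompl R) X'"
  obtain X \<rho> where X': "X' = (X, \<rho>)" by (cases X')
  have X: "X \<in> Obj R" "\<rho> \<in> equiv_rels R X" using a by (simp_all add: X' qcompl_simps)
  note QX = a(1)[unfolded X'] and Q\<sigma> = a(2)[unfolded X']
  note q = dom.qcompl_quotient_arrow[OF X Q\<sigma>]
  note r = QR.equiv_relsD(1)[OF QX Q\<sigma>]
  note qa = QR.quotient_arrow_arr[OF q r]
  have s: "\<sigma> \<in> equiv_rels R X" using Q\<sigma> X by (simp add: dom.qcompl_equiv_rels)
  have Fs: "FRel F X X \<sigma> \<in> equiv_rels (qcompl S) (FObj F X, FRel F X X \<rho>)"
    using Q.equiv[OF QX Q\<sigma>] by (simp add: Q_one_simps QX r)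
  have "quotient_arrow (qcompl S) (FObj F X, FRel F X X \<rho>) (FRel F X X \<sigma>)
      (FObj F X, FRel F X X \<sigma>) (Ident S (FObj F X))"
    by (rule cod.qcompl_quotient_arrow[OF obj[OF X(1)] equiv[OF X] Fs])
  then have "quotient_arrow (qcompl S) (FObj (Q_one R F) (X, \<rho>)) (FRel (Q_one R F) (X, \<rho>) (X, \<rho>) \<sigma>)
      (FObj (Q_one R F) (X, \<sigma>)) (FArr (Q_one R F) (X, \<rho>) (X, \<sigma>) (Ident R X))"
    using QX r qa QR.arr_obj[OF qa] by (simp add: Q_one_simps ident X)
  then show "\<exists>W q. quotient_arrow (qcompl R) X' \<sigma> W q \<and> quotient_arrow (qcompl S) (FObj (Q_one R F) X')
       (FRel (Q_one R F) X' X' \<sigma>) (FObj (Q_one R F) W) (FArr (Q_one R F) X' W q)"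
    using q unfolding X' by blast
qed

end

lemma Q_two_simps: "(X, \<rho>) \<in> Obj (qcompl R) \<Longrightarrow> Q_two R \<theta> (X, \<rho>) = \<theta> X"
  by (simp add: Q_two_def)

lemma Q_two_arrow:
  assumes F: "one_arrow R S F" and G: "one_arrow R S G" and \<theta>: "\<theta> \<in> two_arrows R S F G"
  shows "Q_two R \<theta> \<in> two_arrows (qcompl R) (qcompl S) (Q_one R F) (Q_one R G)"
proof -
  let ?S = "qcompl S"
  let ?R = "qcompl R"
  let ?G = "Q_one R G"
  let ?F = "Q_one R F"
  interpret F: one_arrow R S F by fact
  interpret G: one_arrow R S G by fact
  interpret QR: relational_doctrine "?R" by (rule F.dom.qcompl_relational_doctrine)
  note t = two_arrowsD[OF \<theta> F G]
  have a: "arr ?S (FObj F X, FRel F X X \<rho>) (FObj G X, FRel G X X \<rho>) (\<theta> X)"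
    if "(X, \<rho>) \<in> Obj ?R" for X \<rho>
    using that t(4)[of X X \<rho>] by (simp add: F.cod.qcompl_arr qcompl_simps F.equiv G.equiv F.dom.equiv_relsD)
  show ?thesis
  proof (rule two_arrowsI[OF F.one_arrow_Q G.one_arrow_Q]; (unfold split_paired_all)?)
    show "Q_two R \<theta> \<in> extensional (Obj ?R)" by (simp add: Q_two_def)
  next
    fix X \<rho> assume "(X, \<rho>) \<in> Obj ?R"
    then show "arr ?S (FObj ?F (X, \<rho>)) (FObj ?G (X, \<rho>)) (Q_two R \<theta> (X, \<rho>))"
      by (simp add: Q_two_simps Q_one_simps a)
  next
    fix X \<rho> Y \<sigma> f assume f: "arr ?R (X, \<rho>) (Y, \<sigma>) f"
    then have "arr R X Y f" by (auto simp: F.dom.qcompl_arr dest: F.dom.squareD(1))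
    from t(3)[OF this] show "Comp ?S (FObj ?F (X, \<rho>)) (FObj ?F (Y, \<sigma>))
        (FObj ?G (Y, \<sigma>)) (Q_two R \<theta> (Y, \<sigma>)) (FArr ?F (X, \<rho>) (Y, \<sigma>) f) =
      Comp ?S (FObj ?F (X, \<rho>)) (FObj ?G (X, \<rho>))
        (FObj ?G (Y, \<sigma>)) (FArr ?G (X, \<rho>) (Y, \<sigma>) f) (Q_two R \<theta> (X, \<rho>))"
      using f QR.arr_obj[OF f] by (simp add: Q_two_simps Q_one_simps) (simp add: qcompl_simps)
  next
    fix X \<rho> Y \<sigma> \<alpha> assume r: "rel ?R (X, \<rho>) (Y, \<sigma>) \<alpha>"
    then have "rel R X Y \<alpha>" by (simp add: F.dom.qcompl_rel)
    from t(4)[OF this] show "square ?S (FObj ?F (X, \<rho>)) (FObj ?G (X, \<rho>))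
        (FObj ?F (Y, \<sigma>)) (FObj ?G (Y, \<sigma>)) (Q_two R \<theta> (X, \<rho>)) (Q_two R \<theta> (Y, \<sigma>))
        (FRel ?F (X, \<rho>) (Y, \<sigma>) \<alpha>) (FRel ?G (X, \<rho>) (Y, \<sigma>) \<alpha>)"
      using r QR.relD[OF r] a F.Q_rel[OF r] G.Q_rel[OF r]
      by (simp add: Q_two_simps Q_one_simps F.cod.qcompl_square)
  qed
qed

lemma one_arr_record_eqI:
  fixes F G :: "('o, 'a, 'p, 'b, 'r, 's) one_arr"
  assumes "FObj F = FObj G" "FArr F = FArr G" "FRel F = FRel G" shows "F = G"
  using assms by (cases F; cases G) simp

lemma one_arrow_eqI:
  assumes F: "one_arrow R S F" and G: "one_arrow R S G"
    and "\<And>X. X \<in> Obj R \<Longrightarrow> FObj F X = FObj G X"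
    and "\<And>X Y f. arr R X Y f \<Longrightarrow> FArr F X Y f = FArr G X Y f"
    and "\<And>X Y \<alpha>. rel R X Y \<alpha> \<Longrightarrow> FRel F X Y \<alpha> = FRel G X Y \<alpha>"
  shows "F = G"
proof -
  interpret F: one_arrow R S F by fact
  interpret G: one_arrow R S G by fact
  have "FObj F = FObj G"
    using F.obj_in G.obj_in assms(3) by (auto intro!: extensionalityI[of _ "Obj R"] simp: PiE_def)
  moreover have "FArr F X Y f = FArr G X Y f" for X Y f
    using assms(4)[of X Y f] F.arr_undefined[of X Y f] G.arr_undefined[of X Y f]
    by (cases "arr R X Y f") (auto simp: arr_def)
  moreover have "FRel F X Y \<alpha> = FRel G X Y \<alpha>" for X Y \<alpha>
    using assms(5)[of X Y \<alpha>] F.rel_undefined[of X Y \<alpha>] G.rel_undefined[of X Y \<alpha>]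
    by (cases "rel R X Y \<alpha>") (auto simp: rel_def)
  ultimately show ?thesis by (intro one_arr_record_eqI) (simp_all add: fun_eq_iff)
qed

lemma Q_one_id:
  assumes "relational_doctrine R" shows "Q_one R (id_one_arrow R) = id_one_arrow (qcompl R)"
proof -
  interpret relational_doctrine R by fact
  interpret I: one_arrow R R "id_one_arrow R" by (rule one_arrow_id[OF assms])
  interpret Q: relational_doctrine "qcompl R" by (rule qcompl_relational_doctrine)
  show ?thesis
  proof (rule one_arrow_eqI[OF I.one_arrow_Q one_arrow_id[OF qcompl_relational_doctrine]]; unfold split_paired_all)
    fix X \<rho> assume "(X, \<rho>) \<in> Obj (qcompl R)"
    then show "FObj (Q_one R (id_one_arrow R)) (X, \<rho>) = FObj (id_one_arrow (qcompl R)) (X, \<rho>)"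
      by (simp add: Q_one_simps id_one_arrow_simps) (simp add: qcompl_simps id_one_arrow_simps equiv_relsD)
  next
    fix X \<rho> Y \<sigma> f assume f: "arr (qcompl R) (X, \<rho>) (Y, \<sigma>) f"
    then have "arr R X Y f" by (auto simp: qcompl_arr dest: squareD(1))
    with f show "FArr (Q_one R (id_one_arrow R)) (X, \<rho>) (Y, \<sigma>) f = FArr (id_one_arrow (qcompl R)) (X, \<rho>) (Y, \<sigma>) f"
      by (simp add: Q_one_simps id_one_arrow_simps)
  next
    fix X \<rho> Y \<sigma> \<alpha> assume a: "rel (qcompl R) (X, \<rho>) (Y, \<sigma>) \<alpha>"
    then have "rel R X Y \<alpha>" by (simp add: qcompl_rel)
    with a show "FRel (Q_one R (id_one_arrow R)) (X, \<rho>) (Y, \<sigma>) \<alpha> = FRel (id_one_arrow (qcompl R)) (X, \<rho>) (Y, \<sigma>) \<alpha>"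
      by (simp add: Q_one_simps id_one_arrow_simps)
  qed
qed

lemma Q_one_comp:
  assumes F: "one_arrow R S F" and G: "one_arrow S T G"
  shows "Q_one R (comp_one_arrow R G F) = comp_one_arrow (qcompl R) (Q_one S G) (Q_one R F)"
proof -
  interpret F: one_arrow R S F by fact
  interpret G: one_arrow S T G by fact
  interpret GF: one_arrow R T "comp_one_arrow R G F" by (rule one_arrow_comp[OF F G])
  interpret Q: relational_doctrine "qcompl R" by (rule F.dom.qcompl_relational_doctrine)
  note s = Q_one_simps comp_one_arrow_simps F.Q_obj F.Q_arr F.Q_rel
  show ?thesis
  proof (rule one_arrow_eqI[OF GF.one_arrow_Q one_arrow_comp[OF F.one_arrow_Q G.one_arrow_Q]]; unfold split_paired_all)
    fix X \<rho> assume a: "(X, \<rho>) \<in> Obj (qcompl R)"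
    then have "X \<in> Obj R" "rel R X X \<rho>" by (simp_all add: qcompl_simps F.dom.equiv_relsD)
    with a show "FObj (Q_one R (comp_one_arrow R G F)) (X, \<rho>) =
        FObj (comp_one_arrow (qcompl R) (Q_one S G) (Q_one R F)) (X, \<rho>)"
      by (simp add: s)
  next
    fix X \<rho> Y \<sigma> f assume f: "arr (qcompl R) (X, \<rho>) (Y, \<sigma>) f"
    then have "arr R X Y f" by (auto simp: F.dom.qcompl_arr dest: F.dom.squareD(1))
    with f Q.arr_obj[OF f] show "FArr (Q_one R (comp_one_arrow R G F)) (X, \<rho>) (Y, \<sigma>) f =
        FArr (comp_one_arrow (qcompl R) (Q_one S G) (Q_one R F)) (X, \<rho>) (Y, \<sigma>) f"
      by (simp add: s)
  next
    fix X \<rho> Y \<sigma> \<alpha> assume a: "rel (qcompl R) (X, \<rho>) (Y, \<sigma>) \<alpha>"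
    then have "rel R X Y \<alpha>" by (simp add: F.dom.qcompl_rel)
    with a Q.relD[OF a] show "FRel (Q_one R (comp_one_arrow R G F)) (X, \<rho>) (Y, \<sigma>) \<alpha> =
        FRel (comp_one_arrow (qcompl R) (Q_one S G) (Q_one R F)) (X, \<rho>) (Y, \<sigma>) \<alpha>"
      by (simp add: s)
  qed
qed

lemma Q_two_hcomp:
  assumes F: "one_arrow R S F" and F': "one_arrow R S F'" and G: "one_arrow S T G" and G': "one_arrow S T G'"
    and \<theta>: "\<theta> \<in> two_arrows R S F F'" and \<phi>: "\<phi> \<in> two_arrows S T G G'"
  shows "Q_two R (hcomp R T G G' F F' \<phi> \<theta>) =
    hcomp (qcompl R) (qcompl T) (Q_one S G) (Q_one S G') (Q_one R F) (Q_one R F') (Q_two S \<phi>) (Q_two R \<theta>)"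
proof (rule extensionalityI[of _ "Obj (qcompl R)"])
  show "Q_two R (hcomp R T G G' F F' \<phi> \<theta>) \<in> extensional (Obj (qcompl R))" by (simp add: Q_two_def)
  show "hcomp (qcompl R) (qcompl T) (Q_one S G) (Q_one S G') (Q_one R F) (Q_one R F') (Q_two S \<phi>) (Q_two R \<theta>)
      \<in> extensional (Obj (qcompl R))" by (simp add: hcomp_def)
  interpret F: one_arrow R S F by fact
  interpret F': one_arrow R S F' by fact
  fix P assume P: "P \<in> Obj (qcompl R)"
  obtain X \<rho> where X: "P = (X, \<rho>)" by (cases P)
  note QX = P[unfolded X]
  then have "X \<in> Obj R" by (simp add: qcompl_simps)
  moreover have "arr (qcompl S) (FObj F X, FRel F X X \<rho>) (FObj F' X, FRel F' X X \<rho>) (\<theta> X)"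
    using two_arrow_arr[OF Q_two_arrow[OF F F' \<theta>] F.one_arrow_Q F'.one_arrow_Q QX] QX
    by (simp add: Q_one_simps Q_two_simps)
  ultimately show "Q_two R (hcomp R T G G' F F' \<phi> \<theta>) P = hcomp (qcompl R) (qcompl T) (Q_one S G) (Q_one S G')
      (Q_one R F) (Q_one R F') (Q_two S \<phi>) (Q_two R \<theta>) P"
    unfolding X hcomp_def using QX
    by (simp add: Q_one_simps Q_two_simps F.Q_obj F'.Q_obj) (simp add: qcompl_simps)
qed

lemma Q_hom_functor:
  assumes R: "relational_doctrine R" and S: "relational_doctrine S"
  shows "cat_functor (RD_hom R S) (QRD_hom (qcompl R) (qcompl S)) (Q_hom R S)"
proof -
  let ?Q = "Q_hom R S"
  let ?RD = "RD_hom R S"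
  let ?QRD = "QRD_hom (qcompl R) (qcompl S)"
  interpret R: relational_doctrine R by fact
  interpret H: category "?RD" by (rule RD_hom_category)
  interpret Q: category "?QRD" by (rule QRD_hom_category)
  have so: "F \<in> Obj ?RD \<Longrightarrow> FObj ?Q F = Q_one R F" for F by (simp add: Q_hom_def)
  have sa: "\<lbrakk>F \<in> Obj ?RD; G \<in> Obj ?RD; \<theta> \<in> Hom ?RD F G\<rbrakk>
    \<Longrightarrow> FArr ?Q F G \<theta> = Q_two R \<theta>" for F G \<theta> by (simp add: Q_hom_def mk_arr_def)
  show ?thesis
  proof
    show "FObj ?Q \<in> Obj ?RD \<rightarrow>\<^sub>E Obj ?QRD"
      by (auto simp: Q_hom_def RD_hom_simps QRD_hom_simps intro: one_arrow.quotient_one_arrow_Q)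
  next
    fix F G \<theta> assume "F \<in> Obj ?RD" "G \<in> Obj ?RD" "\<theta> \<in> Hom ?RD F G"
    then show "FArr ?Q F G \<theta> \<in> Hom ?QRD (FObj ?Q F) (FObj ?Q G)"
      by (simp add: so sa) (simp add: RD_hom_simps QRD_hom_simps Q_two_arrow)
  next
    fix F G \<theta> assume "\<not> (F \<in> Obj ?RD \<and> G \<in> Obj ?RD \<and> \<theta> \<in> Hom ?RD F G)"
    then show "FArr ?Q F G \<theta> = undefined" by (auto simp: Q_hom_def mk_arr_def)
  next
    fix F assume F: "F \<in> Obj ?RD"
    show "FArr ?Q F F (Ident ?RD F) = Ident ?QRD (FObj ?Q F)"
      using F H.ident_in[OF F]
      by (auto simp: so sa Q_two_def RD_hom_simps QRD_hom_simps Q_one_simps qcompl_simps intro!: restrict_ext)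
  next
    fix F G H \<theta> \<phi> assume a: "F \<in> Obj ?RD" "G \<in> Obj ?RD" "H \<in> Obj ?RD"
      "\<theta> \<in> Hom ?RD F G" "\<phi> \<in> Hom ?RD G H"
    show "FArr ?Q F H (Comp ?RD F G H \<phi> \<theta>) = Comp ?QRD
       (FObj ?Q F) (FObj ?Q G) (FObj ?Q H) (FArr ?Q G H \<phi>) (FArr ?Q F G \<theta>)"
      using a H.comp_in[OF a]
      by (auto simp: so sa Q_two_def RD_hom_simps QRD_hom_simps Q_one_simps qcompl_simps intro!: restrict_ext)
  qed
qed


section \<open>The universal property of the completion\<close>

text \<open>
  Every object of the completion is a quotient of an object in the image of the unit.
\<close>

lemma (in relational_doctrine) qcompl_unit_quotient:
  assumes "X \<in> Obj R" "\<rho> \<in> equiv_rels R X"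
  shows "\<rho> \<in> equiv_rels (qcompl R) (X, Diag R X)"
    and "quotient_arrow (qcompl R) (X, Diag R X) \<rho> (X, \<rho>) (Ident R X)"
    and "arr (qcompl R) (X, Diag R X) (X, \<rho>) (Ident R X)"
proof -
  interpret Q: relational_doctrine "qcompl R" by (rule qcompl_relational_doctrine)
  have X: "(X, Diag R X) \<in> Obj (qcompl R)" using assms by (simp add: qcompl_simps diag_equiv)
  show e: "\<rho> \<in> equiv_rels (qcompl R) (X, Diag R X)"
    using assms by (simp add: qcompl_equiv_rels diag_equiv diag_le_equiv)
  show q: "quotient_arrow (qcompl R) (X, Diag R X) \<rho> (X, \<rho>) (Ident R X)"
    by (rule qcompl_quotient_arrow[OF assms(1) diag_equiv[OF assms(1)] e])
  show "arr (qcompl R) (X, Diag R X) (X, \<rho>) (Ident R X)"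
    by (rule Q.quotient_arrow_arr[OF q Q.equiv_relsD(1)[OF X e]])
qed

text \<open>
  Fibres of the completion embed into the fibres over the image of the unit, and they are related to them
  by reindexing along the quotient arrows above.
\<close>

lemma (in relational_doctrine) qcompl_rel_unit:
  assumes "rel (qcompl R) (X, \<rho>) (Y, \<sigma>) \<alpha>"
  shows "rel (qcompl R) (X, Diag R X) (Y, Diag R Y) \<alpha>"
    and "square (qcompl R) (X, Diag R X) (X, \<rho>) (Y, Diag R Y) (Y, \<sigma>) (Ident R X) (Ident R Y) \<alpha> \<alpha>"
proof -
  have a: "rel R X Y \<alpha>" "\<rho> \<in> equiv_rels R X" "\<sigma> \<in> equiv_rels R Y" using assms by (simp_all add: qcompl_rel)
  note o = relD(1,2)[OF a(1)]
  show r: "rel (qcompl R) (X, Diag R X) (Y, Diag R Y) \<alpha>"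
    using a o by (simp add: qcompl_rel diag_equiv diag_left diag_right)
  show "square (qcompl R) (X, Diag R X) (X, \<rho>) (Y, Diag R Y) (Y, \<sigma>) (Ident R X) (Ident R Y) \<alpha> \<alpha>"
    using r assms a o by (simp add: qcompl_square qcompl_unit_quotient square_id_iff rle_refl)
qed

lemma (in relational_doctrine) qcompl_arr_unit:
  assumes "arr (qcompl R) (X, \<rho>) (Y, \<sigma>) f"
  shows "arr (qcompl R) (X, Diag R X) (Y, Diag R Y) f"
proof -
  have "arr R X Y f" using assms by (auto simp: qcompl_arr dest: squareD(1))
  then show ?thesis by (simp add: qcompl_arr square_diag diag_equiv arr_obj)
qed

text \<open>
  A 1-arrow \<open>F : R \<rightarrow> S\<close>, a quotient preserving \<open>G : R\<^sup>q \<rightarrow> S\<close> and a 2-arrow \<open>\<phi> : F \<Rightarrow> GE\<close>.  Both the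
  candidate universal arrow and the arrows to be factored through it have this form, so that
  the facts about the comparison arrows serve for either.
\<close>

locale arrow_into_restriction = F: one_arrow R S F + G: quotient_one_arrow "qcompl R" S G
  for R :: "('o, 'a, 'r) doctrine" and S :: "('p, 'b, 's) doctrine"
    and F :: "('o, 'a, 'p, 'b, 'r, 's) one_arr" and G :: "('o \<times> 'r, 'a, 'p, 'b, 'r, 's) one_arr" +
  fixes \<phi> :: "'o \<Rightarrow> 'b"
  assumes \<phi>: "\<phi> \<in> two_arrows R S F (comp_one_arrow R G (unit_arrow R))"
begin

text \<open>
  The composite \<open>FX \<rightarrow> G(X, d) \<rightarrow> G(X, \<rho>)\<close>; it extends \<open>\<phi>\<close> from the image of the unit to all
  objects of the completion.
\<close>

definition comparison :: "'o \<Rightarrow> 'r \<Rightarrow> 'b" where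
  "comparison X \<rho> = Comp S (FObj F X) (FObj G (X, Diag R X)) (FObj G (X, \<rho>))
     (FArr G (X, Diag R X) (X, \<rho>) (Ident R X)) (\<phi> X)"

lemma one_arrow_restriction: "one_arrow R S (comp_one_arrow R G (unit_arrow R))"
  by (rule one_arrow_comp[OF F.dom.one_arrow_unit G.one_arrow_axioms])

lemma component_arr: "X \<in> Obj R \<Longrightarrow> arr S (FObj F X) (FObj G (X, Diag R X)) (\<phi> X)"
  using two_arrow_arr[OF \<phi> F.one_arrow_axioms one_arrow_restriction]
  by (simp add: comp_one_arrow_simps unit_arrow_simps)

lemma component_natural:
  assumes "arr R X Y f"
  shows "Comp S (FObj F X) (FObj F Y) (FObj G (Y, Diag R Y)) (\<phi> Y) (FArr F X Y f) =
    Comp S (FObj F X) (FObj G (X, Diag R X)) (FObj G (Y, Diag R Y))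
      (FArr G (X, Diag R X) (Y, Diag R Y) f) (\<phi> X)"
  using two_arrow_natural[OF \<phi> F.one_arrow_axioms one_arrow_restriction assms] assms
  by (simp add: comp_one_arrow_simps unit_arrow_simps F.dom.arr_obj)

lemma component_square:
  assumes "rel R X Y \<alpha>"
  shows "square S (FObj F X) (FObj G (X, Diag R X)) (FObj F Y) (FObj G (Y, Diag R Y)) (\<phi> X) (\<phi> Y)
    (FRel F X Y \<alpha>) (FRel G (X, Diag R X) (Y, Diag R Y) \<alpha>)"
  using two_arrow_square[OF \<phi> F.one_arrow_axioms one_arrow_restriction assms] assms
  by (simp add: comp_one_arrow_simps unit_arrow_simps F.dom.relD)

lemma comparison_arr:
  assumes "X \<in> Obj R" "\<rho> \<in> equiv_rels R X"
  shows "arr S (FObj F X) (FObj G (X, \<rho>)) (comparison X \<rho>)"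
  unfolding comparison_def
  by (rule F.cod.arr_comp[OF component_arr[OF assms(1)] G.arr[OF F.dom.qcompl_unit_quotient(3)[OF assms]]])

lemma comparison_diag: "X \<in> Obj R \<Longrightarrow> comparison X (Diag R X) = \<phi> X"
  using G.ident[of "(X, Diag R X)"] F.cod.ident_left[OF component_arr[of X]]
  by (simp add: comparison_def qcompl_simps F.dom.diag_equiv)

lemma comparison_square:
  assumes "rel (qcompl R) (X, \<rho>) (Y, \<sigma>) \<alpha>"
  shows "square S (FObj F X) (FObj G (X, \<rho>)) (FObj F Y) (FObj G (Y, \<sigma>)) (comparison X \<rho>) (comparison Y \<sigma>)
    (FRel F X Y \<alpha>) (FRel G (X, \<rho>) (Y, \<sigma>) \<alpha>)"
  unfolding comparison_def
proof (rule F.cod.square_vertical[OF component_square])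
  show "rel R X Y \<alpha>" using assms by (simp add: F.dom.qcompl_rel)
qed (rule G.square[OF F.dom.qcompl_rel_unit(2)[OF assms]])

text \<open>
  This is where \<open>G\<close> has to preserve quotients: the second factor of the comparison arrow is the
  image under \<open>G\<close> of a quotient arrow of \<open>\<rho>\<close>.
\<close>

lemma comparison_kernel:
  assumes "X \<in> Obj R" "\<rho> \<in> equiv_rels R X"
  shows "square S (FObj F X) (FObj G (X, \<rho>)) (FObj F X) (FObj G (X, \<rho>)) (comparison X \<rho>) (comparison X \<rho>)
    (FRel F X X \<rho>) (Diag S (FObj G (X, \<rho>)))"
  unfolding comparison_def
proof (rule F.cod.square_vertical[OF component_square])
  show "rel R X X \<rho>" by (rule F.dom.equiv_relsD(1)[OF assms])
  have X: "(X, Diag R X) \<in> Obj (qcompl R)" using assms by (simp add: qcompl_simps F.dom.diag_equiv)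
  note u = F.dom.qcompl_unit_quotient[OF assms]
  show "square S (FObj G (X, Diag R X)) (FObj G (X, \<rho>)) (FObj G (X, Diag R X)) (FObj G (X, \<rho>))
     (FArr G (X, Diag R X) (X, \<rho>) (Ident R X)) (FArr G (X, Diag R X) (X, \<rho>) (Ident R X))
     (FRel G (X, Diag R X) (X, Diag R X) \<rho>) (Diag S (FObj G (X, \<rho>)))"
    by (rule F.cod.quotient_arrow_square[OF G.preserves_quotients[OF X u(1,2)]
          G.rel[OF G.dom.equiv_relsD(1)[OF X u(1)]]])
qed

lemma comparison_natural:
  assumes f: "arr (qcompl R) (X, \<rho>) (Y, \<sigma>) f"
  shows "Comp S (FObj F X) (FObj G (X, \<rho>)) (FObj G (Y, \<sigma>)) (FArr G (X, \<rho>) (Y, \<sigma>) f) (comparison X \<rho>) =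
    Comp S (FObj F X) (FObj F Y) (FObj G (Y, \<sigma>)) (comparison Y \<sigma>) (FArr F X Y f)"
proof -
  have e: "\<rho> \<in> equiv_rels R X" "\<sigma> \<in> equiv_rels R Y" and f': "arr R X Y f"
    using f by (auto simp: F.dom.qcompl_arr dest: F.dom.squareD(1))
  note o = F.dom.arr_obj[OF f']
  note fd = F.dom.qcompl_arr_unit[OF f]
  note u = F.dom.qcompl_unit_quotient(3)[OF o(1) e(1)] and v = F.dom.qcompl_unit_quotient(3)[OF o(2) e(2)]
  have "Comp S (FObj F X) (FObj G (X, \<rho>)) (FObj G (Y, \<sigma>)) (FArr G (X, \<rho>) (Y, \<sigma>) f) (comparison X \<rho>)
    = Comp S (FObj F X) (FObj G (X, Diag R X)) (FObj G (Y, \<sigma>))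
       (FArr G (X, Diag R X) (Y, \<sigma>) (Comp (qcompl R) (X, Diag R X) (X, \<rho>) (Y, \<sigma>) f (Ident R X))) (\<phi> X)"
    unfolding comparison_def by (simp add: F.cod.assoc[OF component_arr[OF o(1)] G.arr[OF u] G.arr[OF f]] G.comp[OF u f])
  also have "Comp (qcompl R) (X, Diag R X) (X, \<rho>) (Y, \<sigma>) f (Ident R X)
      = Comp (qcompl R) (X, Diag R X) (Y, Diag R Y) (Y, \<sigma>) (Ident R Y) f"
    using f' by (simp add: qcompl_simps F.dom.ident_left F.dom.ident_right)
  also have "Comp S (FObj F X) (FObj G (X, Diag R X)) (FObj G (Y, \<sigma>)) (FArr G (X, Diag R X) (Y, \<sigma>) \<dots>) (\<phi> X)
    = Comp S (FObj F X) (FObj G (Y, Diag R Y)) (FObj G (Y, \<sigma>)) (FArr G (Y, Diag R Y) (Y, \<sigma>) (Ident R Y))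
       (Comp S (FObj F X) (FObj G (X, Diag R X)) (FObj G (Y, Diag R Y)) (FArr G (X, Diag R X) (Y, Diag R Y) f) (\<phi> X))"
    by (simp add: F.cod.assoc[OF component_arr[OF o(1)] G.arr[OF fd] G.arr[OF v]] G.comp[OF fd v])
  also have "\<dots> = Comp S (FObj F X) (FObj F Y) (FObj G (Y, \<sigma>)) (comparison Y \<sigma>) (FArr F X Y f)"
    unfolding comparison_def
    by (simp add: component_natural[OF f', symmetric]
        F.cod.assoc[OF F.arr[OF f'] component_arr[OF o(2)] G.arr[OF v]])
  finally show ?thesis .
qed

end

abbreviation restriction ::
  "('o, 'a, 'r) doctrine \<Rightarrow> ('p, 'b, 's) doctrine \<Rightarrow> (('o \<times> 'r, 'a, 'p, 'b, 'r, 's) one_arr, 'o \<times> 'r \<Rightarrow> 'b,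
     ('o, 'a, 'p, 'b, 'r, 's) one_arr, 'o \<Rightarrow> 'b) cfun" where
  "restriction R S \<equiv> comp_functor (QRD_hom (qcompl R) S)
     (precomp R (qcompl R) S (unit_arrow R)) (Uq_hom (qcompl R) S)"

lemma restriction_functor:
  "relational_doctrine R \<Longrightarrow> cat_functor (QRD_hom (qcompl R) S) (RD_hom R S) (restriction R S)"
  by (rule cat_functor_comp[OF Uq_hom_functor precomp_functor[OF relational_doctrine.one_arrow_unit]])

lemma restriction_obj:
  "quotient_one_arrow (qcompl R) S G \<Longrightarrow> FObj (restriction R S) G = comp_one_arrow R G (unit_arrow R)"
  by (simp add: comp_functor_def precomp_def Uq_hom_def id_functor_def QRD_hom_simps RD_hom_simps
      quotient_one_arrow.axioms)

lemma restriction_arr: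
  assumes "quotient_one_arrow (qcompl R) S G" "quotient_one_arrow (qcompl R) S G'" "\<theta> \<in> two_arrows (qcompl R) S G G'"
  shows "FArr (restriction R S) G G' \<theta> = (\<lambda>X\<in>Obj R. \<theta> (X, Diag R X))"
  using assms
  by (auto simp: comp_functor_def precomp_def Uq_hom_def id_functor_def QRD_hom_simps RD_hom_simps mk_arr_def
      quotient_one_arrow.axioms unit_arrow_simps intro!: restrict_ext)

text \<open>
  Given \<open>\<phi> : F \<Rightarrow> GE\<close>, the comparison arrow of \<open>\<phi>\<close> at \<open>(X, \<rho>)\<close> has a kernel containing \<open>F(\<rho>)\<close>, so it
  factors uniquely through the comparison arrow of \<open>\<eta>\<close>, which is a quotient arrow of \<open>F(\<rho>)\<close>.  The
  factorisations form the required 2-arrow \<open>\<psi>\<close>: naturality may be checked after composing with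
  quotient arrows, which are epic, and \<open>H(\<alpha>) \<le> S\<^bsub>\<psi>,\<psi>\<^esub>(G(\<alpha>))\<close> after reindexing along them, because they
  are descent.  Conversely, a 2-arrow \<open>\<psi>'\<close> that extends \<open>\<phi>\<close> is natural with respect to
  \<open>(X, d) \<rightarrow> (X, \<rho>)\<close>, so its component at \<open>(X, \<rho>)\<close> is such a factorisation too.
\<close>

lemma universal_arrow_of_quotients:
  assumes H: "arrow_into_restriction R S F H \<eta>"
    and quot: "\<And>X \<rho>. \<lbrakk>X \<in> Obj R; \<rho> \<in> equiv_rels R X\<rbrakk> \<Longrightarrow>
      quotient_arrow S (FObj F X) (FRel F X X \<rho>) (FObj H (X, \<rho>)) (arrow_into_restriction.comparison R S F H \<eta> X \<rho>)"
    and le: "\<And>X \<rho> Y \<sigma> \<alpha>. rel (qcompl R) (X, \<rho>) (Y, \<sigma>) \<alpha> \<Longrightarrow>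
      rle S (FObj F X) (FObj F Y) (Reidx S (FObj F X) (FObj H (X, \<rho>)) (FObj F Y) (FObj H (Y, \<sigma>))
        (arrow_into_restriction.comparison R S F H \<eta> X \<rho>) (arrow_into_restriction.comparison R S F H \<eta> Y \<sigma>)
        (FRel H (X, \<rho>) (Y, \<sigma>) \<alpha>)) (FRel F X Y \<alpha>)"
  shows "universal_arrow (QRD_hom (qcompl R) S) (RD_hom R S) (restriction R S) F H \<eta>"
proof -
  interpret H: arrow_into_restriction R S F H \<eta> by fact
  note F = H.F.one_arrow_axioms and HQ = H.G.quotient_one_arrow_axioms
  have ex: "\<exists>!\<psi>. \<psi> \<in> two_arrows (qcompl R) S H G \<and>
      (\<forall>X\<in>Obj R. Comp S (FObj F X) (FObj H (X, Diag R X)) (FObj G (X, Diag R X)) (\<psi> (X, Diag R X)) (\<eta> X) = \<phi> X)"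
    if GQ: "quotient_one_arrow (qcompl R) S G"
      and \<phi>: "\<phi> \<in> two_arrows R S F (comp_one_arrow R G (unit_arrow R))" for G \<phi>
  proof -
    interpret G: arrow_into_restriction R S F G \<phi>
      by (intro arrow_into_restriction.intro arrow_into_restriction_axioms.intro F GQ \<phi>)
    have Fr: "rel S (FObj F X) (FObj F X) (FRel F X X \<rho>)" if "X \<in> Obj R" "\<rho> \<in> equiv_rels R X" for X \<rho>
      by (rule H.F.rel[OF H.F.dom.equiv_relsD(1)[OF that]])
    define lift where "lift X \<rho> = (SOME h. arr S (FObj H (X, \<rho>)) (FObj G (X, \<rho>)) h \<and>
        Comp S (FObj F X) (FObj H (X, \<rho>)) (FObj G (X, \<rho>)) h (H.comparison X \<rho>) = G.comparison X \<rho>)" for X \<rho>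
    have lift: "arr S (FObj H (X, \<rho>)) (FObj G (X, \<rho>)) (lift X \<rho>)"
        "Comp S (FObj F X) (FObj H (X, \<rho>)) (FObj G (X, \<rho>)) (lift X \<rho>) (H.comparison X \<rho>) = G.comparison X \<rho>"
      if "X \<in> Obj R" "\<rho> \<in> equiv_rels R X" for X \<rho>
      using someI_ex[OF H.F.cod.quotient_arrow_factor[OF quot[OF that] Fr[OF that] G.comparison_kernel[OF that]]]
      unfolding lift_def by blast+
    note epi = H.F.cod.quotient_arrow_epi[OF quot Fr]
    let ?\<psi> = "\<lambda>(X, \<rho>)\<in>Obj (qcompl R). lift X \<rho>"
    have \<psi>: "?\<psi> \<in> two_arrows (qcompl R) S H G"
    proof (rule two_arrowsI[OF H.G.one_arrow_axioms G.G.one_arrow_axioms]; (unfold split_paired_all)?)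
      show "?\<psi> \<in> extensional (Obj (qcompl R))" by simp
    next
      fix X \<rho> assume "(X, \<rho>) \<in> Obj (qcompl R)"
      then show "arr S (FObj H (X, \<rho>)) (FObj G (X, \<rho>)) (?\<psi> (X, \<rho>))" by (simp add: lift qcompl_simps)
    next
      fix X \<rho> Y \<sigma> f assume f: "arr (qcompl R) (X, \<rho>) (Y, \<sigma>) f"
      then have e: "\<rho> \<in> equiv_rels R X" "\<sigma> \<in> equiv_rels R Y" and f': "arr R X Y f"
        by (auto simp: H.F.dom.qcompl_arr dest: H.F.dom.squareD(1))
      note o = H.F.dom.arr_obj[OF f']
      note X = o(1) e(1) and Y = o(2) e(2)
      have "Comp S (FObj H (X, \<rho>)) (FObj H (Y, \<sigma>)) (FObj G (Y, \<sigma>)) (lift Y \<sigma>) (FArr H (X, \<rho>) (Y, \<sigma>) f) =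
        Comp S (FObj H (X, \<rho>)) (FObj G (X, \<rho>)) (FObj G (Y, \<sigma>)) (FArr G (X, \<rho>) (Y, \<sigma>) f) (lift X \<rho>)" (is "?a = ?b")
      proof (rule epi[OF X X])
        show "arr S (FObj H (X, \<rho>)) (FObj G (Y, \<sigma>)) ?a" "arr S (FObj H (X, \<rho>)) (FObj G (Y, \<sigma>)) ?b"
          by (rule H.F.cod.arr_comp[OF H.G.arr[OF f] lift(1)[OF Y]], rule H.F.cod.arr_comp[OF lift(1)[OF X] G.G.arr[OF f]])
        have "Comp S (FObj F X) (FObj H (X, \<rho>)) (FObj G (Y, \<sigma>)) ?a (H.comparison X \<rho>)
          = Comp S (FObj F X) (FObj H (Y, \<sigma>)) (FObj G (Y, \<sigma>)) (lift Y \<sigma>)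
             (Comp S (FObj F X) (FObj F Y) (FObj H (Y, \<sigma>)) (H.comparison Y \<sigma>) (FArr F X Y f))"
          by (simp add: H.F.cod.assoc[OF H.comparison_arr[OF X] H.G.arr[OF f] lift(1)[OF Y], symmetric]
              H.comparison_natural[OF f])
        also have "\<dots> = Comp S (FObj F X) (FObj F Y) (FObj G (Y, \<sigma>)) (G.comparison Y \<sigma>) (FArr F X Y f)"
          by (simp add: H.F.cod.assoc[OF H.F.arr[OF f'] H.comparison_arr[OF Y] lift(1)[OF Y]] lift(2)[OF Y])
        also have "\<dots> = Comp S (FObj F X) (FObj H (X, \<rho>)) (FObj G (Y, \<sigma>)) ?b (H.comparison X \<rho>)"
          by (simp add: H.F.cod.assoc[OF H.comparison_arr[OF X] lift(1)[OF X] G.G.arr[OF f], symmetric] lift(2)[OF X]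
              G.comparison_natural[OF f])
        finally show "Comp S (FObj F X) (FObj H (X, \<rho>)) (FObj G (Y, \<sigma>)) ?a (H.comparison X \<rho>) =
            Comp S (FObj F X) (FObj H (X, \<rho>)) (FObj G (Y, \<sigma>)) ?b (H.comparison X \<rho>)" .
      qed
      then show "Comp S (FObj H (X, \<rho>)) (FObj H (Y, \<sigma>)) (FObj G (Y, \<sigma>)) (?\<psi> (Y, \<sigma>)) (FArr H (X, \<rho>) (Y, \<sigma>) f) =
        Comp S (FObj H (X, \<rho>)) (FObj G (X, \<rho>)) (FObj G (Y, \<sigma>)) (FArr G (X, \<rho>) (Y, \<sigma>) f) (?\<psi> (X, \<rho>))"
        using X Y by (simp add: qcompl_simps)
    next
      fix X \<rho> Y \<sigma> \<alpha> assume r: "rel (qcompl R) (X, \<rho>) (Y, \<sigma>) \<alpha>"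
      then have e: "\<rho> \<in> equiv_rels R X" "\<sigma> \<in> equiv_rels R Y" and r': "rel R X Y \<alpha>" by (simp_all add: H.F.dom.qcompl_rel)
      note o = H.F.dom.relD(1,2)[OF r']
      note X = o(1) e(1) and Y = o(2) e(2)
      have "square S (FObj F X) (FObj G (X, \<rho>)) (FObj F Y) (FObj G (Y, \<sigma>)) (G.comparison X \<rho>) (G.comparison Y \<sigma>)
        (Reidx S (FObj F X) (FObj H (X, \<rho>)) (FObj F Y) (FObj H (Y, \<sigma>)) (H.comparison X \<rho>) (H.comparison Y \<sigma>)
        (FRel H (X, \<rho>) (Y, \<sigma>) \<alpha>)) (FRel G (X, \<rho>) (Y, \<sigma>) \<alpha>)"
        by (rule H.F.cod.square_mono_left[OF le[OF r] G.comparison_square[OF r]])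
      note s = H.F.cod.square_factor[OF this[folded lift(2)[OF X] lift(2)[OF Y]] H.comparison_arr[OF X] lift(1)[OF X]
          H.comparison_arr[OF Y] lift(1)[OF Y]]
      have "rle S (FObj H (X, \<rho>)) (FObj H (Y, \<sigma>)) (FRel H (X, \<rho>) (Y, \<sigma>) \<alpha>)
         (Reidx S (FObj H (X, \<rho>)) (FObj G (X, \<rho>)) (FObj H (Y, \<sigma>)) (FObj G (Y, \<sigma>)) (lift X \<rho>) (lift Y \<sigma>)
           (FRel G (X, \<rho>) (Y, \<sigma>) \<alpha>))"
        by (rule H.F.cod.descent_reflects[OF H.comparison_arr[OF X] H.comparison_arr[OF Y] _ _ s H.G.rel[OF r]])
          (rule H.G.cod.quotient_arrow_descent[OF H.F.obj[OF X(1)] H.F.equiv[OF X] quot[OF X]],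
           rule H.G.cod.quotient_arrow_descent[OF H.F.obj[OF Y(1)] H.F.equiv[OF Y] quot[OF Y]])
      then have "square S (FObj H (X, \<rho>)) (FObj G (X, \<rho>)) (FObj H (Y, \<sigma>)) (FObj G (Y, \<sigma>)) (lift X \<rho>) (lift Y \<sigma>)
           (FRel H (X, \<rho>) (Y, \<sigma>) \<alpha>) (FRel G (X, \<rho>) (Y, \<sigma>) \<alpha>)"
        by (rule H.F.cod.squareI[OF lift(1)[OF X] lift(1)[OF Y] G.G.rel[OF r]])
      then show "square S (FObj H (X, \<rho>)) (FObj G (X, \<rho>)) (FObj H (Y, \<sigma>)) (FObj G (Y, \<sigma>)) (?\<psi> (X, \<rho>)) (?\<psi> (Y, \<sigma>))
           (FRel H (X, \<rho>) (Y, \<sigma>) \<alpha>) (FRel G (X, \<rho>) (Y, \<sigma>) \<alpha>)"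
        using X Y by (simp add: qcompl_simps)
    qed
    show ?thesis
    proof (rule ex1I[of _ ?\<psi>], intro conjI ballI \<psi>)
      fix X assume X: "X \<in> Obj R"
      then show "Comp S (FObj F X) (FObj H (X, Diag R X)) (FObj G (X, Diag R X)) (?\<psi> (X, Diag R X)) (\<eta> X) = \<phi> X"
        using lift(2)[OF X H.F.dom.diag_equiv[OF X]]
        by (simp add: qcompl_simps H.F.dom.diag_equiv H.comparison_diag G.comparison_diag)
    next
      fix \<psi>' assume "\<psi>' \<in> two_arrows (qcompl R) S H G \<and>
        (\<forall>X\<in>Obj R. Comp S (FObj F X) (FObj H (X, Diag R X)) (FObj G (X, Diag R X)) (\<psi>' (X, Diag R X)) (\<eta> X) = \<phi> X)"
      then have \<psi>': "\<psi>' \<in> two_arrows (qcompl R) S H G"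
        and c: "\<And>X. X \<in> Obj R \<Longrightarrow>
          Comp S (FObj F X) (FObj H (X, Diag R X)) (FObj G (X, Diag R X)) (\<psi>' (X, Diag R X)) (\<eta> X) = \<phi> X"
        by blast+
      note t = two_arrowsD[OF \<psi>' H.G.one_arrow_axioms G.G.one_arrow_axioms]
      have "\<psi>' (X, \<rho>) = lift X \<rho>" if X: "X \<in> Obj R" "\<rho> \<in> equiv_rels R X" for X \<rho>
      proof (rule epi[OF X X])
        have Q: "(X, \<rho>) \<in> Obj (qcompl R)" "(X, Diag R X) \<in> Obj (qcompl R)"
          using X by (simp_all add: qcompl_simps H.F.dom.diag_equiv)
        note u = H.F.dom.qcompl_unit_quotient(3)[OF X]
        show "arr S (FObj H (X, \<rho>)) (FObj G (X, \<rho>)) (\<psi>' (X, \<rho>))" by (rule t(2)[OF Q(1)])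
        show "arr S (FObj H (X, \<rho>)) (FObj G (X, \<rho>)) (lift X \<rho>)" by (rule lift(1)[OF X])
        have "Comp S (FObj F X) (FObj H (X, \<rho>)) (FObj G (X, \<rho>)) (\<psi>' (X, \<rho>)) (H.comparison X \<rho>) =
          Comp S (FObj F X) (FObj H (X, Diag R X)) (FObj G (X, \<rho>)) (Comp S (FObj H (X, Diag R X)) (FObj G (X, Diag R X))
            (FObj G (X, \<rho>)) (FArr G (X, Diag R X) (X, \<rho>) (Ident R X)) (\<psi>' (X, Diag R X))) (\<eta> X)"
          unfolding H.comparison_def t(3)[OF u, symmetric]
          by (rule H.F.cod.assoc[OF H.component_arr[OF X(1)] H.G.arr[OF u] t(2)[OF Q(1)]])
        also have "\<dots> = G.comparison X \<rho>"
          unfolding G.comparison_def c[OF X(1), symmetric]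
          by (rule H.F.cod.assoc[OF H.component_arr[OF X(1)] t(2)[OF Q(2)] G.G.arr[OF u], symmetric])
        finally show "Comp S (FObj F X) (FObj H (X, \<rho>)) (FObj G (X, \<rho>)) (\<psi>' (X, \<rho>)) (H.comparison X \<rho>) =
          Comp S (FObj F X) (FObj H (X, \<rho>)) (FObj G (X, \<rho>)) (lift X \<rho>) (H.comparison X \<rho>)"
          by (simp add: lift(2)[OF X])
      qed
      then show "\<psi>' = ?\<psi>"
        using t(1) by (intro extensionalityI[of _ "Obj (qcompl R)"]) (auto simp: qcompl_simps)
    qed
  qed
  show ?thesis
    unfolding universal_arrow_def
  proof (intro conjI ballI)
    show "H \<in> Obj (QRD_hom (qcompl R) S)" using HQ by (simp add: QRD_hom_simps)
    show "\<eta> \<in> Hom (RD_hom R S) F (FObj (restriction R S) H)" using H.\<phi> HQ by (simp add: RD_hom_simps restriction_obj)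
    fix G \<phi> assume "G \<in> Obj (QRD_hom (qcompl R) S)" and p: "\<phi> \<in> Hom (RD_hom R S) F (FObj (restriction R S) G)"
    then have G: "quotient_one_arrow (qcompl R) S G" by (simp add: QRD_hom_simps)
    from p have p: "\<phi> \<in> two_arrows R S F (comp_one_arrow R G (unit_arrow R))"
      by (simp add: RD_hom_simps restriction_obj[OF G])
    have "\<phi> \<in> extensional (Obj R)"
      by (rule two_arrow_ext[OF p F one_arrow_comp[OF H.F.dom.one_arrow_unit]])
        (use G in \<open>simp add: quotient_one_arrow.axioms\<close>)
    then have "Comp (RD_hom R S) F (FObj (restriction R S) H) (FObj (restriction R S) G)
         (FArr (restriction R S) H G \<psi>) \<eta> = \<phi> \<longleftrightarrow>
       (\<forall>X\<in>Obj R. Comp S (FObj F X) (FObj H (X, Diag R X)) (FObj G (X, Diag R X)) (\<psi> (X, Diag R X)) (\<eta> X) = \<phi> X)"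
      if "\<psi> \<in> two_arrows (qcompl R) S H G" for \<psi>
      using that by (auto simp: RD_hom_simps restriction_obj HQ G restriction_arr comp_one_arrow_simps unit_arrow_simps
          fun_eq_iff extensional_def)
    then show "\<exists>!\<psi>. \<psi> \<in> Hom (QRD_hom (qcompl R) S) H G \<and> Comp (RD_hom R S) F (FObj (restriction R S) H)
        (FObj (restriction R S) G) (FArr (restriction R S) H G \<psi>) \<eta> = \<phi>"
      using ex[OF G p] by (simp add: QRD_hom_simps cong: conj_cong)
  qed
qed

text \<open>
  With \<open>\<eta>\<close> the identity of \<open>GE\<close>, the comparison arrow at \<open>(X, \<rho>)\<close> is the image under \<open>G\<close> of
  \<open>(X, d) \<rightarrow> (X, \<rho>)\<close>.  It is a quotient arrow because \<open>G\<close> preserves quotients, and reindexing \<open>G(\<alpha>)\<close>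
  along such arrows gives \<open>GE(\<alpha>)\<close> by naturality of the action of \<open>G\<close> on relations.
\<close>

lemma universal_arrow_ident:
  assumes R: "relational_doctrine R" and G: "quotient_one_arrow (qcompl R) S G"
  shows "universal_arrow (QRD_hom (qcompl R) S) (RD_hom R S) (restriction R S) (FObj (restriction R S) G) G
    (Ident (RD_hom R S) (FObj (restriction R S) G))"
proof -
  interpret R: relational_doctrine R by fact
  interpret G: quotient_one_arrow "qcompl R" S G by fact
  let ?F = "comp_one_arrow R G (unit_arrow R)" and ?\<eta> = "Ident (RD_hom R S) (comp_one_arrow R G (unit_arrow R))"
  have F: "one_arrow R S ?F" by (rule one_arrow_comp[OF R.one_arrow_unit G.one_arrow_axioms])
  have \<eta>: "arrow_into_restriction R S ?F G ?\<eta>"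
    by (intro arrow_into_restriction.intro arrow_into_restriction_axioms.intro F G)
      (simp add: RD_hom_simps two_arrow_ident[OF F])
  interpret F: arrow_into_restriction R S ?F G ?\<eta> by fact
  have FX: "FObj ?F X = FObj G (X, Diag R X)" if "X \<in> Obj R" for X
    using that by (simp add: comp_one_arrow_simps unit_arrow_simps)
  have Fr: "FRel ?F X Y \<alpha> = FRel G (X, Diag R X) (Y, Diag R Y) \<alpha>" if "rel R X Y \<alpha>" for X Y \<alpha>
    using that by (simp add: comp_one_arrow_simps unit_arrow_simps R.relD)
  have c: "F.comparison X \<rho> = FArr G (X, Diag R X) (X, \<rho>) (Ident R X)" if "X \<in> Obj R" "\<rho> \<in> equiv_rels R X" for X \<rho>
    unfolding F.comparison_def using that G.cod.ident_right[OF G.arr[OF R.qcompl_unit_quotient(3)[OF that]]]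
    by (simp add: FX RD_hom_simps)
  show ?thesis unfolding restriction_obj[OF G]
  proof (rule universal_arrow_of_quotients[OF \<eta>])
    fix X \<rho> assume a: "X \<in> Obj R" "\<rho> \<in> equiv_rels R X"
    note u = R.qcompl_unit_quotient[OF a]
    show "quotient_arrow S (FObj ?F X) (FRel ?F X X \<rho>) (FObj G (X, \<rho>)) (F.comparison X \<rho>)"
      using G.preserves_quotients[OF _ u(1,2)] a
      by (simp add: qcompl_simps R.diag_equiv c FX Fr R.equiv_relsD)
  next
    fix X \<rho> Y \<sigma> \<alpha> assume r: "rel (qcompl R) (X, \<rho>) (Y, \<sigma>) \<alpha>"
    then have e: "\<rho> \<in> equiv_rels R X" "\<sigma> \<in> equiv_rels R Y" and r': "rel R X Y \<alpha>" by (simp_all add: R.qcompl_rel)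
    note o = R.relD(1,2)[OF r']
    note X = o(1) e(1) and Y = o(2) e(2)
    have "FRel G (X, Diag R X) (Y, Diag R Y)
        (Reidx (qcompl R) (X, Diag R X) (X, \<rho>) (Y, Diag R Y) (Y, \<sigma>) (Ident R X) (Ident R Y) \<alpha>) =
      FRel G (X, Diag R X) (Y, Diag R Y) \<alpha>"
      using r' by (simp add: qcompl_simps R.reidx_id)
    then show "rle S (FObj ?F X) (FObj ?F Y) (Reidx S (FObj ?F X) (FObj G (X, \<rho>)) (FObj ?F Y) (FObj G (Y, \<sigma>))
        (F.comparison X \<rho>) (F.comparison Y \<sigma>) (FRel G (X, \<rho>) (Y, \<sigma>) \<alpha>)) (FRel ?F X Y \<alpha>)"
      using G.reidx[OF R.qcompl_unit_quotient(3)[OF X] R.qcompl_unit_quotient(3)[OF Y] r]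
        G.cod.rle_refl[OF G.rel[OF R.qcompl_rel_unit(1)[OF r]]] o
      by (simp add: c[OF X] c[OF Y] FX Fr[OF r'])
  qed
qed


section \<open>Extending a one-arrow along chosen quotients\<close>

text \<open>
  The choice of quotient arrows is a parameter of the construction; that they are effective and descent
  is a consequence of \<open>quotient_arrow_effective_descent\<close>.
\<close>

locale quotient_extension = S: doctrine_with_quotients S + F: one_arrow R S F
  for R :: "('o, 'a, 'r) doctrine" and S :: "('p, 'b, 's) doctrine"
    and F :: "('o, 'a, 'p, 'b, 'r, 's) one_arr" +
  fixes W :: "'o \<Rightarrow> 'r \<Rightarrow> 'p" and q :: "'o \<Rightarrow> 'r \<Rightarrow> 'b"
  assumes quot: "\<lbrakk>X \<in> Obj R; \<rho> \<in> equiv_rels R X\<rbrakk>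
    \<Longrightarrow> quotient_arrow S (FObj F X) (FRel F X X \<rho>) (W X \<rho>) (q X \<rho>)"
begin

definition lift :: "'o \<times> 'r \<Rightarrow> 'o \<times> 'r \<Rightarrow> 'a \<Rightarrow> 'b" where
  "lift = (\<lambda>(X, \<rho>) (Y, \<sigma>) f. SOME h. arr S (W X \<rho>) (W Y \<sigma>) h \<and>
     Comp S (FObj F X) (W X \<rho>) (W Y \<sigma>) h (q X \<rho>) = Comp S (FObj F X) (FObj F Y) (W Y \<sigma>) (q Y \<sigma>) (FArr F X Y f))"

definition extension :: "('o \<times> 'r, 'a, 'p, 'b, 'r, 's) one_arr" where
  "extension = \<lparr>FObj = (\<lambda>(X, \<rho>)\<in>Obj (qcompl R). W X \<rho>), FArr = mk_arr (qcompl R) lift,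
     FRel = mk_rel (qcompl R) (\<lambda>(X, \<rho>) (Y, \<sigma>) \<alpha>.
       direct_image S (FObj F X) (W X \<rho>) (FObj F Y) (W Y \<sigma>) (q X \<rho>) (q Y \<sigma>) (FRel F X Y \<alpha>))\<rparr>"

abbreviation pull where
  "pull X \<rho> Y \<sigma> \<equiv> Reidx S (FObj F X) (W X \<rho>) (FObj F Y) (W Y \<sigma>) (q X \<rho>) (q Y \<sigma>)"

lemma Fr: "\<lbrakk>X \<in> Obj R; \<rho> \<in> equiv_rels R X\<rbrakk> \<Longrightarrow> rel S (FObj F X) (FObj F X) (FRel F X X \<rho>)"
  by (rule F.rel[OF F.dom.equiv_relsD(1)])

lemma q_arr: "\<lbrakk>X \<in> Obj R; \<rho> \<in> equiv_rels R X\<rbrakk> \<Longrightarrow> arr S (FObj F X) (W X \<rho>) (q X \<rho>)"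
  by (rule S.quotient_arrow_arr[OF quot Fr])

lemma W_obj: "\<lbrakk>X \<in> Obj R; \<rho> \<in> equiv_rels R X\<rbrakk> \<Longrightarrow> W X \<rho> \<in> Obj S"
  by (rule S.arr_obj(2)[OF q_arr])

lemma q_epi: "\<lbrakk>X \<in> Obj R; \<rho> \<in> equiv_rels R X; arr S (W X \<rho>) Z h; arr S (W X \<rho>) Z h';
    Comp S (FObj F X) (W X \<rho>) Z h (q X \<rho>) = Comp S (FObj F X) (W X \<rho>) Z h' (q X \<rho>)\<rbrakk> \<Longrightarrow> h = h'"
  by (rule S.quotient_arrow_epi[OF quot Fr])

lemma q_descent: "\<lbrakk>X \<in> Obj R; \<rho> \<in> equiv_rels R X\<rbrakk> \<Longrightarrow> descent S (FObj F X) (W X \<rho>) (q X \<rho>)"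
  by (rule S.quotient_arrow_descent[OF F.obj F.equiv quot])

lemma q_effective: "\<lbrakk>X \<in> Obj R; \<rho> \<in> equiv_rels R X\<rbrakk> \<Longrightarrow> pull X \<rho> X \<rho> (Diag S (W X \<rho>)) = FRel F X X \<rho>"
  by (rule S.quotient_arrow_effective[OF F.obj F.equiv quot])

lemma pull_inject:
  assumes X: "X \<in> Obj R" "\<rho> \<in> equiv_rels R X" and Y: "Y \<in> Obj R" "\<sigma> \<in> equiv_rels R Y"
    and "rel S (W X \<rho>) (W Y \<sigma>) \<gamma>" "rel S (W X \<rho>) (W Y \<sigma>) \<delta>" "pull X \<rho> Y \<sigma> \<gamma> = pull X \<rho> Y \<sigma> \<delta>"
  shows "\<gamma> = \<delta>"
  by (rule S.descent_reidx_inject[OF q_arr[OF X] q_arr[OF Y] q_descent[OF X] q_descent[OF Y] assms(7,5,6)])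

lemma extension_obj: "\<lbrakk>X \<in> Obj R; \<rho> \<in> equiv_rels R X\<rbrakk> \<Longrightarrow> FObj extension (X, \<rho>) = W X \<rho>"
  by (simp add: extension_def qcompl_simps)

lemma extension_arr:
  assumes f: "arr (qcompl R) (X, \<rho>) (Y, \<sigma>) f"
  shows "arr S (W X \<rho>) (W Y \<sigma>) (FArr extension (X, \<rho>) (Y, \<sigma>) f)"
    and "Comp S (FObj F X) (W X \<rho>) (W Y \<sigma>) (FArr extension (X, \<rho>) (Y, \<sigma>) f) (q X \<rho>) =
      Comp S (FObj F X) (FObj F Y) (W Y \<sigma>) (q Y \<sigma>) (FArr F X Y f)"
proof -
  have e: "\<rho> \<in> equiv_rels R X" "\<sigma> \<in> equiv_rels R Y" and s: "square R X Y X Y f f \<rho> \<sigma>"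
    using f by (auto simp: F.dom.qcompl_arr)
  note o = F.dom.arr_obj[OF F.dom.squareD(1)[OF s]]
  note X = o(1) e(1) and Y = o(2) e(2)
  have "\<exists>h. arr S (W X \<rho>) (W Y \<sigma>) h \<and>
     Comp S (FObj F X) (W X \<rho>) (W Y \<sigma>) h (q X \<rho>) = Comp S (FObj F X) (FObj F Y) (W Y \<sigma>) (q Y \<sigma>) (FArr F X Y f)"
    by (rule S.quotient_arrow_factor[OF quot[OF X] Fr[OF X]
          S.square_vertical[OF F.square[OF s] S.quotient_arrow_square[OF quot[OF Y] Fr[OF Y]]]])
  note h = someI_ex[OF this]
  have "FArr extension (X, \<rho>) (Y, \<sigma>) f = lift (X, \<rho>) (Y, \<sigma>) f"
    using f by (simp add: extension_def mk_arr_def arr_def)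
  with h show "arr S (W X \<rho>) (W Y \<sigma>) (FArr extension (X, \<rho>) (Y, \<sigma>) f)"
    "Comp S (FObj F X) (W X \<rho>) (W Y \<sigma>) (FArr extension (X, \<rho>) (Y, \<sigma>) f) (q X \<rho>) =
      Comp S (FObj F X) (FObj F Y) (W Y \<sigma>) (q Y \<sigma>) (FArr F X Y f)"
    by (simp_all add: lift_def)
qed

lemma extension_rel_def:
  "rel (qcompl R) (X, \<rho>) (Y, \<sigma>) \<alpha> \<Longrightarrow> FRel extension (X, \<rho>) (Y, \<sigma>) \<alpha> =
     direct_image S (FObj F X) (W X \<rho>) (FObj F Y) (W Y \<sigma>) (q X \<rho>) (q Y \<sigma>) (FRel F X Y \<alpha>)"
  by (simp add: extension_def mk_rel_def rel_def)

text \<open>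
  The formula for the action on relations matters less than this characterisation.  Reindexing
  the direct image gives \<open>F(\<rho>) ; F(\<alpha>) ; F(\<sigma>)\<close>, since the quotient arrows are effective, and this is
  \<open>F(\<alpha>)\<close> because \<open>\<alpha>\<close> is saturated.  As reindexing along the quotient arrows is an order embedding,
  the image of \<open>\<alpha>\<close> is the only relation between the quotients with this property.
\<close>

lemma extension_rel:
  assumes r: "rel (qcompl R) (X, \<rho>) (Y, \<sigma>) \<alpha>"
  shows "rel S (W X \<rho>) (W Y \<sigma>) (FRel extension (X, \<rho>) (Y, \<sigma>) \<alpha>)"
    and "pull X \<rho> Y \<sigma> (FRel extension (X, \<rho>) (Y, \<sigma>) \<alpha>) = FRel F X Y \<alpha>"
proof -
  have e: "\<rho> \<in> equiv_rels R X" "\<sigma> \<in> equiv_rels R Y" and r': "rel R X Y \<alpha>"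
    and a: "RComp R X X Y \<rho> \<alpha> = \<alpha>" "RComp R X Y Y \<alpha> \<sigma> = \<alpha>"
    using r by (simp_all add: F.dom.qcompl_rel)
  note o = F.dom.relD(1,2)[OF r']
  note X = o(1) e(1) and Y = o(2) e(2)
  show "rel S (W X \<rho>) (W Y \<sigma>) (FRel extension (X, \<rho>) (Y, \<sigma>) \<alpha>)"
    unfolding extension_rel_def[OF r] by (rule S.rel_direct_image[OF q_arr[OF X] q_arr[OF Y] F.rel[OF r']])
  let ?q = "graph S (FObj F X) (W X \<rho>) (q X \<rho>)" and ?q' = "graph S (FObj F Y) (W Y \<sigma>) (q Y \<sigma>)"
  note g = S.rel_graph[OF q_arr[OF X]] S.rel_graph[OF q_arr[OF Y]]
  note t = g g[THEN S.rel_conv] F.rel[OF r'] Fr[OF X] Fr[OF Y]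
  have k: "RComp S (FObj F X) (W X \<rho>) (FObj F X) ?q (Conv S (FObj F X) (W X \<rho>) ?q) = FRel F X X \<rho>"
    "RComp S (FObj F Y) (W Y \<sigma>) (FObj F Y) ?q' (Conv S (FObj F Y) (W Y \<sigma>) ?q') = FRel F Y Y \<sigma>"
    using q_effective[OF X] q_effective[OF Y]
    by (simp_all add: S.kernel_eq_reidx[OF q_arr[OF X], symmetric] S.kernel_eq_reidx[OF q_arr[OF Y], symmetric] kernel_def)
  have "pull X \<rho> Y \<sigma> (FRel extension (X, \<rho>) (Y, \<sigma>) \<alpha>) =
     RComp S (FObj F X) (FObj F Y) (FObj F Y)
      (RComp S (FObj F X) (FObj F X) (FObj F Y) (RComp S (FObj F X) (W X \<rho>) (FObj F X) ?q (Conv S (FObj F X) (W X \<rho>) ?q))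
        (FRel F X Y \<alpha>))
      (RComp S (FObj F Y) (W Y \<sigma>) (FObj F Y) ?q' (Conv S (FObj F Y) (W Y \<sigma>) ?q'))"
    unfolding S.reidx_eq_graphs[OF q_arr[OF X] q_arr[OF Y] \<open>rel S (W X \<rho>) (W Y \<sigma>) _\<close>]
    unfolding extension_rel_def[OF r] direct_image_def
    by (simp add: S.reassoc t S.rel_rcomp)
  then show "pull X \<rho> Y \<sigma> (FRel extension (X, \<rho>) (Y, \<sigma>) \<alpha>) = FRel F X Y \<alpha>"
    unfolding k by (simp add: F.rel_absorb_left X F.rel_absorb_right Y r' a)
qed

lemma extension_rel_square:
  assumes r: "rel (qcompl R) (X, \<rho>) (Y, \<sigma>) \<alpha>"
  shows "square S (FObj F X) (W X \<rho>) (FObj F Y) (W Y \<sigma>) (q X \<rho>) (q Y \<sigma>)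
    (FRel F X Y \<alpha>) (FRel extension (X, \<rho>) (Y, \<sigma>) \<alpha>)"
proof -
  have e: "\<rho> \<in> equiv_rels R X" "\<sigma> \<in> equiv_rels R Y" and r': "rel R X Y \<alpha>"
    using r by (simp_all add: F.dom.qcompl_rel)
  note o = F.dom.relD(1,2)[OF r']
  show ?thesis
    using S.square_reidx[OF q_arr[OF o(1) e(1)] q_arr[OF o(2) e(2)] extension_rel(1)[OF r]]
    by (simp add: extension_rel(2)[OF r])
qed

lemma extension_diag:
  assumes X: "X \<in> Obj R" "\<rho> \<in> equiv_rels R X"
  shows "FRel extension (X, \<rho>) (X, \<rho>) \<rho> = Diag S (W X \<rho>)"
proof -
  have r: "rel (qcompl R) (X, \<rho>) (X, \<rho>) \<rho>" using X by (simp add: F.dom.qcompl_rel F.dom.equiv_relsD)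
  show ?thesis
    by (rule pull_inject[OF X X extension_rel(1)[OF r] S.rel_diag[OF W_obj[OF X]]])
      (simp add: extension_rel(2)[OF r] q_effective X)
qed

lemma extension_rle:
  assumes r: "rel (qcompl R) (X, \<rho>) (Y, \<sigma>) \<alpha>" and r': "rel (qcompl R) (X, \<rho>) (Y, \<sigma>) \<beta>" and le: "rle R X Y \<alpha> \<beta>"
  shows "rle S (W X \<rho>) (W Y \<sigma>) (FRel extension (X, \<rho>) (Y, \<sigma>) \<alpha>) (FRel extension (X, \<rho>) (Y, \<sigma>) \<beta>)"
proof -
  have e: "\<rho> \<in> equiv_rels R X" "\<sigma> \<in> equiv_rels R Y" using r by (simp_all add: F.dom.qcompl_rel)
  note o = F.dom.relD(1,2)[OF F.dom.rleD(1)[OF le]]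
  note X = o(1) e(1) and Y = o(2) e(2)
  show ?thesis
    by (rule S.descent_reflects[OF q_arr[OF X] q_arr[OF Y] q_descent[OF X] q_descent[OF Y] _ extension_rel(1)[OF r]])
      (simp add: extension_rel(2)[OF r] S.square_mono_left[OF F.rle[OF le] extension_rel_square[OF r']])
qed

lemma extension_reidx:
  assumes f: "arr (qcompl R) (X, \<rho>) (A, \<rho>') f" and g: "arr (qcompl R) (Y, \<sigma>) (B, \<sigma>') g"
    and r: "rel (qcompl R) (A, \<rho>') (B, \<sigma>') \<alpha>"
  shows "FRel extension (X, \<rho>) (Y, \<sigma>) (Reidx R X A Y B f g \<alpha>) =
    Reidx S (W X \<rho>) (W A \<rho>') (W Y \<sigma>) (W B \<sigma>') (FArr extension (X, \<rho>) (A, \<rho>') f)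
      (FArr extension (Y, \<sigma>) (B, \<sigma>') g) (FRel extension (A, \<rho>') (B, \<sigma>') \<alpha>)"
proof -
  interpret Q: relational_doctrine "qcompl R" by (rule F.dom.qcompl_relational_doctrine)
  have e: "\<rho> \<in> equiv_rels R X" "\<rho>' \<in> equiv_rels R A" "\<sigma> \<in> equiv_rels R Y" "\<sigma>' \<in> equiv_rels R B"
    and f': "arr R X A f" and g': "arr R Y B g" and r': "rel R A B \<alpha>"
    using f g r by (auto simp: F.dom.qcompl_arr F.dom.qcompl_rel dest: F.dom.squareD(1))
  note o = F.dom.arr_obj[OF f'] F.dom.arr_obj[OF g']
  note X = o(1) e(1) and A = o(2) e(2) and Y = o(3) e(3) and B = o(4) e(4)
  have t: "rel (qcompl R) (X, \<rho>) (Y, \<sigma>) (Reidx R X A Y B f g \<alpha>)"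
    using Q.rel_reidx[OF f g r] by (simp add: qcompl_simps)
  note Ff = F.arr[OF f'] and Fg = F.arr[OF g'] and E = extension_rel(1)[OF r]
  show ?thesis
  proof (rule pull_inject[OF X Y extension_rel(1)[OF t]])
    show "rel S (W X \<rho>) (W Y \<sigma>) (Reidx S (W X \<rho>) (W A \<rho>') (W Y \<sigma>) (W B \<sigma>') (FArr extension (X, \<rho>) (A, \<rho>') f)
      (FArr extension (Y, \<sigma>) (B, \<sigma>') g) (FRel extension (A, \<rho>') (B, \<sigma>') \<alpha>))"
      by (rule S.rel_reidx[OF extension_arr(1)[OF f] extension_arr(1)[OF g] E])
    have "pull X \<rho> Y \<sigma> (FRel extension (X, \<rho>) (Y, \<sigma>) (Reidx R X A Y B f g \<alpha>)) =
      Reidx S (FObj F X) (FObj F A) (FObj F Y) (FObj F B) (FArr F X A f) (FArr F Y B g)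
        (pull A \<rho>' B \<sigma>' (FRel extension (A, \<rho>') (B, \<sigma>') \<alpha>))"
      by (simp add: extension_rel(2)[OF t] extension_rel(2)[OF r] F.reidx[OF f' g' r'])
    also have "\<dots> = pull X \<rho> Y \<sigma> (Reidx S (W X \<rho>) (W A \<rho>') (W Y \<sigma>) (W B \<sigma>') (FArr extension (X, \<rho>) (A, \<rho>') f)
      (FArr extension (Y, \<sigma>) (B, \<sigma>') g) (FRel extension (A, \<rho>') (B, \<sigma>') \<alpha>))"
      by (simp add: S.reidx_reidx[OF Ff q_arr[OF A] Fg q_arr[OF B] E]
          S.reidx_reidx[OF q_arr[OF X] extension_arr(1)[OF f] q_arr[OF Y] extension_arr(1)[OF g] E]
          extension_arr(2)[OF f] extension_arr(2)[OF g])
    finally show "pull X \<rho> Y \<sigma> (FRel extension (X, \<rho>) (Y, \<sigma>) (Reidx R X A Y B f g \<alpha>)) =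
      pull X \<rho> Y \<sigma> (Reidx S (W X \<rho>) (W A \<rho>') (W Y \<sigma>) (W B \<sigma>') (FArr extension (X, \<rho>) (A, \<rho>') f)
      (FArr extension (Y, \<sigma>) (B, \<sigma>') g) (FRel extension (A, \<rho>') (B, \<sigma>') \<alpha>))" .
  qed
qed

text \<open>
  Reindexing is only lax for composition, so the reindexing of the composite is not known to be small.
  The composite of the direct images is computed instead: the inner factor \<open>\<Gamma>\<^sub>q' ; \<Gamma>\<^sub>q'\<^sup>\<bottom>\<close> equals \<open>F(\<sigma>)\<close> and is absorbed.
\<close>

lemma extension_rcomp:
  assumes r: "rel (qcompl R) (X, \<rho>) (Y, \<sigma>) \<alpha>" and r': "rel (qcompl R) (Y, \<sigma>) (Z, \<tau>) \<beta>"
  shows "rle S (W X \<rho>) (W Z \<tau>)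
    (RComp S (W X \<rho>) (W Y \<sigma>) (W Z \<tau>) (FRel extension (X, \<rho>) (Y, \<sigma>) \<alpha>) (FRel extension (Y, \<sigma>) (Z, \<tau>) \<beta>))
    (FRel extension (X, \<rho>) (Z, \<tau>) (RComp R X Y Z \<alpha> \<beta>))"
proof -
  interpret Q: relational_doctrine "qcompl R" by (rule F.dom.qcompl_relational_doctrine)
  have e: "\<rho> \<in> equiv_rels R X" "\<sigma> \<in> equiv_rels R Y" "\<tau> \<in> equiv_rels R Z"
    and a: "rel R X Y \<alpha>" "rel R Y Z \<beta>" "RComp R X Y Y \<alpha> \<sigma> = \<alpha>"
    using r r' by (simp_all add: F.dom.qcompl_rel)
  note o = F.dom.relD(1,2)[OF a(1)] F.dom.relD(2)[OF a(2)]
  note X = o(1) e(1) and Y = o(2) e(2) and Z = o(3) e(3)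
  have t: "rel (qcompl R) (X, \<rho>) (Z, \<tau>) (RComp R X Y Z \<alpha> \<beta>)"
    using Q.rel_rcomp[OF r r'] by (simp add: qcompl_simps)
  let ?q = "graph S (FObj F X) (W X \<rho>) (q X \<rho>)" and ?q' = "graph S (FObj F Y) (W Y \<sigma>) (q Y \<sigma>)"
    and ?q'' = "graph S (FObj F Z) (W Z \<tau>) (q Z \<tau>)"
  note g = S.rel_graph[OF q_arr[OF X]] S.rel_graph[OF q_arr[OF Y]] S.rel_graph[OF q_arr[OF Z]]
  note u = g g[THEN S.rel_conv] F.rel[OF a(1)] F.rel[OF a(2)] Fr[OF Y]
  let ?\<gamma> = "RComp S (FObj F X) (FObj F Y) (FObj F Z) (FRel F X Y \<alpha>) (FRel F Y Z \<beta>)"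
  have k: "RComp S (FObj F Y) (W Y \<sigma>) (FObj F Y) ?q' (Conv S (FObj F Y) (W Y \<sigma>) ?q') = FRel F Y Y \<sigma>"
    using q_effective[OF Y] by (simp add: S.kernel_eq_reidx[OF q_arr[OF Y], symmetric] kernel_def)
  have "RComp S (W X \<rho>) (W Y \<sigma>) (W Z \<tau>) (FRel extension (X, \<rho>) (Y, \<sigma>) \<alpha>) (FRel extension (Y, \<sigma>) (Z, \<tau>) \<beta>)
    = RComp S (W X \<rho>) (FObj F Z) (W Z \<tau>) (RComp S (W X \<rho>) (FObj F X) (FObj F Z) (Conv S (FObj F X) (W X \<rho>) ?q)
       (RComp S (FObj F X) (FObj F Y) (FObj F Z) (RComp S (FObj F X) (FObj F Y) (FObj F Y) (FRel F X Y \<alpha>)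
         (RComp S (FObj F Y) (W Y \<sigma>) (FObj F Y) ?q' (Conv S (FObj F Y) (W Y \<sigma>) ?q'))) (FRel F Y Z \<beta>))) ?q''"
    unfolding extension_rel_def[OF r] extension_rel_def[OF r'] direct_image_def
    by (simp add: S.reassoc u S.rel_rcomp)
  also have "\<dots> = direct_image S (FObj F X) (W X \<rho>) (FObj F Z) (W Z \<tau>) (q X \<rho>) (q Z \<tau>) ?\<gamma>"
    unfolding k direct_image_def by (simp add: F.rel_absorb_right Y a)
  also have "rle S (W X \<rho>) (W Z \<tau>) \<dots> (FRel extension (X, \<rho>) (Z, \<tau>) (RComp R X Y Z \<alpha> \<beta>))"
    by (subst S.direct_image_le_iff[OF q_arr[OF X] q_arr[OF Z] S.rel_rcomp[OF F.rel[OF a(1)] F.rel[OF a(2)]]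
          extension_rel(1)[OF t]])
      (rule S.square_mono_left[OF F.rcomp_le[OF a(1,2)] extension_rel_square[OF t]])
  finally show ?thesis .
qed

lemma extension_conv:
  assumes r: "rel (qcompl R) (X, \<rho>) (Y, \<sigma>) \<alpha>"
  shows "Conv S (W X \<rho>) (W Y \<sigma>) (FRel extension (X, \<rho>) (Y, \<sigma>) \<alpha>) = FRel extension (Y, \<sigma>) (X, \<rho>) (Conv R X Y \<alpha>)"
proof -
  interpret Q: relational_doctrine "qcompl R" by (rule F.dom.qcompl_relational_doctrine)
  have e: "\<rho> \<in> equiv_rels R X" "\<sigma> \<in> equiv_rels R Y" and a: "rel R X Y \<alpha>" using r by (simp_all add: F.dom.qcompl_rel)
  note o = F.dom.relD(1,2)[OF a]
  note X = o(1) e(1) and Y = o(2) e(2)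
  have t: "rel (qcompl R) (Y, \<sigma>) (X, \<rho>) (Conv R X Y \<alpha>)"
    using Q.rel_conv[OF r] by (simp add: qcompl_simps)
  show ?thesis
    by (rule pull_inject[OF Y X S.rel_conv[OF extension_rel(1)[OF r]] extension_rel(1)[OF t]])
      (simp add: extension_rel(2)[OF t] S.conv_reidx_eq[OF q_arr[OF X] q_arr[OF Y] extension_rel(1)[OF r], symmetric]
        extension_rel(2)[OF r] F.conv[OF a])
qed

lemma one_arrow_extension: "one_arrow (qcompl R) S extension"
proof -
  interpret Q: relational_doctrine "qcompl R" by (rule F.dom.qcompl_relational_doctrine)
  show ?thesis
  proof (rule one_arrowI[OF F.dom.qcompl_relational_doctrine S.relational_doctrine_axioms]; (unfold split_paired_all)?)
    show "FObj extension \<in> extensional (Obj (qcompl R))" by (simp add: extension_def)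
  next
    fix X \<rho> Y \<sigma> f assume "\<not> arr (qcompl R) (X, \<rho>) (Y, \<sigma>) f"
    then show "FArr extension (X, \<rho>) (Y, \<sigma>) f = undefined" by (auto simp: extension_def mk_arr_def arr_def)
  next
    fix X \<rho> Y \<sigma> \<alpha> assume "\<not> rel (qcompl R) (X, \<rho>) (Y, \<sigma>) \<alpha>"
    then show "FRel extension (X, \<rho>) (Y, \<sigma>) \<alpha> = undefined" by (auto simp: extension_def mk_rel_def rel_def)
  next
    fix X \<rho> assume a: "(X, \<rho>) \<in> Obj (qcompl R)"
    then have X: "X \<in> Obj R" "\<rho> \<in> equiv_rels R X" by (simp_all add: qcompl_simps)
    show "FObj extension (X, \<rho>) \<in> Obj S" using X by (simp add: extension_obj W_obj)
    show "rle S (FObj extension (X, \<rho>)) (FObj extension (X, \<rho>)) (Diag S (FObj extension (X, \<rho>)))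
        (FRel extension (X, \<rho>) (X, \<rho>) (Diag (qcompl R) (X, \<rho>)))"
      using X by (simp add: extension_obj qcompl_simps extension_diag S.rle_refl S.rel_diag W_obj)
    have i: "arr (qcompl R) (X, \<rho>) (X, \<rho>) (Ident R X)" using Q.arr_ident[OF a] by (simp add: qcompl_simps)
    have "FArr extension (X, \<rho>) (X, \<rho>) (Ident R X) = Ident S (W X \<rho>)"
      by (rule q_epi[OF X extension_arr(1)[OF i] S.arr_ident[OF W_obj[OF X]]])
        (simp add: extension_arr(2)[OF i] F.ident[OF X(1)] S.ident_left[OF q_arr[OF X]] S.ident_right[OF q_arr[OF X]])
    then show "FArr extension (X, \<rho>) (X, \<rho>) (Ident (qcompl R) (X, \<rho>)) = Ident S (FObj extension (X, \<rho>))"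
      using X by (simp add: qcompl_simps extension_obj)
  next
    fix X \<rho> Y \<sigma> f assume a: "arr (qcompl R) (X, \<rho>) (Y, \<sigma>) f"
    then show "arr S (FObj extension (X, \<rho>)) (FObj extension (Y, \<sigma>)) (FArr extension (X, \<rho>) (Y, \<sigma>) f)"
      using Q.arr_obj[OF a] extension_arr(1)[OF a] by (simp add: extension_obj qcompl_simps)
  next
    fix X \<rho> Y \<sigma> Z \<tau> f g assume f: "arr (qcompl R) (X, \<rho>) (Y, \<sigma>) f" and g: "arr (qcompl R) (Y, \<sigma>) (Z, \<tau>) g"
    have e: "\<rho> \<in> equiv_rels R X" "\<sigma> \<in> equiv_rels R Y" "\<tau> \<in> equiv_rels R Z" and f': "arr R X Y f" and g': "arr R Y Z g"
      using f g by (auto simp: F.dom.qcompl_arr dest: F.dom.squareD(1))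
    note o = F.dom.arr_obj[OF f'] F.dom.arr_obj(2)[OF g']
    note X = o(1) e(1) and Y = o(2) e(2) and Z = o(3) e(3)
    have gf: "arr (qcompl R) (X, \<rho>) (Z, \<tau>) (Comp R X Y Z g f)" using Q.arr_comp[OF f g] by (simp add: qcompl_simps)
    note Ef = extension_arr(1)[OF f] and Eg = extension_arr(1)[OF g]
    have "FArr extension (X, \<rho>) (Z, \<tau>) (Comp R X Y Z g f) =
      Comp S (W X \<rho>) (W Y \<sigma>) (W Z \<tau>) (FArr extension (Y, \<sigma>) (Z, \<tau>) g) (FArr extension (X, \<rho>) (Y, \<sigma>) f)"
    proof (rule q_epi[OF X extension_arr(1)[OF gf] S.arr_comp[OF Ef Eg]])
      have "Comp S (FObj F X) (W X \<rho>) (W Z \<tau>) (Comp S (W X \<rho>) (W Y \<sigma>) (W Z \<tau>)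
          (FArr extension (Y, \<sigma>) (Z, \<tau>) g) (FArr extension (X, \<rho>) (Y, \<sigma>) f)) (q X \<rho>)
        = Comp S (FObj F X) (W Y \<sigma>) (W Z \<tau>) (FArr extension (Y, \<sigma>) (Z, \<tau>) g)
          (Comp S (FObj F X) (FObj F Y) (W Y \<sigma>) (q Y \<sigma>) (FArr F X Y f))"
        by (simp add: S.assoc[OF q_arr[OF X] Ef Eg, symmetric] extension_arr(2)[OF f])
      also have "\<dots> = Comp S (FObj F X) (FObj F Y) (W Z \<tau>)
          (Comp S (FObj F Y) (FObj F Z) (W Z \<tau>) (q Z \<tau>) (FArr F Y Z g)) (FArr F X Y f)"
        by (simp add: S.assoc[OF F.arr[OF f'] q_arr[OF Y] Eg] extension_arr(2)[OF g])
      also have "\<dots> = Comp S (FObj F X) (W X \<rho>) (W Z \<tau>) (FArr extension (X, \<rho>) (Z, \<tau>) (Comp R X Y Z g f)) (q X \<rho>)"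
        by (simp add: extension_arr(2)[OF gf] F.comp[OF f' g'] S.assoc[OF F.arr[OF f'] F.arr[OF g'] q_arr[OF Z]])
      finally show "Comp S (FObj F X) (W X \<rho>) (W Z \<tau>) (FArr extension (X, \<rho>) (Z, \<tau>) (Comp R X Y Z g f)) (q X \<rho>) =
        Comp S (FObj F X) (W X \<rho>) (W Z \<tau>) (Comp S (W X \<rho>) (W Y \<sigma>) (W Z \<tau>)
          (FArr extension (Y, \<sigma>) (Z, \<tau>) g) (FArr extension (X, \<rho>) (Y, \<sigma>) f)) (q X \<rho>)" by simp
    qed
    then show "FArr extension (X, \<rho>) (Z, \<tau>) (Comp (qcompl R) (X, \<rho>) (Y, \<sigma>) (Z, \<tau>) g f) =
        Comp S (FObj extension (X, \<rho>)) (FObj extension (Y, \<sigma>)) (FObj extension (Z, \<tau>))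
          (FArr extension (Y, \<sigma>) (Z, \<tau>) g) (FArr extension (X, \<rho>) (Y, \<sigma>) f)"
      by (simp add: qcompl_simps extension_obj X Y Z)
  next
    fix X \<rho> Y \<sigma> \<alpha> \<beta> assume a: "rle (qcompl R) (X, \<rho>) (Y, \<sigma>) \<alpha> \<beta>"
    then show "rle S (FObj extension (X, \<rho>)) (FObj extension (Y, \<sigma>))
        (FRel extension (X, \<rho>) (Y, \<sigma>) \<alpha>) (FRel extension (X, \<rho>) (Y, \<sigma>) \<beta>)"
      using Q.relD[OF Q.rleD(1)[OF a]] by (simp add: F.dom.qcompl_rle extension_rle extension_obj qcompl_simps)
  next
    fix X \<rho> A \<sigma> Y \<tau> B \<upsilon> f g \<alpha>
    assume a: "arr (qcompl R) (X, \<rho>) (A, \<sigma>) f" "arr (qcompl R) (Y, \<tau>) (B, \<upsilon>) g" "rel (qcompl R) (A, \<sigma>) (B, \<upsilon>) \<alpha>"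
    show "FRel extension (X, \<rho>) (Y, \<tau>) (Reidx (qcompl R) (X, \<rho>) (A, \<sigma>) (Y, \<tau>) (B, \<upsilon>) f g \<alpha>) =
      Reidx S (FObj extension (X, \<rho>)) (FObj extension (A, \<sigma>)) (FObj extension (Y, \<tau>))
        (FObj extension (B, \<upsilon>)) (FArr extension (X, \<rho>) (A, \<sigma>) f) (FArr extension (Y, \<tau>) (B, \<upsilon>) g)
        (FRel extension (A, \<sigma>) (B, \<upsilon>) \<alpha>)"
      using extension_reidx[OF a] Q.arr_obj[OF a(1)] Q.arr_obj[OF a(2)] by (simp add: qcompl_simps extension_obj)
  next
    fix X \<rho> Y \<sigma> Z \<tau> \<alpha> \<beta> assume a: "rel (qcompl R) (X, \<rho>) (Y, \<sigma>) \<alpha>" "rel (qcompl R) (Y, \<sigma>) (Z, \<tau>) \<beta>"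
    show "rle S (FObj extension (X, \<rho>)) (FObj extension (Z, \<tau>))
        (RComp S (FObj extension (X, \<rho>)) (FObj extension (Y, \<sigma>)) (FObj extension (Z, \<tau>))
          (FRel extension (X, \<rho>) (Y, \<sigma>) \<alpha>) (FRel extension (Y, \<sigma>) (Z, \<tau>) \<beta>))
        (FRel extension (X, \<rho>) (Z, \<tau>) (RComp (qcompl R) (X, \<rho>) (Y, \<sigma>) (Z, \<tau>) \<alpha> \<beta>))"
      using extension_rcomp[OF a] Q.relD[OF a(1)] Q.relD[OF a(2)] by (simp add: qcompl_simps extension_obj)
  next
    fix X \<rho> Y \<sigma> \<alpha> assume a: "rel (qcompl R) (X, \<rho>) (Y, \<sigma>) \<alpha>"
    show "rle S (FObj extension (Y, \<sigma>)) (FObj extension (X, \<rho>))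
        (Conv S (FObj extension (X, \<rho>)) (FObj extension (Y, \<sigma>)) (FRel extension (X, \<rho>) (Y, \<sigma>) \<alpha>))
        (FRel extension (Y, \<sigma>) (X, \<rho>) (Conv (qcompl R) (X, \<rho>) (Y, \<sigma>) \<alpha>))"
      using extension_conv[OF a] Q.relD[OF a] S.rle_refl[OF S.rel_conv[OF extension_rel(1)[OF a]]]
      by (simp add: qcompl_simps extension_obj)
  qed
qed

text \<open>
  The identity of \<open>X\<close> as an arrow \<open>(X, \<rho>) \<rightarrow> (X, \<sigma>)\<close> is sent to the induced arrow
  \<open>FX/F(\<rho>) \<rightarrow> FX/F(\<sigma>)\<close>.  An arrow out of \<open>FX/F(\<rho>)\<close> whose kernel contains the image of \<open>\<sigma>\<close> has, after
  composition with the quotient arrow of \<open>F(\<rho>)\<close>, a kernel containing \<open>F(\<sigma>)\<close>; so it factors through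
  \<open>FX/F(\<sigma>)\<close>.
\<close>

lemma quotient_one_arrow_extension: "quotient_one_arrow (qcompl R) S extension"
proof (rule quotient_one_arrowI[OF F.dom.qcompl_with_quotients S.doctrine_with_quotients_axioms one_arrow_extension])
  interpret Q: relational_doctrine "qcompl R" by (rule F.dom.qcompl_relational_doctrine)
  interpret E: one_arrow "qcompl R" S extension by (rule one_arrow_extension)
  fix X' \<sigma> assume a: "X' \<in> Obj (qcompl R)" "\<sigma> \<in> equiv_rels (qcompl R) X'"
  obtain X \<rho> where X': "X' = (X, \<rho>)" by (cases X')
  have X: "X \<in> Obj R" "\<rho> \<in> equiv_rels R X" using a by (simp_all add: X' qcompl_simps)
  note QX = a(1)[unfolded X'] and Q\<sigma> = a(2)[unfolded X']
  note u = F.dom.qcompl_quotient_arrow[OF X Q\<sigma>]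
  note r = Q.equiv_relsD(1)[OF QX Q\<sigma>]
  note i = Q.quotient_arrow_arr[OF u r]
  have s: "\<sigma> \<in> equiv_rels R X" using Q\<sigma> X by (simp add: F.dom.qcompl_equiv_rels)
  note Y = X(1) s
  let ?i = "FArr extension (X, \<rho>) (X, \<sigma>) (Ident R X)"
  note Ei = extension_arr(1)[OF i]
  have iq: "Comp S (FObj F X) (W X \<rho>) (W X \<sigma>) ?i (q X \<rho>) = q X \<sigma>"
    by (simp add: extension_arr(2)[OF i] F.ident X S.ident_right[OF q_arr[OF Y]])
  have "quotient_arrow S (W X \<rho>) (FRel extension (X, \<rho>) (X, \<rho>) \<sigma>) (W X \<sigma>) ?i"
  proof (rule S.quotient_arrowI)
    show "square S (W X \<rho>) (W X \<sigma>) (W X \<rho>) (W X \<sigma>) ?i ?i (FRel extension (X, \<rho>) (X, \<rho>) \<sigma>) (Diag S (W X \<sigma>))"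
      using E.square[OF Q.quotient_arrow_square[OF u r]]
      by (simp add: extension_obj X Y qcompl_simps extension_diag)
  next
    fix Z f assume f: "square S (W X \<rho>) Z (W X \<rho>) Z f f (FRel extension (X, \<rho>) (X, \<rho>) \<sigma>) (Diag S Z)"
    note fa = S.squareD(1)[OF f]
    obtain h where h: "arr S (W X \<sigma>) Z h"
        "Comp S (FObj F X) (W X \<sigma>) Z h (q X \<sigma>) = Comp S (FObj F X) (W X \<rho>) Z f (q X \<rho>)"
      using S.quotient_arrow_factor[OF quot[OF Y] Fr[OF Y] S.square_vertical[OF extension_rel_square[OF r] f]] by blast
    have "Comp S (W X \<rho>) (W X \<sigma>) Z h ?i = f"
      by (rule q_epi[OF X S.arr_comp[OF Ei h(1)] fa])
        (simp add: S.assoc[OF q_arr[OF X] Ei h(1), symmetric] iq h(2))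
    with h(1) show "\<exists>h. arr S (W X \<sigma>) Z h \<and> Comp S (W X \<rho>) (W X \<sigma>) Z h ?i = f" by blast
  next
    fix Z h h' assume h: "arr S (W X \<sigma>) Z h" "arr S (W X \<sigma>) Z h'"
      "Comp S (W X \<rho>) (W X \<sigma>) Z h ?i = Comp S (W X \<rho>) (W X \<sigma>) Z h' ?i"
    show "h = h'"
      by (rule q_epi[OF Y h(1,2)])
        (simp add: iq[symmetric] S.assoc[OF q_arr[OF X] Ei h(1)] S.assoc[OF q_arr[OF X] Ei h(2)] h(3))
  qed
  then show "\<exists>V p. quotient_arrow (qcompl R) X' \<sigma> V p \<and> quotient_arrow S (FObj extension X')
       (FRel extension X' X' \<sigma>) (FObj extension V) (FArr extension X' V p)"
    using u unfolding X' by (intro exI[of _ "(X, \<sigma>)"] exI[of _ "Ident R X"]) (simp add: extension_obj X Y)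
qed

text \<open>
  The comparison arrows of the unit \<open>FX \<rightarrow> FX/F(d)\<close> are the chosen quotient arrows.  The unit
  need not be invertible, because \<open>F\<close> may enlarge the identity relations.
\<close>

lemma universal_arrow_extension:
  "universal_arrow (QRD_hom (qcompl R) S) (RD_hom R S) (restriction R S) F extension
     (\<lambda>X\<in>Obj R. q X (Diag R X))"
proof -
  let ?\<eta> = "\<lambda>X\<in>Obj R. q X (Diag R X)"
  let ?E = "comp_one_arrow R extension (unit_arrow R)"
  have "?\<eta> \<in> two_arrows R S F ?E"
  proof (rule two_arrowsI[OF F.one_arrow_axioms one_arrow_comp[OF F.dom.one_arrow_unit one_arrow_extension]])
    fix X assume "X \<in> Obj R"
    then show "arr S (FObj F X) (FObj ?E X) (?\<eta> X)"
      by (simp add: comp_one_arrow_simps unit_arrow_simps extension_obj F.dom.diag_equiv q_arr)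
  next
    fix X Y f assume f: "arr R X Y f"
    then have "arr (qcompl R) (X, Diag R X) (Y, Diag R Y) f"
      by (simp add: F.dom.qcompl_arr F.dom.square_diag F.dom.diag_equiv F.dom.arr_obj)
    with f extension_arr(2)[OF this]
    show "Comp S (FObj F X) (FObj F Y) (FObj ?E Y) (?\<eta> Y) (FArr F X Y f) =
      Comp S (FObj F X) (FObj ?E X)
        (FObj ?E Y)
        (FArr ?E X Y f) (?\<eta> X)"
      by (simp add: comp_one_arrow_simps unit_arrow_simps extension_obj F.dom.diag_equiv F.dom.arr_obj)
  next
    fix X Y \<alpha> assume a: "rel R X Y \<alpha>"
    then have "rel (qcompl R) (X, Diag R X) (Y, Diag R Y) \<alpha>"
      by (simp add: F.dom.qcompl_rel F.dom.diag_equiv F.dom.relD F.dom.diag_left F.dom.diag_right)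
    with a extension_rel_square[OF this]
    show "square S (FObj F X) (FObj ?E X) (FObj F Y)
      (FObj ?E Y) (?\<eta> X) (?\<eta> Y) (FRel F X Y \<alpha>)
      (FRel ?E X Y \<alpha>)"
      by (simp add: comp_one_arrow_simps unit_arrow_simps extension_obj F.dom.diag_equiv F.dom.relD)
  qed simp
  then interpret E: arrow_into_restriction R S F extension ?\<eta>
    by (intro arrow_into_restriction.intro arrow_into_restriction_axioms.intro F.one_arrow_axioms
        quotient_one_arrow_extension)
  have c: "E.comparison X \<rho> = q X \<rho>" if X: "X \<in> Obj R" "\<rho> \<in> equiv_rels R X" for X \<rho>
    using X extension_arr(2)[OF F.dom.qcompl_unit_quotient(3)[OF X]] S.ident_right[OF q_arr[OF X]]
    by (simp add: E.comparison_def extension_obj F.dom.diag_equiv F.ident)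
  show ?thesis
  proof (rule universal_arrow_of_quotients[OF E.arrow_into_restriction_axioms])
    fix X \<rho> assume "X \<in> Obj R" "\<rho> \<in> equiv_rels R X"
    then show "quotient_arrow S (FObj F X) (FRel F X X \<rho>) (FObj extension (X, \<rho>)) (E.comparison X \<rho>)"
      by (simp add: c extension_obj quot)
  next
    fix X \<rho> Y \<sigma> \<alpha> assume r: "rel (qcompl R) (X, \<rho>) (Y, \<sigma>) \<alpha>"
    then have e: "\<rho> \<in> equiv_rels R X" "\<sigma> \<in> equiv_rels R Y" and r': "rel R X Y \<alpha>" by (simp_all add: F.dom.qcompl_rel)
    then show "rle S (FObj F X) (FObj F Y) (Reidx S (FObj F X) (FObj extension (X, \<rho>)) (FObj F Y) (FObj extension (Y, \<sigma>))
        (E.comparison X \<rho>) (E.comparison Y \<sigma>) (FRel extension (X, \<rho>) (Y, \<sigma>) \<alpha>)) (FRel F X Y \<alpha>)"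
      using F.dom.relD(1,2)[OF r'] by (simp add: c extension_obj extension_rel(2)[OF r] S.rle_refl F.rel)
  qed
qed

end

section \<open>The lax adjunction\<close>

lemma universal_arrow_exists:
  assumes S: "doctrine_with_quotients S" and F: "one_arrow R S F"
  shows "\<exists>H \<eta>. universal_arrow (QRD_hom (qcompl R) S) (RD_hom R S) (restriction R S) F H \<eta>"
proof -
  interpret S: doctrine_with_quotients S by fact
  interpret F: one_arrow R S F by fact
  have "\<forall>X \<rho>. \<exists>W q. X \<in> Obj R \<and> \<rho> \<in> equiv_rels R X \<longrightarrow> quotient_arrow S (FObj F X) (FRel F X X \<rho>) W q"
    using S.has_quotients F.obj F.equiv by blast
  then obtain W q where "\<And>X \<rho>. \<lbrakk>X \<in> Obj R; \<rho> \<in> equiv_rels R X\<rbrakk>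
      \<Longrightarrow> quotient_arrow S (FObj F X) (FRel F X X \<rho>) (W X \<rho>) (q X \<rho>)"
    by metis
  then interpret quotient_extension R S F W q by unfold_locales
  show ?thesis using universal_arrow_extension by blast
qed

theorem theorem3p15:
  fixes R :: "('o1, 'a1, 'r1) doctrine" and R' :: "('o2, 'a2, 'r2) doctrine"
    and R'' :: "('o3, 'a3, 'r3) doctrine"
    and S :: "('p1, 'b1, 's1) doctrine" and S' :: "('p2, 'b2, 's2) doctrine"
    and S'' :: "('p3, 'b3, 's3) doctrine"
  assumes "relational_doctrine R" and "relational_doctrine R'" and "relational_doctrine R''"
    and "doctrine_with_quotients S" and "doctrine_with_quotients S'"
    and "doctrine_with_quotients S''"
  shows "Q_two_functorial R R' R'' \<and> Uq_two_functorial S S' S'' \<and>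
    one_arrow R (qcompl R) (unit_arrow R) \<and>
    has_reflection_left_adjoint (QRD_hom (qcompl R) S) (RD_hom R S)
      (comp_functor (QRD_hom (qcompl R) S)
         (precomp R (qcompl R) S (unit_arrow R)) (Uq_hom (qcompl R) S))"
proof (intro conjI)
  show "Q_two_functorial R R' R''"
    unfolding Q_two_functorial_def using assms
    by (simp add: relational_doctrine.qcompl_with_quotients Q_hom_functor Q_one_id RD_hom_simps Q_one_comp Q_two_hcomp)
  show "Uq_two_functorial S S' S''"
    unfolding Uq_two_functorial_def using assms
    by (simp add: Uq_hom_functor QRD_hom_simps quotient_one_arrow_id quotient_one_arrow_comp)
  show "one_arrow R (qcompl R) (unit_arrow R)" using assms(1) by (rule relational_doctrine.one_arrow_unit)
  show "has_reflection_left_adjoint (QRD_hom (qcompl R) S) (RD_hom R S) (restriction R S)"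
  proof (rule reflection_of_universal_arrows[OF restriction_functor[OF assms(1)]])
    fix F assume "F \<in> Obj (RD_hom R S)"
    then show "\<exists>H \<eta>. universal_arrow (QRD_hom (qcompl R) S) (RD_hom R S) (restriction R S) F H \<eta>"
      using universal_arrow_exists[OF assms(4)] by (simp add: RD_hom_simps)
  next
    fix G assume "G \<in> Obj (QRD_hom (qcompl R) S)"
    then show "universal_arrow (QRD_hom (qcompl R) S) (RD_hom R S) (restriction R S) (FObj (restriction R S) G) G
      (Ident (RD_hom R S) (FObj (restriction R S) G))"
      by (intro universal_arrow_ident assms(1)) (simp add: QRD_hom_simps)
  qed
qed

end
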